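(* Let $X(w)$ be a Schubert variety in $G_{2,N}$. Then $X(w)$ is a spherical $L_w$-variety.
   Context: Everything is over $\mathbb{C}$, and $N>2$. $G_{2,N}$ is the Grassmannian of $2$-dimensional subspaces of $\mathbb{C}^N$ with its left $GL_N$-action, embedded in $\mathbb{P}(\bigwedge^2\mathbb{C}^N)$ by the Plücker embedding. $B\subset GL_N$ is the group of upper triangular matrices. For $w=(\ell_1,\ell_2)$ with $1\le\ell_1<\ell_2\le N$, the Schubert variety is $X(w)=\overline{B[e_{\ell_1}\wedge e_{\ell_2}]}$ with reduced structure. $Q_w\supseteq B$ is the stabilizer of $X(w)$ in $GL_N$ under left multiplication, a parabolic subgroup, and $L_w$ is its Levi part (the block diagonal Levi subgroup containing the diagonal torus). For a connected reductive group $G$ with Borel subgroup $B_G$, an irreducible $G$-variety is a spherical $G$-variety if it is normal and has an open dense $B_G$-orbit. *)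

theory Defs
  imports
    "HOL-Algebra.Solvable_Groups"
    "HOL-Analysis.Abstract_Topology"
    "Jordan_Normal_Form.VS_Connect"
begin

section \<open>Polynomial functions and Zariski topologies\<close>

inductive_set poly_fun :: "nat \<Rightarrow> (complex mat \<Rightarrow> complex) set" for N :: nat where
  const: "(\<lambda>A. c) \<in> poly_fun N"
| coord: "i < N \<Longrightarrow> j < N \<Longrightarrow> (\<lambda>A. A $$ (i, j)) \<in> poly_fun N"
| add: "f \<in> poly_fun N \<Longrightarrow> g \<in> poly_fun N \<Longrightarrow> (\<lambda>A. f A + g A) \<in> poly_fun N"
| mult: "f \<in> poly_fun N \<Longrightarrow> g \<in> poly_fun N \<Longrightarrow> (\<lambda>A. f A * g A) \<in> poly_fun N"

definition hom_poly_fun :: "nat \<Rightarrow> nat \<Rightarrow> (complex mat \<Rightarrow> complex) set" where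
  "hom_poly_fun N d =
     {f \<in> poly_fun N. \<forall>c. \<forall>A \<in> carrier_mat N N. f (c \<cdot>\<^sub>m A) = c ^ d * f A}"

definition line :: "complex mat \<Rightarrow> complex mat set" where
  "line A = range (\<lambda>c. c \<cdot>\<^sub>m A)"

text \<open>The second exterior power of \<open>\<complex>\<^sup>N\<close> is realised as the space of skew-symmetric
  \<open>N \<times> N\<close> matrices: the bivector with Pluecker coordinates \<open>p\<^sub>i\<^sub>j\<close> is the matrix \<open>(p\<^sub>i\<^sub>j)\<close>, and
  \<open>v \<and> w\<close> is \<open>v w\<^sup>T - w v\<^sup>T\<close>. A point of its projective space is a one-dimensional linear
  subspace (so the zero matrix is an element of every point).\<close>

definition wedge :: "nat \<Rightarrow> complex vec \<Rightarrow> complex vec \<Rightarrow> complex mat" where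
  "wedge N v w = mat N N (\<lambda>(i, j). v $ i * w $ j - w $ i * v $ j)"

definition proj_space :: "nat \<Rightarrow> complex mat set set" where
  "proj_space N =
     {line A | A. A \<in> carrier_mat N N \<and> transpose_mat A = - A \<and> A \<noteq> 0\<^sub>m N N}"

definition zariski :: "nat \<Rightarrow> complex mat set topology" where
  "zariski N = topology_generated_by
     {{p \<in> proj_space N. \<exists>A \<in> p. f A \<noteq> 0} | f d. f \<in> hom_poly_fun N d}"

definition GL :: "nat \<Rightarrow> complex mat monoid" where
  "GL N = units_of (ring_mat TYPE(complex) N ())"

definition zariski_GL :: "nat \<Rightarrow> complex mat topology" where
  "zariski_GL N = topology_generated_by
     {{A \<in> carrier (GL N). f A \<noteq> 0} | f. f \<in> poly_fun N}"


section \<open>Varieties and normality\<close>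

definition irreducible_space :: "'a topology \<Rightarrow> bool" where
  "irreducible_space T \<longleftrightarrow> topspace T \<noteq> {} \<and>
     (\<forall>U V. openin T U \<and> openin T V \<and> U \<noteq> {} \<and> V \<noteq> {} \<longrightarrow> U \<inter> V \<noteq> {})"

text \<open>Irreducible quasi-projective varieties in the projective space above.\<close>

definition irreducible_variety :: "nat \<Rightarrow> complex mat set set \<Rightarrow> bool" where
  "irreducible_variety N X \<longleftrightarrow>
     (\<exists>U C. openin (zariski N) U \<and> closedin (zariski N) C \<and> X = U \<inter> C) \<and>
     irreducible_space (subtopology (zariski N) X)"

definition regular_on ::
  "nat \<Rightarrow> complex mat set set \<Rightarrow> complex mat set set \<Rightarrow> (complex mat set \<Rightarrow> complex) \<Rightarrow> bool" where
  "regular_on N X U \<phi> \<longleftrightarrow> openin (subtopology (zariski N) X) U \<and>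
     (\<forall>p \<in> U. \<exists>V d f g. openin (subtopology (zariski N) X) V \<and> p \<in> V \<and> V \<subseteq> U \<and>
        f \<in> hom_poly_fun N d \<and> g \<in> hom_poly_fun N d \<and>
        (\<forall>q \<in> V. \<forall>A \<in> q. A \<noteq> 0\<^sub>m N N \<longrightarrow> g A \<noteq> 0 \<and> \<phi> q = f A / g A))"

text \<open>For an irreducible variety \<open>X\<close>, an element of the function field is represented by a
  regular function \<open>\<phi>\<close> on a nonempty open set \<open>U\<close>, two such being equal iff they agree on the
  intersection of their domains; the local ring at \<open>p\<close> consists of the elements represented
  on a neighbourhood of \<open>p\<close>. Finitely many elements of the local ring have a common such
  neighbourhood, which is \<open>W\<close> below.\<close>

definition in_local_ring ::
  "nat \<Rightarrow> complex mat set set \<Rightarrow> complex mat set \<Rightarrow> complex mat set set \<Rightarrow>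
   (complex mat set \<Rightarrow> complex) \<Rightarrow> bool" where
  "in_local_ring N X p U \<phi> \<longleftrightarrow>
     (\<exists>V \<psi>. p \<in> V \<and> regular_on N X V \<psi> \<and> (\<forall>q \<in> U \<inter> V. \<phi> q = \<psi> q))"

definition integral_over_local_ring ::
  "nat \<Rightarrow> complex mat set set \<Rightarrow> complex mat set \<Rightarrow> complex mat set set \<Rightarrow>
   (complex mat set \<Rightarrow> complex) \<Rightarrow> bool" where
  "integral_over_local_ring N X p U \<phi> \<longleftrightarrow>
     (\<exists>W n c. p \<in> W \<and> openin (subtopology (zariski N) X) W \<and>
        (\<forall>i<n. regular_on N X W (c i)) \<and>
        (\<forall>q \<in> U \<inter> W. \<phi> q ^ n + (\<Sum>i<n. c i q * \<phi> q ^ i) = 0))"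

definition normal_variety :: "nat \<Rightarrow> complex mat set set \<Rightarrow> bool" where
  "normal_variety N X \<longleftrightarrow> irreducible_variety N X \<and>
     (\<forall>p \<in> X. \<forall>U \<phi>. U \<noteq> {} \<and> regular_on N X U \<phi> \<and> integral_over_local_ring N X p U \<phi> \<longrightarrow>
        in_local_ring N X p U \<phi>)"


section \<open>Linear algebraic groups and spherical varieties\<close>

definition closed_subgroup :: "nat \<Rightarrow> complex mat set \<Rightarrow> bool" where
  "closed_subgroup N H \<longleftrightarrow> subgroup H (GL N) \<and> closedin (zariski_GL N) H"

definition unipotent :: "nat \<Rightarrow> complex mat set \<Rightarrow> bool" where
  "unipotent N H \<longleftrightarrow> (\<forall>u \<in> H. \<exists>k. (u - 1\<^sub>m N) ^\<^sub>m k = 0\<^sub>m N N)"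

definition connected_reductive :: "nat \<Rightarrow> complex mat set \<Rightarrow> bool" where
  "connected_reductive N G \<longleftrightarrow> closed_subgroup N G \<and> connectedin (zariski_GL N) G \<and>
     (\<forall>U. closed_subgroup N U \<and> U \<lhd> (GL N)\<lparr>carrier := G\<rparr> \<and>
        connectedin (zariski_GL N) U \<and> unipotent N U \<longrightarrow> U = {1\<^sub>m N})"

definition connected_solvable :: "nat \<Rightarrow> complex mat set \<Rightarrow> bool" where
  "connected_solvable N H \<longleftrightarrow> closed_subgroup N H \<and> connectedin (zariski_GL N) H \<and>
     solvable ((GL N)\<lparr>carrier := H\<rparr>)"

definition borel_subgroup :: "nat \<Rightarrow> complex mat set \<Rightarrow> complex mat set \<Rightarrow> bool" where
  "borel_subgroup N G H \<longleftrightarrow> H \<subseteq> G \<and> connected_solvable N H \<and>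
     (\<forall>H'. H \<subseteq> H' \<and> H' \<subseteq> G \<and> connected_solvable N H' \<longrightarrow> H' = H)"

text \<open>On skew-symmetric matrices \<open>g\<close> acts by \<open>A \<mapsto> g A g\<^sup>T\<close>, so that
  \<open>v \<and> w \<mapsto> g v \<and> g w\<close>.\<close>

definition act :: "complex mat \<Rightarrow> complex mat set \<Rightarrow> complex mat set" where
  "act g p = (\<lambda>A. g * A * transpose_mat g) ` p"

definition orbit_of :: "complex mat set \<Rightarrow> complex mat set \<Rightarrow> complex mat set set" where
  "orbit_of H p = (\<lambda>g. act g p) ` H"

text \<open>All Borel subgroups of \<open>G\<close> are conjugate, so it does not matter which one is taken.\<close>

definition spherical_variety :: "nat \<Rightarrow> complex mat set \<Rightarrow> complex mat set set \<Rightarrow> bool" where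
  "spherical_variety N G X \<longleftrightarrow>
     connected_reductive N G \<and>
     irreducible_variety N X \<and> (\<forall>g \<in> G. act g ` X \<subseteq> X) \<and>
     normal_variety N X \<and>
     (\<exists>H. borel_subgroup N G H \<and>
        (\<exists>p \<in> X. openin (subtopology (zariski N) X) (orbit_of H p) \<and>
                 subtopology (zariski N) X closure_of orbit_of H p = X))"


section \<open>Schubert varieties in the Grassmannian of planes\<close>

definition grassmannian2 :: "nat \<Rightarrow> complex vec set set" where
  "grassmannian2 N =
     {W. VectorSpace.subspace class_ring W (module_vec TYPE(complex) N) \<and>
         vectorspace.dim class_ring ((module_vec TYPE(complex) N)\<lparr>carrier := W\<rparr>) = 2}"

text \<open>For a plane \<open>W\<close> every element of its second exterior power is of the form \<open>v \<and> w\<close>,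
  so the following set is the line which is the image of \<open>W\<close> in the projective space.\<close>

definition pluecker :: "nat \<Rightarrow> complex vec set \<Rightarrow> complex mat set" where
  "pluecker N W = {wedge N v w | v w. v \<in> W \<and> w \<in> W}"

definition upper_borel :: "nat \<Rightarrow> complex mat set" where
  "upper_borel N = {g \<in> carrier (GL N). upper_triangular g}"

text \<open>Indices \<open>l1\<close>, \<open>l2\<close> run through \<open>1, \<dots>, N\<close>, whereas matrix and vector entries are
  numbered from \<open>0\<close>.\<close>

definition schubert :: "nat \<Rightarrow> nat \<Rightarrow> nat \<Rightarrow> complex mat set set" where
  "schubert N l1 l2 =
     subtopology (zariski N) (pluecker N ` grassmannian2 N) closure_of
       orbit_of (upper_borel N) (line (wedge N (unit_vec N (l1 - 1)) (unit_vec N (l2 - 1))))"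

definition set_stabilizer :: "nat \<Rightarrow> complex mat set set \<Rightarrow> complex mat set" where
  "set_stabilizer N X = {g \<in> carrier (GL N). act g ` X = X}"

text \<open>A parabolic subgroup \<open>Q\<close> containing the upper triangular matrices is the group of
  invertible block upper triangular matrices for the partition of the indices cut out by those
  \<open>0 < d < N\<close> for which \<open>Q\<close> stabilises the span of the first \<open>d\<close> unit vectors. Its Levi
  subgroup containing the diagonal torus consists of the block diagonal matrices for the same
  partition.\<close>

definition block_steps :: "nat \<Rightarrow> complex mat set \<Rightarrow> nat set" where
  "block_steps N Q =
     {d. 0 < d \<and> d < N \<and> (\<forall>g \<in> Q. \<forall>i j. j < d \<and> d \<le> i \<and> i < N \<longrightarrow> g $$ (i, j) = 0)}"

definition levi_subgroup :: "nat \<Rightarrow> complex mat set \<Rightarrow> complex mat set" where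
  "levi_subgroup N Q =
     {g \<in> carrier (GL N). \<forall>i<N. \<forall>j<N. g $$ (i, j) \<noteq> 0 \<longrightarrow>
        (\<forall>d \<in> block_steps N Q. i < d \<longleftrightarrow> j < d)}"

end

theory Submission
  imports Defs "HOL-Computational_Algebra.Polynomial_Factorial" "HOL-Computational_Algebra.Field_as_Ring"
    "Jordan_Normal_Form.Schur_Decomposition"
begin

text \<open>Put \<open>a = l1\<close>, \<open>b = l2\<close>, and let \<open>E d\<close> be the span of the first \<open>d\<close> unit vectors. The Schubert
  variety \<open>X\<close> consists of the planes contained in \<open>E b\<close> that meet \<open>E a\<close>, that is, of the points
  \<open>v \<and> w\<close> with \<open>v \<in> E a\<close> and \<open>w \<in> E b\<close> (\<open>schubert_eq_planes\<close>). It is cut out by the quadratic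
  Pluecker relations and the vanishing of coordinates (\<open>planesI_rel\<close>), and it is irreducible
  because \<open>(v, w)\<close> ranges over an affine space.

  \<^emph>\<open>Normality.\<close> On the open set where the coordinate \<open>(i, j)\<close> does not vanish, \<open>X\<close> is the image of
  an affine space under a polynomial map \<open>\<sigma>\<close>. Near a plane not contained in \<open>E a\<close> the map \<open>\<sigma>\<close> is
  an isomorphism. Near a plane inside \<open>E a\<close> the variety is an affine space times the cone of
  \<open>2 \<times> (b - a)\<close> matrices \<open>s t\<^sup>T\<close> of rank at most one, and \<open>\<sigma>\<close> sends \<open>(s, t)\<close> to \<open>s t\<^sup>T\<close>. A rational
  function on \<open>X\<close> that is integral over a local ring becomes, after multiplication by a
  denominator which is nonzero at the point, integral over the polynomials on the affine space.
  These are integrally closed (\<open>polyf_integrally_closed\<close>), so it pulls back to a polynomial \<open>h\<close>.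
  Being constant on the fibres of \<open>\<sigma>\<close>, this \<open>h\<close> is invariant under \<open>(s, t) \<mapsto> (c s, t / c)\<close> and
  hence a polynomial in the entries of \<open>s t\<^sup>T\<close> (\<open>torus_invariant_imp_inv_poly\<close>), which are
  coordinates on \<open>X\<close>. The locale \<open>polynomial_chart\<close> isolates what is used of \<open>\<sigma>\<close>.

  \<^emph>\<open>Groups.\<close> The stabilizer of \<open>X\<close> preserves \<open>E b\<close> and, unless \<open>b = a + 1\<close>, also \<open>E a\<close>, and it
  preserves no other coordinate subspace; if \<open>b = a + 1\<close> then \<open>X\<close> is the Grassmannian of all planes
  in \<open>E b\<close>. So the Levi subgroup is a group of block diagonal matrices with steps among \<open>a, b\<close>
  and acts on \<open>X\<close>. That such a group is reductive follows from a computation with traces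
  (\<open>tr_transv_conj\<close>), and that its upper triangular matrices form a Borel subgroup follows because
  every larger subgroup contains two opposite root subgroups (\<open>borel_maximal\<close>).

  \<^emph>\<open>The open orbit.\<close> Points of \<open>X\<close> whose coordinates \<open>(a, b)\<close> and, for \<open>a > 1\<close>, \<open>(a - 1, a)\<close> do
  not vanish lie in a single orbit of the upper triangular matrices that are block diagonal for the
  steps \<open>a, b\<close> (\<open>open_orbit_point\<close>). An orbit that contains a nonempty open set
  is open, and by irreducibility it is dense.\<close>

section \<open>Polynomial functions on affine space are integrally closed\<close>

inductive_set polyf :: "(('i \<Rightarrow> complex) \<Rightarrow> complex) set" where
  const: "(\<lambda>y. c) \<in> polyf"
| var: "(\<lambda>y. y i) \<in> polyf"
| add: "f \<in> polyf \<Longrightarrow> g \<in> polyf \<Longrightarrow> (\<lambda>y. f y + g y) \<in> polyf"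
| mult: "f \<in> polyf \<Longrightarrow> g \<in> polyf \<Longrightarrow> (\<lambda>y. f y * g y) \<in> polyf"

lemma polyf_sum: "(\<And>k. k \<in> K \<Longrightarrow> f k \<in> polyf) \<Longrightarrow> (\<lambda>y. \<Sum>k\<in>K. f k y) \<in> polyf"
  by (induction K rule: infinite_finite_induct) (auto intro: polyf.intros)

lemma polyf_prod: "(\<And>k. k \<in> K \<Longrightarrow> f k \<in> polyf) \<Longrightarrow> (\<lambda>y. \<Prod>k\<in>K. f k y) \<in> polyf"
  by (induction K rule: infinite_finite_induct) (auto intro: polyf.intros)

lemma polyf_power: "f \<in> polyf \<Longrightarrow> (\<lambda>y. f y ^ n) \<in> polyf"
  by (induction n) (auto intro: polyf.intros)

lemma polyf_uminus: "f \<in> polyf \<Longrightarrow> (\<lambda>y. - f y) \<in> polyf"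
  using polyf.mult[OF polyf.const[of "-1"], of f] by simp

lemma polyf_diff: "f \<in> polyf \<Longrightarrow> g \<in> polyf \<Longrightarrow> (\<lambda>y. f y - g y) \<in> polyf"
  using polyf.add[OF _ polyf_uminus, of f g] by simp

lemmas polyf_rules = polyf.intros polyf_sum polyf_prod polyf_power polyf_uminus polyf_diff

lemma polyf_subst:
  assumes "f \<in> polyf" "\<And>i. (\<lambda>y. \<sigma> y i) \<in> polyf"
  shows "(\<lambda>y. f (\<sigma> y)) \<in> polyf"
  using assms(1) by induction (auto intro: polyf.intros assms(2))

text \<open>\<open>F v\<close> is the restriction of \<open>f\<close> to the line through \<open>x\<close> in direction \<open>v\<close>. What matters is that
  its coefficients depend polynomially on \<open>v\<close> and that its degree is bounded independently of \<open>v\<close>.\<close>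

definition line_poly ::
  "('i \<Rightarrow> complex) \<Rightarrow> (('i \<Rightarrow> complex) \<Rightarrow> complex) \<Rightarrow> (('i \<Rightarrow> complex) \<Rightarrow> complex poly) \<Rightarrow> bool" where
  "line_poly x f F \<longleftrightarrow> (\<forall>v t. poly (F v) t = f (\<lambda>i. x i + t * v i)) \<and>
     (\<forall>k. (\<lambda>v. coeff (F v) k) \<in> polyf) \<and> (\<exists>d. \<forall>v. degree (F v) \<le> d)"

lemma line_poly_exists:
  assumes "f \<in> polyf"
  shows "\<exists>F. line_poly x f F"
  using assms
proof induction
  case (const c)
  show ?case
    by (rule exI[of _ "\<lambda>v. [:c:]"]) (auto simp: line_poly_def coeff_pCons split: nat.split intro: polyf.intros)
next
  case (var i)
  have "(\<lambda>v. coeff [:x i, v i:] k) \<in> polyf" for k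
    by (cases k; cases "k - 1") (auto simp: coeff_pCons intro: polyf.intros)
  moreover have "degree [:x i, v i:] \<le> 1" for v :: "'a \<Rightarrow> complex"
    by (simp add: degree_pCons_le)
  ultimately show ?case
    by (intro exI[of _ "\<lambda>v. [:x i, v i:]"]) (auto simp: line_poly_def)
next
  case (add f g)
  then obtain F G where F: "line_poly x f F" and G: "line_poly x g G" by blast
  from F G obtain d e where "\<And>v. degree (F v) \<le> d" "\<And>v. degree (G v) \<le> e"
    unfolding line_poly_def by blast
  then have "degree (F v + G v) \<le> max d e" for v
    by (meson degree_add_le max.coboundedI1 max.coboundedI2)
  with F G show ?case
    by (intro exI[of _ "\<lambda>v. F v + G v"]) (auto simp: line_poly_def intro: polyf.intros)
next
  case (mult f g)
  then obtain F G where F: "line_poly x f F" and G: "line_poly x g G" by blast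
  from F G obtain d e where "\<And>v. degree (F v) \<le> d" "\<And>v. degree (G v) \<le> e"
    unfolding line_poly_def by blast
  then have "degree (F v * G v) \<le> d + e" for v
    by (meson degree_mult_le order_trans add_mono)
  with F G show ?case
    by (intro exI[of _ "\<lambda>v. F v * G v"])
      (auto simp: line_poly_def coeff_mult intro!: polyf_rules)
qed

text \<open>Along the line through \<open>y1\<close> and \<open>y2\<close> both functions are nonzero polynomials in one variable, so
  their product is one too. This is the source of all irreducibility statements below.\<close>

lemma polyf_nonzero_both:
  assumes "f \<in> polyf" "g \<in> polyf" "f y1 \<noteq> 0" "g y2 \<noteq> 0"
  shows "\<exists>y. f y \<noteq> 0 \<and> g y \<noteq> 0"
proof -
  obtain F G where F: "line_poly y1 f F" and G: "line_poly y1 g G"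
    using line_poly_exists assms by metis
  let ?v = "\<lambda>i. y2 i - y1 i"
  have "poly (F ?v) 0 \<noteq> 0" "poly (G ?v) 1 \<noteq> 0"
    using F G assms(3,4) by (auto simp: line_poly_def)
  then have "F ?v * G ?v \<noteq> 0" by auto
  then obtain t where "poly (F ?v * G ?v) t \<noteq> 0"
    using poly_all_0_iff_0 by blast
  then show ?thesis using F G by (auto simp: line_poly_def)
qed

lemma polyf_eq_zero_if_generic:
  assumes "f \<in> polyf" "e \<in> polyf" "e y0 \<noteq> 0" "\<And>y. e y \<noteq> 0 \<Longrightarrow> f y = 0"
  shows "f y = 0"
  using polyf_nonzero_both[OF assms(1,2) _ assms(3)] assms(4) by blast

text \<open>Divisibility can be tested on the lines through a point \<open>x\<close> where the divisor does not vanish: the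
  quotient on the line in direction \<open>v\<close> is the power series \<open>f / g\<close> expanded at \<open>x\<close>, whose
  coefficients arise by the recursion for division by a series with constant term \<open>g x\<close> and are
  therefore polynomials in \<open>v\<close>.\<close>

lemma polyf_dvd_if_dvd_on_lines:
  assumes g: "g \<in> polyf"
    and F: "line_poly x f F" and G: "line_poly x g G"
    and gx: "g x \<noteq> 0" and dvd: "\<And>v. G v dvd F v"
  shows "\<exists>h \<in> polyf. \<forall>y. f y = g y * h y"
proof -
  define H where "H v = F v div G v" for v
  have FGH: "F v = G v * H v" for v
    using dvd by (simp add: H_def)
  have G0: "coeff (G v) 0 = g x" for v
    using G[unfolded line_poly_def, THEN conjunct1, rule_format, of v 0] by (simp add: poly_0_coeff_0)
  have H_coeff: "(\<lambda>v. coeff (H v) k) \<in> polyf" for k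
  proof (induction k rule: less_induct)
    case (less k)
    have "coeff (H v) k =
        inverse (g x) * (coeff (F v) k - (\<Sum>i\<in>{1..k}. coeff (G v) i * coeff (H v) (k - i)))" for v
    proof -
      have "coeff (F v) k = (\<Sum>i\<le>k. coeff (G v) i * coeff (H v) (k - i))"
        unfolding FGH by (simp add: coeff_mult)
      also have "{..k} = insert 0 {1..k}" by auto
      finally show ?thesis using gx by (simp add: G0 field_simps)
    qed
    moreover have "(\<lambda>v. inverse (g x) * (coeff (F v) k - (\<Sum>i\<in>{1..k}. coeff (G v) i * coeff (H v) (k - i)))) \<in> polyf"
      using F G less by (intro polyf_rules) (auto simp: line_poly_def)
    ultimately show ?case by simp
  qed
  obtain d where d: "degree (F v) \<le> d" for v
    using F by (auto simp: line_poly_def)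
  have degH: "degree (H v) \<le> d" for v
  proof (cases "H v = 0")
    case False
    have "G v \<noteq> 0" using G0[of v] gx by auto
    with False have "degree (H v) \<le> degree (F v)"
      by (simp add: FGH[of v] degree_mult_eq)
    then show ?thesis using d[of v] by simp
  qed simp
  define h where "h y = (\<Sum>k\<le>d. coeff (H (\<lambda>i. y i - x i)) k)" for y
  have "h \<in> polyf"
    unfolding h_def by (intro polyf_sum polyf_subst[OF H_coeff] polyf_rules)
  moreover have "f y = g y * h y" for y
  proof -
    let ?v = "\<lambda>i. y i - x i"
    have "poly (H ?v) 1 = h y"
      unfolding h_def poly_altdef using degH[of ?v]
      by (auto intro!: sum.mono_neutral_left intro: le_degree)
    moreover have "poly (F ?v) 1 = f y" "poly (G ?v) 1 = g y"
      using F G by (auto simp: line_poly_def)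
    ultimately show ?thesis using FGH[of ?v] by (metis poly_mult)
  qed
  ultimately show ?thesis by blast
qed

text \<open>The rational root theorem: in lowest terms, the denominator divides a power of the numerator.\<close>

lemma dvd_if_integral:
  fixes f g :: "complex poly"
  assumes "g \<noteq> 0" and eq: "f ^ n + (\<Sum>k<n. a k * g ^ (n - k) * f ^ k) = 0"
  shows "g dvd f"
proof -
  define d where "d = gcd f g"
  obtain f' g' where f': "f = d * f'" and g': "g = d * g'" and cop: "coprime f' g'"
    using gcd_coprime_exists[of f g] assms(1) unfolding d_def by (auto simp: mult.commute)
  have d0: "d \<noteq> 0" using assms(1) g' by auto
  have "(\<Sum>k<n. a k * g ^ (n - k) * f ^ k) = d ^ n * (\<Sum>k<n. a k * g' ^ (n - k) * f' ^ k)"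
    unfolding sum_distrib_left
  proof (rule sum.cong)
    fix k assume "k \<in> {..<n}"
    then have "d ^ n = d ^ (n - k) * d ^ k" by (simp flip: power_add)
    then show "a k * g ^ (n - k) * f ^ k = d ^ n * (a k * g' ^ (n - k) * f' ^ k)"
      by (simp add: f' g' power_mult_distrib algebra_simps)
  qed simp
  then have "d ^ n * (f' ^ n + (\<Sum>k<n. a k * g' ^ (n - k) * f' ^ k)) = 0"
    using eq by (simp add: f' power_mult_distrib algebra_simps)
  then have "f' ^ n + (\<Sum>k<n. a k * g' ^ (n - k) * f' ^ k) = 0" using d0 by simp
  moreover have "g' dvd (\<Sum>k<n. a k * g' ^ (n - k) * f' ^ k)"
    by (intro dvd_sum) (auto intro!: dvd_mult2 dvd_mult dvd_power)
  ultimately have "g' dvd f' ^ n"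
    using dvd_add_left_iff[of g' "\<Sum>k<n. a k * g' ^ (n - k) * f' ^ k" "f' ^ n"] by simp
  then have "is_unit g'"
    using coprime_common_divisor[of "f' ^ n" g' g'] cop by simp
  then show ?thesis by (simp add: f' g' mult_dvd_mono unit_imp_dvd)
qed

text \<open>Normality of affine space, reduced to one variable by restriction to lines.\<close>

lemma polyf_integrally_closed:
  assumes f: "f \<in> polyf" and g: "g \<in> polyf" and gx: "g x \<noteq> 0"
    and a: "\<And>k. k < n \<Longrightarrow> a k \<in> polyf"
    and eq: "\<And>y. f y ^ n + (\<Sum>k<n. a k y * g y ^ (n - k) * f y ^ k) = 0"
  shows "\<exists>h \<in> polyf. \<forall>y. f y = g y * h y"
proof -
  obtain F G where F: "line_poly x f F" and G: "line_poly x g G"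
    using line_poly_exists f g by metis
  have "\<forall>k\<in>{..<n}. \<exists>F. line_poly x (a k) F"
    by (simp add: line_poly_exists a)
  from bchoice[OF this] obtain A where A: "\<And>k. k < n \<Longrightarrow> line_poly x (a k) (A k)" by auto
  show ?thesis
  proof (rule polyf_dvd_if_dvd_on_lines[OF g F G gx])
    fix v
    have "poly (F v ^ n + (\<Sum>k<n. A k v * G v ^ (n - k) * F v ^ k)) t = 0" for t
      using eq[of "\<lambda>i. x i + t * v i"] F G A by (simp add: poly_sum line_poly_def)
    then have "F v ^ n + (\<Sum>k<n. A k v * G v ^ (n - k) * F v ^ k) = 0"
      using poly_all_0_iff_0 by blast
    moreover have "poly (G v) 0 \<noteq> 0" using G gx by (simp add: line_poly_def)
    then have "G v \<noteq> 0" by auto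
    ultimately show "G v dvd F v" by (rule dvd_if_integral[rotated])
  qed
qed


section \<open>Invariants of a one-dimensional torus\<close>

definition torus_act :: "('i \<Rightarrow> int) \<Rightarrow> complex \<Rightarrow> ('i \<Rightarrow> complex) \<Rightarrow> 'i \<Rightarrow> complex" where
  "torus_act wt c y = (\<lambda>i. c powi wt i * y i)"

text \<open>The polynomials generated by the evident invariants; that these are all the invariants is
  \<open>torus_invariant_imp_inv_poly\<close> below.\<close>

inductive_set inv_poly :: "('i \<Rightarrow> int) \<Rightarrow> (('i \<Rightarrow> complex) \<Rightarrow> complex) set" for wt where
  const: "(\<lambda>y. c) \<in> inv_poly wt"
| var: "wt i = 0 \<Longrightarrow> (\<lambda>y. y i) \<in> inv_poly wt"
| pair: "wt i = 1 \<Longrightarrow> wt j = -1 \<Longrightarrow> (\<lambda>y. y i * y j) \<in> inv_poly wt"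
| add: "f \<in> inv_poly wt \<Longrightarrow> g \<in> inv_poly wt \<Longrightarrow> (\<lambda>y. f y + g y) \<in> inv_poly wt"
| mult: "f \<in> inv_poly wt \<Longrightarrow> g \<in> inv_poly wt \<Longrightarrow> (\<lambda>y. f y * g y) \<in> inv_poly wt"

text \<open>The weight space of weight \<open>n\<close> as a module over the invariants. A monomial of weight \<open>n \<ge> 0\<close> is
  an invariant times \<open>n\<close> variables of weight \<open>1\<close>, because each variable of weight \<open>-1\<close> can be paired
  with one of weight \<open>1\<close>; symmetrically for \<open>n \<le> 0\<close>. With this shape it is immediate that weight
  \<open>0\<close> consists of invariants only, and the work lies in closure under multiplication.\<close>

inductive wt_poly :: "('i \<Rightarrow> int) \<Rightarrow> int \<Rightarrow> (('i \<Rightarrow> complex) \<Rightarrow> complex) \<Rightarrow> bool" for wt where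
  inv: "f \<in> inv_poly wt \<Longrightarrow> wt_poly wt 0 f"
| zero: "wt_poly wt n (\<lambda>y. 0)"
| add: "wt_poly wt n f \<Longrightarrow> wt_poly wt n g \<Longrightarrow> wt_poly wt n (\<lambda>y. f y + g y)"
| pos: "n \<ge> 0 \<Longrightarrow> wt i = 1 \<Longrightarrow> wt_poly wt n f \<Longrightarrow> wt_poly wt (n + 1) (\<lambda>y. y i * f y)"
| neg: "n \<le> 0 \<Longrightarrow> wt j = -1 \<Longrightarrow> wt_poly wt n f \<Longrightarrow> wt_poly wt (n - 1) (\<lambda>y. y j * f y)"

lemma wt_poly_0_inv:
  assumes "wt_poly wt n f" "n = 0"
  shows "f \<in> inv_poly wt"
  using assms by induction (simp_all add: inv_poly.const inv_poly.add)

lemma wt_poly_mult_inv: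
  assumes "wt_poly wt n f" "a \<in> inv_poly wt"
  shows "wt_poly wt n (\<lambda>y. a y * f y)"
  using assms
proof induction
  case (inv f)
  then show ?case by (simp add: wt_poly.inv inv_poly.mult)
next
  case (zero n)
  then show ?case by (simp add: wt_poly.zero)
next
  case (add n f g)
  then show ?case
    using wt_poly.add[of wt n "\<lambda>y. a y * f y" "\<lambda>y. a y * g y"] by (simp add: distrib_left)
next
  case (pos n i f)
  then show ?case using wt_poly.pos[of n wt i "\<lambda>y. a y * f y"] by (simp add: mult.left_commute)
next
  case (neg n j f)
  then show ?case using wt_poly.neg[of n wt j "\<lambda>y. a y * f y"] by (simp add: mult.left_commute)
qed

text \<open>In negative weight, a variable of weight \<open>1\<close> is absorbed by pairing it with the last variable of
  weight \<open>-1\<close>.\<close>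

lemma wt_poly_mult_pos:
  assumes "wt_poly wt n f" "wt i = 1"
  shows "wt_poly wt (n + 1) (\<lambda>y. y i * f y)"
  using assms
proof induction
  case (inv f)
  then show ?case using wt_poly.pos[of 0 wt i f] wt_poly.inv[of f wt] by simp
next
  case (zero n)
  then show ?case by (simp add: wt_poly.zero)
next
  case (add n f g)
  then show ?case
    using wt_poly.add[of wt "n + 1" "\<lambda>y. y i * f y" "\<lambda>y. y i * g y"] by (simp add: distrib_left)
next
  case (pos n j f)
  then show ?case
    using wt_poly.pos[of "n + 1" wt i "\<lambda>y. y j * f y"] wt_poly.pos[of n wt j f] by simp
next
  case (neg n j f)
  then show ?case
    using wt_poly_mult_inv[OF neg(3), of "\<lambda>y. y i * y j"] inv_poly.pair[of wt i j] by (simp add: mult.assoc)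
qed

lemma wt_poly_mult_neg:
  assumes "wt_poly wt n f" "wt j = -1"
  shows "wt_poly wt (n - 1) (\<lambda>y. y j * f y)"
  using assms
proof induction
  case (inv f)
  then show ?case using wt_poly.neg[of 0 wt j f] wt_poly.inv[of f wt] by simp
next
  case (zero n)
  then show ?case by (simp add: wt_poly.zero)
next
  case (add n f g)
  then show ?case
    using wt_poly.add[of wt "n - 1" "\<lambda>y. y j * f y" "\<lambda>y. y j * g y"] by (simp add: distrib_left)
next
  case (neg n i f)
  then show ?case
    using wt_poly.neg[of "n - 1" wt j "\<lambda>y. y i * f y"] wt_poly.neg[of n wt i f] by simp
next
  case (pos n i f)
  then show ?case
    using wt_poly_mult_inv[OF pos(3), of "\<lambda>y. y i * y j"] inv_poly.pair[of wt i j]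
    by (simp add: mult.assoc mult.left_commute)
qed

lemma wt_poly_mult:
  assumes "wt_poly wt n f" "wt_poly wt m g"
  shows "wt_poly wt (n + m) (\<lambda>y. f y * g y)"
  using assms
proof (induction)
  case (inv f)
  then show ?case using wt_poly_mult_inv[of wt m g f] by simp
next
  case (zero n)
  then show ?case by (simp add: wt_poly.zero)
next
  case (add n f1 f2)
  then show ?case
    using wt_poly.add[of wt "n + m" "\<lambda>y. f1 y * g y" "\<lambda>y. f2 y * g y"] by (simp add: distrib_right)
next
  case (pos n i f)
  then have "wt_poly wt (n + m + 1) (\<lambda>y. y i * (f y * g y))"
    by (intro wt_poly_mult_pos) auto
  then show ?case by (simp add: algebra_simps)
next
  case (neg n i f)
  then have "wt_poly wt (n + m - 1) (\<lambda>y. y i * (f y * g y))"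
    by (intro wt_poly_mult_neg) auto
  then show ?case by (simp add: algebra_simps)
qed

lemma wt_poly_sum:
  assumes "finite K" "\<And>k. k \<in> K \<Longrightarrow> wt_poly wt n (f k)"
  shows "wt_poly wt n (\<lambda>y. \<Sum>k\<in>K. f k y)"
  using assms
proof (induction K rule: finite_induct)
  case (insert k K)
  then show ?case using wt_poly.add[of wt n "f k" "\<lambda>y. \<Sum>k\<in>K. f k y"] by simp
qed (simp add: wt_poly.zero)

text \<open>The Laurent polynomial \<open>c \<mapsto> f (torus_act wt c y)\<close>, made a polynomial by the factor \<open>c ^ d\<close>; its
  coefficients are the weight components of \<open>f\<close>.\<close>

definition torus_laurent ::
  "('i \<Rightarrow> int) \<Rightarrow> (('i \<Rightarrow> complex) \<Rightarrow> complex) \<Rightarrow> nat \<Rightarrow> (('i \<Rightarrow> complex) \<Rightarrow> complex poly) \<Rightarrow> bool" where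
  "torus_laurent wt f d P \<longleftrightarrow>
    (\<forall>y c. c \<noteq> 0 \<longrightarrow> poly (P y) c = c ^ d * f (torus_act wt c y)) \<and>
    (\<forall>k. wt_poly wt (int k - int d) (\<lambda>y. coeff (P y) k))"

lemma torus_expansion:
  assumes "f \<in> polyf" and wt: "\<And>i. wt i \<in> {-1, 0, 1}"
  shows "\<exists>d P. torus_laurent wt f d P"
  using assms(1)
proof induction
  case (const c)
  have "wt_poly wt (int k - int 0) (\<lambda>y. coeff [:c:] k)" for k
    by (cases k) (simp_all add: wt_poly.inv inv_poly.const wt_poly.zero)
  then show ?case by (intro exI[of _ 0] exI[of _ "\<lambda>y. [:c:]"]) (auto simp: torus_laurent_def)
next
  case (var i)
  have y: "wt_poly wt (wt i) (\<lambda>y. y i)"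
  proof -
    have 1: "wt_poly wt 0 (\<lambda>y. 1)"
      by (intro wt_poly.inv inv_poly.const)
    have "wt_poly wt 0 (\<lambda>y. y i)" if "wt i = 0"
      using that by (intro wt_poly.inv inv_poly.var)
    then show ?thesis
      using wt[of i] wt_poly_mult_pos[OF 1, of i] wt_poly_mult_neg[OF 1, of i] by auto
  qed
  have "wt_poly wt (int k - int 1) (\<lambda>y. coeff (monom (y i) (nat (wt i + 1))) k)" for k
  proof (cases "nat (wt i + 1) = k")
    case True
    then have "int k - int 1 = wt i" using wt[of i] by auto
    then show ?thesis using y True by (simp only: coeff_monom) simp
  qed (auto intro: wt_poly.zero)
  moreover have "poly (monom (y i) (nat (wt i + 1))) c = c ^ 1 * torus_act wt c y i" if "c \<noteq> 0" for c y
    using wt[of i] that by (auto simp: torus_act_def poly_monom power2_eq_square power_int_minus)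
  ultimately show ?case
    by (intro exI[of _ 1] exI[of _ "\<lambda>y. monom (y i) (nat (wt i + 1))"]) (simp add: torus_laurent_def)
next
  case (add f g)
  then obtain d P e Q where PQ: "torus_laurent wt f d P" "torus_laurent wt g e Q" by blast
  then have
    P: "\<And>y c. c \<noteq> 0 \<Longrightarrow> poly (P y) c = c ^ d * f (torus_act wt c y)"
      "\<And>k. wt_poly wt (int k - int d) (\<lambda>y. coeff (P y) k)" and
    Q: "\<And>y c. c \<noteq> 0 \<Longrightarrow> poly (Q y) c = c ^ e * g (torus_act wt c y)"
      "\<And>k. wt_poly wt (int k - int e) (\<lambda>y. coeff (Q y) k)"
    by (simp_all add: torus_laurent_def)
  have "wt_poly wt (int k - int (d + e)) (\<lambda>y. coeff (monom 1 e * P y + monom 1 d * Q y) k)" for k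
    unfolding coeff_add
  proof (rule wt_poly.add)
    show "wt_poly wt (int k - int (d + e)) (\<lambda>y. coeff (monom 1 e * P y) k)"
      using P(2)[of "k - e"] by (cases "k < e") (simp_all add: coeff_monom_mult of_nat_diff wt_poly.zero diff_diff_eq add.commute)
    show "wt_poly wt (int k - int (d + e)) (\<lambda>y. coeff (monom 1 d * Q y) k)"
      using Q(2)[of "k - d"] by (cases "k < d") (simp_all add: coeff_monom_mult of_nat_diff wt_poly.zero diff_diff_eq add.commute)
  qed
  moreover have "poly (monom 1 e * P y + monom 1 d * Q y) c =
      c ^ (d + e) * (f (torus_act wt c y) + g (torus_act wt c y))" if "c \<noteq> 0" for c y
    using P(1)[OF that] Q(1)[OF that] by (simp add: poly_monom power_add algebra_simps)
  ultimately show ?case unfolding torus_laurent_def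
    by (intro exI[of _ "d + e"] exI[of _ "\<lambda>y. monom 1 e * P y + monom 1 d * Q y"]) blast
next
  case (mult f g)
  then obtain d P e Q where PQ: "torus_laurent wt f d P" "torus_laurent wt g e Q" by blast
  then have
    P: "\<And>y c. c \<noteq> 0 \<Longrightarrow> poly (P y) c = c ^ d * f (torus_act wt c y)"
      "\<And>k. wt_poly wt (int k - int d) (\<lambda>y. coeff (P y) k)" and
    Q: "\<And>y c. c \<noteq> 0 \<Longrightarrow> poly (Q y) c = c ^ e * g (torus_act wt c y)"
      "\<And>k. wt_poly wt (int k - int e) (\<lambda>y. coeff (Q y) k)"
    by (simp_all add: torus_laurent_def)
  have "wt_poly wt (int k - int (d + e)) (\<lambda>y. coeff (P y * Q y) k)" for k
    unfolding coeff_mult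
  proof (rule wt_poly_sum)
    fix i assume "i \<in> {..k}"
    then have "int k - int (d + e) = (int i - int d) + (int (k - i) - int e)" by (simp add: of_nat_diff)
    then show "wt_poly wt (int k - int (d + e)) (\<lambda>y. coeff (P y) i * coeff (Q y) (k - i))"
      using wt_poly_mult[OF P(2)[of i] Q(2)[of "k - i"]] by (simp only:)
  qed simp
  moreover have "poly (P y * Q y) c =
      c ^ (d + e) * (f (torus_act wt c y) * g (torus_act wt c y))" if "c \<noteq> 0" for c y
    using P(1)[OF that] Q(1)[OF that] by (simp add: power_add algebra_simps)
  ultimately show ?case unfolding torus_laurent_def
    by (intro exI[of _ "d + e"] exI[of _ "\<lambda>y. P y * Q y"]) blast
qed

text \<open>For an invariant function the Laurent polynomial above is constant in \<open>c\<close>, so that the function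
  equals its component of weight \<open>0\<close>.\<close>

lemma torus_invariant_imp_inv_poly:
  assumes f: "f \<in> polyf" and wt: "\<And>i. wt i \<in> {-1, 0, 1}"
    and inv: "\<And>c y. c \<noteq> 0 \<Longrightarrow> f (torus_act wt c y) = f y"
  shows "f \<in> inv_poly wt"
proof -
  obtain d P where
    P: "\<And>y c. c \<noteq> 0 \<Longrightarrow> poly (P y) c = c ^ d * f (torus_act wt c y)"
      "\<And>k. wt_poly wt (int k - int d) (\<lambda>y. coeff (P y) k)"
    using torus_expansion[of f wt] f wt unfolding torus_laurent_def by blast
  have "P y = monom (f y) d" for y
  proof (rule ccontr)
    assume "P y \<noteq> monom (f y) d"
    then have "finite {c. poly (P y - monom (f y) d) c = 0}"
      using poly_roots_finite[of "P y - monom (f y) d"] by auto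
    moreover have "UNIV - {0} \<subseteq> {c. poly (P y - monom (f y) d) c = 0}"
      using P(1) inv by (auto simp: poly_monom)
    ultimately have "finite (UNIV - {0 :: complex})" by (rule finite_subset[rotated])
    then show False using infinite_UNIV_char_0 by (metis finite_Diff2 finite.emptyI finite_insert)
  qed
  then show ?thesis using P(2)[of d] wt_poly_0_inv[of wt 0 f] by simp
qed

section \<open>Polynomial functions of matrices and the two Zariski topologies\<close>

lemma poly_fun_power: "f \<in> poly_fun N \<Longrightarrow> (\<lambda>A. f A ^ n) \<in> poly_fun N"
  by (induction n) (simp_all add: poly_fun.const poly_fun.mult)

lemma poly_fun_uminus: "f \<in> poly_fun N \<Longrightarrow> (\<lambda>A. - f A) \<in> poly_fun N"
  using poly_fun.mult[OF poly_fun.const[of "-1"], of f] by simp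

lemma poly_fun_diff: "f \<in> poly_fun N \<Longrightarrow> g \<in> poly_fun N \<Longrightarrow> (\<lambda>A. f A - g A) \<in> poly_fun N"
  using poly_fun.add[OF _ poly_fun_uminus, of f N g] by simp

lemma poly_fun_sum:
  "(\<And>k. k \<in> K \<Longrightarrow> f k \<in> poly_fun N) \<Longrightarrow> (\<lambda>A. \<Sum>k\<in>K. f k A) \<in> poly_fun N"
  by (induction K rule: infinite_finite_induct) (simp_all add: poly_fun.const poly_fun.add)

lemma poly_fun_polyf:
  assumes "f \<in> poly_fun N" "\<And>i j. i < N \<Longrightarrow> j < N \<Longrightarrow> (\<lambda>y. \<sigma> y $$ (i, j)) \<in> polyf"
  shows "(\<lambda>y. f (\<sigma> y)) \<in> polyf"
  using assms(1) by induction (simp_all add: polyf.const polyf.add polyf.mult assms(2))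

lemma poly_fun_subst:
  assumes "f \<in> poly_fun N" "\<And>i j. i < N \<Longrightarrow> j < N \<Longrightarrow> (\<lambda>A. \<tau> A $$ (i, j)) \<in> poly_fun N"
  shows "(\<lambda>A. f (\<tau> A)) \<in> poly_fun N"
  using assms(1) by induction (simp_all add: poly_fun.const poly_fun.add poly_fun.mult assms(2))

lemma hom_poly_fun_D:
  assumes "f \<in> hom_poly_fun N d"
  shows "f \<in> poly_fun N" "A \<in> carrier_mat N N \<Longrightarrow> f (c \<cdot>\<^sub>m A) = c ^ d * f A"
  using assms by (auto simp: hom_poly_fun_def)

lemma hom_poly_fun_const: "(\<lambda>A. c) \<in> hom_poly_fun N 0"
  by (simp add: hom_poly_fun_def poly_fun.const)

lemma hom_poly_fun_coord: "i < N \<Longrightarrow> j < N \<Longrightarrow> (\<lambda>A. A $$ (i, j)) \<in> hom_poly_fun N 1"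
  by (auto simp: hom_poly_fun_def poly_fun.coord)

lemma hom_poly_fun_mult:
  "f \<in> hom_poly_fun N d \<Longrightarrow> g \<in> hom_poly_fun N e \<Longrightarrow> (\<lambda>A. f A * g A) \<in> hom_poly_fun N (d + e)"
  by (auto simp: hom_poly_fun_def poly_fun.mult power_add)

lemma hom_poly_fun_add:
  "f \<in> hom_poly_fun N d \<Longrightarrow> g \<in> hom_poly_fun N d \<Longrightarrow> (\<lambda>A. f A + g A) \<in> hom_poly_fun N d"
  by (auto simp: hom_poly_fun_def poly_fun.add distrib_left)

lemma hom_poly_fun_diff:
  "f \<in> hom_poly_fun N d \<Longrightarrow> g \<in> hom_poly_fun N d \<Longrightarrow> (\<lambda>A. f A - g A) \<in> hom_poly_fun N d"
  by (auto simp: hom_poly_fun_def poly_fun_diff right_diff_distrib)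

lemma hom_poly_fun_power:
  "f \<in> hom_poly_fun N d \<Longrightarrow> (\<lambda>A. f A ^ n) \<in> hom_poly_fun N (d * n)"
  by (auto simp: hom_poly_fun_def poly_fun_power power_mult power_mult_distrib)

lemma hom_poly_fun_prod:
  assumes "finite K" "\<And>k. k \<in> K \<Longrightarrow> f k \<in> hom_poly_fun N (d k)"
  shows "(\<lambda>A. \<Prod>k\<in>K. f k A) \<in> hom_poly_fun N (\<Sum>k\<in>K. d k)"
  using assms
proof (induction K rule: finite_induct)
  case (insert k K)
  then show ?case
    using hom_poly_fun_mult[of "f k" N "d k" "\<lambda>A. \<Prod>k\<in>K. f k A" "\<Sum>k\<in>K. d k"] by simp
qed (simp add: hom_poly_fun_const)

definition basic_open :: "nat \<Rightarrow> (complex mat \<Rightarrow> complex) \<Rightarrow> complex mat set set" where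
  "basic_open N f = {p \<in> proj_space N. \<exists>A \<in> p. f A \<noteq> 0}"

lemma proj_spaceE:
  assumes "p \<in> proj_space N"
  obtains A where "p = line A" "A \<in> carrier_mat N N" "transpose_mat A = - A" "A \<noteq> 0\<^sub>m N N"
  using assms unfolding proj_space_def by blast

lemma smult_mat_eq_zero:
  assumes "A \<in> carrier_mat N N" "A \<noteq> 0\<^sub>m N N" "c \<cdot>\<^sub>m A = 0\<^sub>m N N"
  shows "(c :: complex) = 0"
proof (rule ccontr)
  assume c: "c \<noteq> 0"
  have "A $$ (i, j) = 0" if "i < N" "j < N" for i j
    using arg_cong[OF assms(3), of "\<lambda>M. M $$ (i, j)"] that assms(1) c by simp
  then have "A = 0\<^sub>m N N" using assms(1) by (intro eq_matI) auto
  then show False using assms(2) by simp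
qed

lemma line_refl: "A \<in> line A"
  unfolding line_def by (rule range_eqI[of _ _ 1]) (rule eq_matI; simp)

lemma line_eqI:
  assumes "B \<in> line A" "B \<noteq> 0\<^sub>m N N" "A \<in> carrier_mat N N"
  shows "line B = line A"
proof -
  obtain c where c: "B = c \<cdot>\<^sub>m A" using assms(1) by (auto simp: line_def)
  have "c \<noteq> 0"
  proof
    assume "c = 0"
    then have "B = 0\<^sub>m N N" using assms(3) c by (intro eq_matI) auto
    then show False using assms(2) by simp
  qed
  have "d \<cdot>\<^sub>m B = (d * c) \<cdot>\<^sub>m A" for d
    by (auto simp: c intro!: eq_matI)
  then have "range (\<lambda>d. d \<cdot>\<^sub>m B) \<subseteq> range (\<lambda>d. d \<cdot>\<^sub>m A)"
    by (intro image_subsetI range_eqI)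
  moreover have "d \<cdot>\<^sub>m A = (d / c) \<cdot>\<^sub>m B" for d
    using \<open>c \<noteq> 0\<close> by (auto simp: c intro!: eq_matI)
  then have "range (\<lambda>d. d \<cdot>\<^sub>m A) \<subseteq> range (\<lambda>d. d \<cdot>\<^sub>m B)"
    by (intro image_subsetI range_eqI)
  ultimately show ?thesis unfolding line_def by blast
qed

lemma proj_space_rep:
  assumes "p \<in> proj_space N" "A \<in> p" "A \<noteq> 0\<^sub>m N N"
  shows "p = line A" "A \<in> carrier_mat N N" "transpose_mat A = - A"
proof -
  obtain B where B: "p = line B" "B \<in> carrier_mat N N" "transpose_mat B = - B" "B \<noteq> 0\<^sub>m N N"
    using assms(1) by (rule proj_spaceE)
  show "p = line A" using line_eqI[of A B N] B assms by simp
  obtain c where A: "A = c \<cdot>\<^sub>m B" using assms(2) B by (auto simp: line_def)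
  show "A \<in> carrier_mat N N" using A B by simp
  have "transpose_mat A = c \<cdot>\<^sub>m transpose_mat B" unfolding A by (intro eq_matI) auto
  also have "\<dots> = - A" unfolding B(3) A by (intro eq_matI) auto
  finally show "transpose_mat A = - A" .
qed

lemma hom_nonzero_iff:
  assumes "p \<in> proj_space N" "A \<in> p" "A \<noteq> 0\<^sub>m N N" "f \<in> hom_poly_fun N d"
  shows "p \<in> basic_open N f \<longleftrightarrow> f A \<noteq> 0"
proof -
  have p: "p = line A" "A \<in> carrier_mat N N" using proj_space_rep assms by blast+
  show ?thesis
    using hom_poly_fun_D(2)[OF assms(4) p(2)] assms(1,2) unfolding basic_open_def p(1) line_def by auto
qed

lemma basic_open_inter:
  assumes "f \<in> hom_poly_fun N d" "g \<in> hom_poly_fun N e"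
  shows "basic_open N (\<lambda>A. f A * g A) = basic_open N f \<inter> basic_open N g"
proof -
  have "p \<in> basic_open N (\<lambda>A. f A * g A) \<longleftrightarrow> p \<in> basic_open N f \<and> p \<in> basic_open N g" if p: "p \<in> proj_space N" for p
  proof -
    obtain A where "p = line A" "A \<noteq> 0\<^sub>m N N" using p by (rule proj_spaceE)
    then show ?thesis
      using hom_nonzero_iff[OF p, of A] line_refl[of A] assms hom_poly_fun_mult[OF assms] by auto
  qed
  then show ?thesis by (auto simp: basic_open_def)
qed

lemma openin_generated_iff:
  assumes inter: "\<And>A B. A \<in> \<B> \<Longrightarrow> B \<in> \<B> \<Longrightarrow> A \<inter> B \<in> \<B>"
  shows "openin (topology_generated_by \<B>) S \<longleftrightarrow> (\<forall>x\<in>S. \<exists>A\<in>\<B>. x \<in> A \<and> A \<subseteq> S)"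
proof
  assume "openin (topology_generated_by \<B>) S"
  then have "generate_topology_on \<B> S" by (rule openin_topology_generated_by)
  then show "\<forall>x\<in>S. \<exists>A\<in>\<B>. x \<in> A \<and> A \<subseteq> S"
  proof induction
    case (Int a b)
    show ?case
    proof
      fix x assume "x \<in> a \<inter> b"
      then obtain A B where "A \<in> \<B>" "x \<in> A" "A \<subseteq> a" "B \<in> \<B>" "x \<in> B" "B \<subseteq> b"
        using Int.IH by (meson IntD1 IntD2)
      then show "\<exists>A\<in>\<B>. x \<in> A \<and> A \<subseteq> a \<inter> b"
        using inter by (intro bexI[of _ "A \<inter> B"]) auto
    qed
  next
    case (UN K)
    show ?case
    proof
      fix x assume "x \<in> \<Union>K"
      then obtain k where k: "k \<in> K" "x \<in> k" by blast
      then obtain A where "A \<in> \<B>" "x \<in> A" "A \<subseteq> k" using UN.IH[OF k(1)] by blast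
      then show "\<exists>A\<in>\<B>. x \<in> A \<and> A \<subseteq> \<Union>K" using k(1) by (intro bexI[of _ A]) auto
    qed
  qed auto
next
  assume "\<forall>x\<in>S. \<exists>A\<in>\<B>. x \<in> A \<and> A \<subseteq> S"
  then show "openin (topology_generated_by \<B>) S"
    using topology_generated_by_Basis by (subst openin_subopen) blast
qed

lemma openin_zariski_iff:
  "openin (zariski N) S \<longleftrightarrow>
    S \<subseteq> proj_space N \<and> (\<forall>p\<in>S. \<exists>f d. f \<in> hom_poly_fun N d \<and> p \<in> basic_open N f \<and> basic_open N f \<subseteq> S)"
proof -
  let ?B = "{basic_open N f | f d. f \<in> hom_poly_fun N d}"
  have "A \<inter> B \<in> ?B" if AB: "A \<in> ?B" "B \<in> ?B" for A B
  proof -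
    obtain f d where f: "f \<in> hom_poly_fun N d" "A = basic_open N f" using AB(1) by blast
    obtain g e where g: "g \<in> hom_poly_fun N e" "B = basic_open N g" using AB(2) by blast
    have "A \<inter> B = basic_open N (\<lambda>A. f A * g A)" using basic_open_inter[OF f(1) g(1)] f g by simp
    then show ?thesis using hom_poly_fun_mult[OF f(1) g(1)] by blast
  qed
  then have "openin (zariski N) S \<longleftrightarrow> (\<forall>x\<in>S. \<exists>A\<in>?B. x \<in> A \<and> A \<subseteq> S)"
    unfolding zariski_def basic_open_def[symmetric] by (rule openin_generated_iff)
  also have "\<dots> \<longleftrightarrow> (\<forall>x\<in>S. \<exists>f d. f \<in> hom_poly_fun N d \<and> x \<in> basic_open N f \<and> basic_open N f \<subseteq> S)"
    by (intro ball_cong refl) auto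
  moreover have "basic_open N f \<subseteq> proj_space N" for f by (auto simp: basic_open_def)
  then have "S \<subseteq> proj_space N"
    if "\<forall>x\<in>S. \<exists>f d. f \<in> hom_poly_fun N d \<and> x \<in> basic_open N f \<and> basic_open N f \<subseteq> S"
    using that by (meson subset_iff)
  ultimately show ?thesis by argo
qed

lemma openin_basic_open: "f \<in> hom_poly_fun N d \<Longrightarrow> openin (zariski N) (basic_open N f)"
  unfolding openin_zariski_iff by (auto simp: basic_open_def)

lemma topspace_zariski [simp]: "topspace (zariski N) = proj_space N"
proof
  show "topspace (zariski N) \<subseteq> proj_space N"
    using openin_zariski_iff[of N "topspace (zariski N)"] by simp
  have "openin (zariski N) (proj_space N)"
    unfolding openin_zariski_iff
  proof (intro conjI ballI subset_refl)
    fix p assume p: "p \<in> proj_space N"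
    then have "p \<in> basic_open N (\<lambda>A. 1)"
      by (auto simp: basic_open_def elim!: proj_spaceE intro: line_refl)
    moreover have "basic_open N (\<lambda>A. 1) \<subseteq> proj_space N" by (auto simp: basic_open_def)
    ultimately show "\<exists>f d. f \<in> hom_poly_fun N d \<and> p \<in> basic_open N f \<and> basic_open N f \<subseteq> proj_space N"
      using hom_poly_fun_const by blast
  qed
  then show "proj_space N \<subseteq> topspace (zariski N)" by (rule openin_subset)
qed

definition basic_open_GL :: "nat \<Rightarrow> (complex mat \<Rightarrow> complex) \<Rightarrow> complex mat set" where
  "basic_open_GL N f = {A \<in> carrier (GL N). f A \<noteq> 0}"

lemma openin_zariski_GL_iff:
  "openin (zariski_GL N) S \<longleftrightarrow>
    S \<subseteq> carrier (GL N) \<and> (\<forall>g\<in>S. \<exists>f. f \<in> poly_fun N \<and> g \<in> basic_open_GL N f \<and> basic_open_GL N f \<subseteq> S)"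
proof -
  let ?B = "{basic_open_GL N f | f. f \<in> poly_fun N}"
  have "A \<inter> B \<in> ?B" if AB: "A \<in> ?B" "B \<in> ?B" for A B
  proof -
    obtain f where f: "f \<in> poly_fun N" "A = basic_open_GL N f" using AB(1) by blast
    obtain g where g: "g \<in> poly_fun N" "B = basic_open_GL N g" using AB(2) by blast
    have "A \<inter> B = basic_open_GL N (\<lambda>A. f A * g A)" using f g by (auto simp: basic_open_GL_def)
    then show ?thesis using poly_fun.mult[OF f(1) g(1)] by blast
  qed
  then have "openin (zariski_GL N) S \<longleftrightarrow> (\<forall>x\<in>S. \<exists>A\<in>?B. x \<in> A \<and> A \<subseteq> S)"
    unfolding zariski_GL_def basic_open_GL_def[symmetric] by (rule openin_generated_iff)
  also have "\<dots> \<longleftrightarrow> (\<forall>g\<in>S. \<exists>f. f \<in> poly_fun N \<and> g \<in> basic_open_GL N f \<and> basic_open_GL N f \<subseteq> S)"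
    by (intro ball_cong refl) auto
  moreover have "basic_open_GL N f \<subseteq> carrier (GL N)" for f by (auto simp: basic_open_GL_def)
  then have "S \<subseteq> carrier (GL N)"
    if "\<forall>g\<in>S. \<exists>f. f \<in> poly_fun N \<and> g \<in> basic_open_GL N f \<and> basic_open_GL N f \<subseteq> S"
    using that by (meson subset_iff)
  ultimately show ?thesis by argo
qed

lemma topspace_zariski_GL [simp]: "topspace (zariski_GL N) = carrier (GL N)"
proof
  show "topspace (zariski_GL N) \<subseteq> carrier (GL N)"
    using openin_zariski_GL_iff[of N "topspace (zariski_GL N)"] by simp
  have "basic_open_GL N (\<lambda>A. 1) = carrier (GL N)" by (simp add: basic_open_GL_def)
  then have "openin (zariski_GL N) (carrier (GL N))"
    unfolding openin_zariski_GL_iff using poly_fun.const by blast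
  then show "carrier (GL N) \<subseteq> topspace (zariski_GL N)" by (rule openin_subset)
qed


section \<open>The general linear group\<close>

lemma GL_simps [simp]:
  "x \<otimes>\<^bsub>GL N\<^esub> y = x * y" "\<one>\<^bsub>GL N\<^esub> = 1\<^sub>m N"
  by (simp_all add: GL_def units_of_def ring_mat_def)

lemma group_GL: "group (GL N)"
proof -
  interpret ring "ring_mat TYPE(complex) N ()" by (rule ring_mat)
  show ?thesis unfolding GL_def by (rule units_group)
qed

lemma GL_iff: "g \<in> carrier (GL N) \<longleftrightarrow> g \<in> carrier_mat N N \<and> det g \<noteq> 0"
proof
  assume "g \<in> carrier (GL N)"
  then have "g \<in> Units (ring_mat TYPE(complex) N ())" by (simp add: GL_def units_of_def)
  then show "g \<in> carrier_mat N N \<and> det g \<noteq> 0"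
    using unit_imp_det_non_zero by (auto simp: Units_def ring_mat_def)
next
  assume "g \<in> carrier_mat N N \<and> det g \<noteq> 0"
  then show "g \<in> carrier (GL N)"
    using det_non_zero_imp_unit by (auto simp: GL_def units_of_def)
qed

lemma GL_carrier: "g \<in> carrier (GL N) \<Longrightarrow> g \<in> carrier_mat N N"
  by (simp add: GL_iff)

lemma GL_inv:
  assumes "g \<in> carrier (GL N)"
  shows "inv\<^bsub>GL N\<^esub> g \<in> carrier (GL N)" "inv\<^bsub>GL N\<^esub> g \<in> carrier_mat N N"
    "g * inv\<^bsub>GL N\<^esub> g = 1\<^sub>m N" "inv\<^bsub>GL N\<^esub> g * g = 1\<^sub>m N"
proof -
  interpret group "GL N" by (rule group_GL)
  show "inv\<^bsub>GL N\<^esub> g \<in> carrier (GL N)" using assms by simp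
  then show "inv\<^bsub>GL N\<^esub> g \<in> carrier_mat N N" by (rule GL_carrier)
  show "g * inv\<^bsub>GL N\<^esub> g = 1\<^sub>m N" "inv\<^bsub>GL N\<^esub> g * g = 1\<^sub>m N"
    using r_inv[OF assms] l_inv[OF assms] by simp_all
qed

lemma GL_I:
  assumes "g \<in> carrier_mat N N" "h \<in> carrier_mat N N" "g * h = 1\<^sub>m N"
  shows "g \<in> carrier (GL N)" "h \<in> carrier (GL N)" "inv\<^bsub>GL N\<^esub> g = h"
proof -
  have "det g * det h = 1" using det_mult[OF assms(1,2)] assms(3) by simp
  then show g: "g \<in> carrier (GL N)" and h: "h \<in> carrier (GL N)" using assms by (auto simp: GL_iff)
  interpret group "GL N" by (rule group_GL)
  show "inv\<^bsub>GL N\<^esub> g = h" using inv_equality[of h g] mat_mult_left_right_inverse[OF assms] g h by simp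
qed

lemma mat_mult_entry:
  assumes "A \<in> carrier_mat N N" "B \<in> carrier_mat N N" "i < N" "j < N"
  shows "(A * B) $$ (i, j) = (\<Sum>k<N. A $$ (i, k) * B $$ (k, j))"
  using assms by (auto simp: scalar_prod_def atLeast0LessThan)

lemma det_polyf:
  assumes "\<And>y. \<sigma> y \<in> carrier_mat N N" "\<And>i j. i < N \<Longrightarrow> j < N \<Longrightarrow> (\<lambda>y. \<sigma> y $$ (i, j)) \<in> polyf"
  shows "(\<lambda>y. det (\<sigma> y)) \<in> polyf"
proof -
  have "(\<lambda>y. \<Sum>p\<in>{p. p permutes {0..<N}}. signof p * (\<Prod>i = 0..<N. \<sigma> y $$ (i, p i))) \<in> polyf"
    using permutes_in_image[of _ "{0..<N}"]
    by (intro polyf_sum polyf.mult polyf.const polyf_prod assms(2)) auto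
  then show ?thesis by (simp add: det_def'[OF assms(1)])
qed

text \<open>The groups below are cut out of the general linear group by the vanishing of a set of
  matrix entries.\<close>

definition pattern :: "nat \<Rightarrow> (nat \<times> nat) set \<Rightarrow> complex mat set" where
  "pattern N Z = {g \<in> carrier (GL N). \<forall>i<N. \<forall>j<N. (i, j) \<in> Z \<longrightarrow> g $$ (i, j) = 0}"

lemma closedin_pattern: "closedin (zariski_GL N) (pattern N Z)"
  unfolding closedin_def
proof (intro conjI)
  show "pattern N Z \<subseteq> topspace (zariski_GL N)" by (auto simp: pattern_def)
  show "openin (zariski_GL N) (topspace (zariski_GL N) - pattern N Z)"
    unfolding openin_zariski_GL_iff
  proof (intro conjI ballI)
    fix g assume "g \<in> topspace (zariski_GL N) - pattern N Z"
    then obtain i j where ij: "i < N" "j < N" "(i, j) \<in> Z" "g $$ (i, j) \<noteq> 0" "g \<in> carrier (GL N)"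
      by (auto simp: pattern_def)
    have "basic_open_GL N (\<lambda>A. A $$ (i, j)) \<subseteq> topspace (zariski_GL N) - pattern N Z"
      using ij by (auto simp: basic_open_GL_def pattern_def)
    moreover have "g \<in> basic_open_GL N (\<lambda>A. A $$ (i, j))" using ij by (simp add: basic_open_GL_def)
    ultimately show "\<exists>f. f \<in> poly_fun N \<and> g \<in> basic_open_GL N f \<and> basic_open_GL N f \<subseteq> topspace (zariski_GL N) - pattern N Z"
      using poly_fun.coord[OF ij(1,2)] by blast
  qed auto
qed

text \<open>Such a group is even irreducible: it is the open set \<open>det \<noteq> 0\<close> in a linear space of matrices, and
  two nonempty open subsets meet by \<open>polyf_nonzero_both\<close>.\<close>

lemma connectedin_pattern: "connectedin (zariski_GL N) (pattern N Z)"
proof -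
  define \<sigma> :: "(nat \<times> nat \<Rightarrow> complex) \<Rightarrow> complex mat"
    where "\<sigma> y = mat N N (\<lambda>ij. if ij \<in> Z then 0 else y ij)" for y
  have \<sigma>: "\<sigma> y \<in> carrier_mat N N" for y by (simp add: \<sigma>_def)
  have entry: "(\<lambda>y. \<sigma> y $$ (i, j)) \<in> polyf" if "i < N" "j < N" for i j
    using that by (cases "(i, j) \<in> Z") (simp_all add: \<sigma>_def polyf.const polyf.var)
  have \<sigma>_pattern: "\<sigma> y \<in> pattern N Z" if "det (\<sigma> y) \<noteq> 0" for y
    using that \<sigma> by (auto simp: pattern_def GL_iff \<sigma>_def)
  have \<sigma>_surj: "\<exists>y. g = \<sigma> y" if "g \<in> pattern N Z" for g
    using that by (intro exI[of _ "\<lambda>(i, j). g $$ (i, j)"] eq_matI)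
      (auto simp: \<sigma>_def pattern_def GL_iff)
  have meet: "\<exists>g \<in> pattern N Z. g \<in> U \<and> g \<in> V"
    if U: "openin (zariski_GL N) U" and V: "openin (zariski_GL N) V"
      and u: "u \<in> pattern N Z" "u \<in> U" and v: "v \<in> pattern N Z" "v \<in> V" for U V u v
  proof -
    obtain f where f: "f \<in> poly_fun N" "u \<in> basic_open_GL N f" "basic_open_GL N f \<subseteq> U"
      using U u(2) unfolding openin_zariski_GL_iff by blast
    obtain g where g: "g \<in> poly_fun N" "v \<in> basic_open_GL N g" "basic_open_GL N g \<subseteq> V"
      using V v(2) unfolding openin_zariski_GL_iff by blast
    obtain y1 where y1: "u = \<sigma> y1" using \<sigma>_surj u(1) by blast
    obtain y2 where y2: "v = \<sigma> y2" using \<sigma>_surj v(1) by blast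
    let ?F = "\<lambda>y. f (\<sigma> y) * det (\<sigma> y)"
    let ?G = "\<lambda>y. g (\<sigma> y) * det (\<sigma> y)"
    have "?F \<in> polyf" "?G \<in> polyf"
      by (auto intro!: polyf.mult[OF poly_fun_polyf[OF f(1)] det_polyf]
          polyf.mult[OF poly_fun_polyf[OF g(1)] det_polyf] \<sigma> entry)
    moreover have "?F y1 \<noteq> 0" "?G y2 \<noteq> 0"
      using f(2) g(2) y1 y2 by (auto simp: basic_open_GL_def GL_iff)
    ultimately obtain y where y: "?F y \<noteq> 0" "?G y \<noteq> 0" using polyf_nonzero_both by blast
    then have "\<sigma> y \<in> pattern N Z" using \<sigma>_pattern by simp
    moreover have "\<sigma> y \<in> carrier (GL N)" using y \<sigma> by (simp add: GL_iff)
    ultimately show ?thesis using y f(3) g(3) by (intro bexI[of _ "\<sigma> y"]) (auto simp: basic_open_GL_def)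
  qed
  show ?thesis unfolding connectedin
  proof (intro conjI notI)
    show "pattern N Z \<subseteq> topspace (zariski_GL N)" by (auto simp: pattern_def)
    assume "\<exists>E1 E2. openin (zariski_GL N) E1 \<and> openin (zariski_GL N) E2 \<and>
      pattern N Z \<subseteq> E1 \<union> E2 \<and> E1 \<inter> E2 \<inter> pattern N Z = {} \<and>
      E1 \<inter> pattern N Z \<noteq> {} \<and> E2 \<inter> pattern N Z \<noteq> {}"
    then show False using meet by blast
  qed
qed

section \<open>Traces and unipotent matrices\<close>

definition tr :: "nat \<Rightarrow> complex mat \<Rightarrow> complex" where
  "tr N A = (\<Sum>i<N. A $$ (i, i))"

lemma tr_mult_comm:
  assumes "A \<in> carrier_mat N N" "B \<in> carrier_mat N N"
  shows "tr N (A * B) = tr N (B * A)"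
proof -
  have "tr N (A * B) = (\<Sum>i<N. \<Sum>k<N. A $$ (i, k) * B $$ (k, i))"
    unfolding tr_def using assms by (intro sum.cong) (auto simp del: index_mult_mat simp: mat_mult_entry)
  also have "\<dots> = (\<Sum>k<N. \<Sum>i<N. B $$ (k, i) * A $$ (i, k))"
    by (subst sum.swap) (simp add: mult.commute)
  also have "\<dots> = tr N (B * A)"
    unfolding tr_def using assms by (intro sum.cong) (auto simp del: index_mult_mat simp: mat_mult_entry)
  finally show ?thesis .
qed

lemma upper_triangular_mult_entry:
  fixes A B :: "complex mat"
  assumes "A \<in> carrier_mat N N" "B \<in> carrier_mat N N" "upper_triangular A" "upper_triangular B"
  shows "upper_triangular (A * B)"
    and "i < N \<Longrightarrow> (A * B) $$ (i, i) = A $$ (i, i) * B $$ (i, i)"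
proof -
  have 0: "A $$ (i, k) * B $$ (k, j) = 0" if "i < N" "j \<le> i" "k < N" "k \<noteq> i \<or> j < i" for i j k
    using that assms upper_triangularD[of A k i] upper_triangularD[of B j k]
    by (cases "k < i") auto
  show "upper_triangular (A * B)"
  proof (rule upper_triangularI)
    fix i j assume "j < i" "i < dim_row (A * B)"
    then have "(A * B) $$ (i, j) = (\<Sum>k<N. A $$ (i, k) * B $$ (k, j))"
      using assms by (intro mat_mult_entry) auto
    also have "\<dots> = 0"
      using assms 0[of i j] \<open>j < i\<close> \<open>i < dim_row (A * B)\<close> by (intro sum.neutral) auto
    finally show "(A * B) $$ (i, j) = 0" .
  qed
  assume i: "i < N"
  have "(A * B) $$ (i, i) = (\<Sum>k<N. A $$ (i, k) * B $$ (k, i))"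
    using i assms by (simp del: index_mult_mat(1) add: mat_mult_entry)
  also have "\<dots> = (\<Sum>k\<in>{i}. A $$ (i, k) * B $$ (k, i))"
    using i 0 by (intro sum.mono_neutral_right) auto
  finally show "(A * B) $$ (i, i) = A $$ (i, i) * B $$ (i, i)" by simp
qed

lemma upper_triangular_pow_entry:
  fixes A :: "complex mat"
  assumes "A \<in> carrier_mat N N" "upper_triangular A"
  shows "upper_triangular (A ^\<^sub>m k) \<and> (\<forall>i<N. (A ^\<^sub>m k) $$ (i, i) = A $$ (i, i) ^ k)"
proof (induction k)
  case 0
  then show ?case using assms by simp
next
  case (Suc k)
  then show ?case
    using upper_triangular_mult_entry[OF pow_carrier_mat[OF assms(1), of k] assms(1) _ assms(2)]
    by (simp del: index_mult_mat(1) add: mult.commute)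
qed

lemma upper_triangular_nilpotent_diag:
  fixes A :: "complex mat"
  assumes "A \<in> carrier_mat N N" "upper_triangular A" "A ^\<^sub>m k = 0\<^sub>m N N" "i < N"
  shows "A $$ (i, i) = 0"
proof -
  have "(A ^\<^sub>m k) $$ (i, i) = A $$ (i, i) ^ k"
    using upper_triangular_pow_entry[OF assms(1,2)] assms(4) by blast
  then show ?thesis using assms(3,4) by simp
qed

text \<open>By triangularisation, since a nilpotent triangular matrix has zero diagonal.\<close>

lemma nilpotent_tr:
  assumes A: "(A :: complex mat) \<in> carrier_mat N N" and k: "A ^\<^sub>m k = 0\<^sub>m N N"
  shows "tr N A = 0"
proof -
  obtain es where "char_poly A = (\<Prod>a\<leftarrow>es. [:- a, 1:])"
    using char_poly_factorized[OF A] by blast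
  then obtain B where B: "B \<in> carrier_mat N N" "upper_triangular B" "similar_mat A B"
    using schur_decomposition_exists[OF A] by blast
  then have "similar_mat B A" by (rule_tac similar_mat_sym)
  then obtain P Q where PQ: "similar_mat_wit B A P Q" unfolding similar_mat_def by blast
  note w = similar_mat_witD2[OF B(1) PQ]
  have "similar_mat_wit (B ^\<^sub>m k) (A ^\<^sub>m k) P Q" using PQ by (rule similar_mat_wit_pow)
  then have "B ^\<^sub>m k = P * (A ^\<^sub>m k) * Q" by (auto simp: similar_mat_wit_def Let_def)
  then have "B ^\<^sub>m k = 0\<^sub>m N N" using k w by simp
  then have "B $$ (i, i) = 0" if "i < N" for i
    using upper_triangular_nilpotent_diag[OF B(1,2)] that by blast
  then have "tr N B = 0" by (simp add: tr_def)
  have "tr N B = tr N (P * (A * Q))"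
    using w by (simp add: assoc_mult_mat[of P N N A N Q N])
  also have "\<dots> = tr N (A * Q * P)" using w by (intro tr_mult_comm) auto
  also have "A * Q * P = A" using w by (simp add: assoc_mult_mat[of A N N Q N P N])
  finally show ?thesis using \<open>tr N B = 0\<close> by simp
qed

lemma unipotent_tr:
  assumes "u \<in> carrier_mat N N" "(u - 1\<^sub>m N) ^\<^sub>m k = 0\<^sub>m N N"
  shows "tr N u = of_nat N"
proof -
  have "tr N (u - 1\<^sub>m N) = 0" using assms by (intro nilpotent_tr) auto
  moreover have "tr N (u - 1\<^sub>m N) = tr N u - of_nat N"
    using assms(1) by (simp add: tr_def sum_subtractf)
  ultimately show ?thesis by simp
qed


section \<open>Matrices acting on two coordinates\<close>

text \<open>The matrix with rows \<open>(a, b)\<close> and \<open>(c, d)\<close> acting on the coordinates \<open>p, q\<close> and the identity on all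
  others.\<close>

definition emb2 :: "nat \<Rightarrow> nat \<Rightarrow> nat \<Rightarrow> complex \<Rightarrow> complex \<Rightarrow> complex \<Rightarrow> complex \<Rightarrow> complex mat" where
  "emb2 N p q a b c d = mat N N (\<lambda>(i, j).
     if i = p \<and> j = p then a else if i = p \<and> j = q then b
     else if i = q \<and> j = p then c else if i = q \<and> j = q then d else if i = j then 1 else 0)"

lemma emb2_carrier [simp]: "emb2 N p q a b c d \<in> carrier_mat N N"
  by (simp add: emb2_def)

lemma emb2_one: "emb2 N p q 1 0 0 1 = 1\<^sub>m N"
proof (rule eq_matI)
  fix i j assume "i < dim_row (1\<^sub>m N :: complex mat)" "j < dim_col (1\<^sub>m N :: complex mat)"
  then show "emb2 N p q 1 0 0 1 $$ (i, j) = 1\<^sub>m N $$ (i, j)"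
    by (cases "i = j") (simp_all add: emb2_def)
qed (simp_all add: emb2_def)

lemma emb2_left_entry:
  assumes "p < N" "q < N" "p \<noteq> q" "A \<in> carrier_mat N N" "i < N" "j < N"
  shows "(emb2 N p q a b c d * A) $$ (i, j) =
    (if i = p then a * A $$ (p, j) + b * A $$ (q, j)
     else if i = q then c * A $$ (p, j) + d * A $$ (q, j) else A $$ (i, j))"
proof -
  have "(emb2 N p q a b c d * A) $$ (i, j) = (\<Sum>k<N. emb2 N p q a b c d $$ (i, k) * A $$ (k, j))"
    using assms by (intro mat_mult_entry) auto
  also have "\<dots> = (\<Sum>k\<in>{p, q} \<union> {i}. emb2 N p q a b c d $$ (i, k) * A $$ (k, j))"
    using assms by (intro sum.mono_neutral_right) (auto simp: emb2_def)
  also have "\<dots> = (if i = p then a * A $$ (p, j) + b * A $$ (q, j)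
     else if i = q then c * A $$ (p, j) + d * A $$ (q, j) else A $$ (i, j))"
    using assms by (auto simp: emb2_def insert_commute)
  finally show ?thesis .
qed

lemma emb2_right_entry:
  assumes "p < N" "q < N" "p \<noteq> q" "A \<in> carrier_mat N N" "i < N" "j < N"
  shows "(A * emb2 N p q a b c d) $$ (i, j) =
    (if j = p then A $$ (i, p) * a + A $$ (i, q) * c
     else if j = q then A $$ (i, p) * b + A $$ (i, q) * d else A $$ (i, j))"
proof -
  have "(A * emb2 N p q a b c d) $$ (i, j) = (\<Sum>k<N. A $$ (i, k) * emb2 N p q a b c d $$ (k, j))"
    using assms by (intro mat_mult_entry) auto
  also have "\<dots> = (\<Sum>k\<in>{p, q} \<union> {j}. A $$ (i, k) * emb2 N p q a b c d $$ (k, j))"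
    using assms by (intro sum.mono_neutral_right) (auto simp: emb2_def)
  also have "\<dots> = (if j = p then A $$ (i, p) * a + A $$ (i, q) * c
     else if j = q then A $$ (i, p) * b + A $$ (i, q) * d else A $$ (i, j))"
    using assms by (auto simp: emb2_def insert_commute)
  finally show ?thesis .
qed

lemma emb2_mult:
  assumes "p < N" "q < N" "p \<noteq> q"
  shows "emb2 N p q a b c d * emb2 N p q a' b' c' d' =
    emb2 N p q (a * a' + b * c') (a * b' + b * d') (c * a' + d * c') (c * b' + d * d')"
proof (rule eq_matI)
  let ?M = "emb2 N p q (a * a' + b * c') (a * b' + b * d') (c * a' + d * c') (c * b' + d * d')"
  fix i j assume "i < dim_row ?M" "j < dim_col ?M"
  then have "i < N" "j < N" by (simp_all add: emb2_def)
  then show "(emb2 N p q a b c d * emb2 N p q a' b' c' d') $$ (i, j) = ?M $$ (i, j)"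
    using assms emb2_left_entry[OF assms emb2_carrier, of i j a b c d p q a' b' c' d']
    by (auto simp: emb2_def simp del: index_mult_mat(1))
qed (simp_all add: emb2_def)

text \<open>The root element with parameter \<open>c\<close> at the position \<open>(p, q)\<close>.\<close>

abbreviation transv :: "nat \<Rightarrow> nat \<Rightarrow> nat \<Rightarrow> complex \<Rightarrow> complex mat" where
  "transv N p q c \<equiv> emb2 N p q 1 c 0 1"

lemma emb2_swap: "p \<noteq> q \<Longrightarrow> emb2 N q p a b c d = emb2 N p q d c b a"
proof (rule eq_matI)
  fix i j assume "p \<noteq> q" "i < dim_row (emb2 N p q d c b a)" "j < dim_col (emb2 N p q d c b a)"
  then show "emb2 N q p a b c d $$ (i, j) = emb2 N p q d c b a $$ (i, j)"
    by (simp add: emb2_def)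
qed (simp_all add: emb2_def)

lemma transv_GL:
  assumes "p < N" "q < N" "p \<noteq> q"
  shows "transv N p q c \<in> carrier (GL N)" "inv\<^bsub>GL N\<^esub> (transv N p q c) = transv N p q (- c)"
  using GL_I[OF emb2_carrier emb2_carrier, of N p q 1 c 0 1 p q 1 "- c" 0 1] assms
  by (simp_all add: emb2_mult emb2_one)


section \<open>Block diagonal groups and their upper triangular subgroups\<close>

text \<open>The positions outside the diagonal blocks when the indices are cut at the elements of \<open>D\<close>.\<close>

definition off_blocks :: "nat set \<Rightarrow> (nat \<times> nat) set" where
  "off_blocks D = {(i, j). \<exists>d\<in>D. (i < d) \<noteq> (j < d)}"

definition below_diag :: "(nat \<times> nat) set" where
  "below_diag = {(i, j). j < i}"

lemma pattern_one:
  assumes "\<And>i. (i, i) \<notin> Z"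
  shows "1\<^sub>m N \<in> pattern N Z"
  using assms by (auto simp: pattern_def GL_iff)

lemma pattern_mult:
  assumes "\<And>i j k. (i, j) \<in> Z \<Longrightarrow> (i, k) \<in> Z \<or> (k, j) \<in> Z"
    and "g \<in> pattern N Z" "h \<in> pattern N Z"
  shows "g * h \<in> pattern N Z"
proof -
  have GL: "g \<in> carrier (GL N)" "h \<in> carrier (GL N)" using assms by (auto simp: pattern_def)
  have "(g * h) $$ (i, j) = 0" if ij: "i < N" "j < N" "(i, j) \<in> Z" for i j
  proof -
    have "(g * h) $$ (i, j) = (\<Sum>k<N. g $$ (i, k) * h $$ (k, j))"
      using GL ij by (intro mat_mult_entry) (auto dest: GL_carrier)
    also have "\<dots> = 0"
    proof (intro sum.neutral ballI)
      fix k assume "k \<in> {..<N}"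
      then show "g $$ (i, k) * h $$ (k, j) = 0"
        using assms(1)[OF ij(3), of k] assms(2,3) ij by (auto simp: pattern_def)
    qed
    finally show ?thesis .
  qed
  moreover have "g * h \<in> carrier (GL N)"
    using group.is_monoid[OF group_GL, THEN monoid.m_closed, of g N h] GL by simp
  ultimately show ?thesis by (simp add: pattern_def del: index_mult_mat(1))
qed

lemma pattern_Un: "pattern N (Z1 \<union> Z2) = pattern N Z1 \<inter> pattern N Z2"
  by (auto simp: pattern_def)

text \<open>Row by row from the bottom: for the inverse \<open>h\<close>, the entries of \<open>g h = 1\<close> below the diagonal
  express \<open>h\<close> through its lower rows, since the diagonal of \<open>g\<close> has no zero.\<close>

lemma below_diag_inv:
  assumes g: "g \<in> pattern N below_diag"
  shows "inv\<^bsub>GL N\<^esub> g \<in> pattern N below_diag"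
proof -
  have GL: "g \<in> carrier (GL N)" using g by (auto simp: pattern_def)
  note h = GL_inv[OF GL] and gc = GL_carrier[OF GL]
  define h where "h = inv\<^bsub>GL N\<^esub> g"
  have upper: "g $$ (i, k) = 0" if "k < i" "i < N" for i k
    using g that by (auto simp: pattern_def below_diag_def)
  have "upper_triangular g" using gc upper by auto
  then have diag: "g $$ (i, i) \<noteq> 0" if "i < N" for i
    using upper_triangular_imp_det_eq_0_iff[OF gc] GL that gc by (auto simp: GL_iff diag_mat_def)
  have "i < N \<Longrightarrow> \<forall>j<i. h $$ (i, j) = 0" for i
  proof (induction "N - i" arbitrary: i rule: less_induct)
    case less
    show ?case
    proof (intro allI impI)
      fix j assume j: "j < i"
      have "0 = (g * h) $$ (i, j)" using h(3) j less.prems by (simp add: h_def)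
      also have "\<dots> = (\<Sum>k<N. g $$ (i, k) * h $$ (k, j))"
        using less.prems j h(2) gc by (intro mat_mult_entry) (auto simp: h_def)
      also have "\<dots> = (\<Sum>k\<in>{i}. g $$ (i, k) * h $$ (k, j))"
      proof (intro sum.mono_neutral_right ballI)
        fix k assume k: "k \<in> {..<N} - {i}"
        show "g $$ (i, k) * h $$ (k, j) = 0"
        proof (cases "k < i")
          case False
          then have "N - k < N - i" "k < N" "j < k" using k j less.prems by auto
          then show ?thesis using less.hyps[of k] by simp
        qed (simp add: upper less.prems)
      qed (use less.prems in auto)
      finally show "h $$ (i, j) = 0" using diag[OF less.prems] by simp
    qed
  qed
  then show ?thesis using h(1) by (auto simp: pattern_def below_diag_def h_def)
qed

text \<open>Block diagonal matrices are those that commute with the projections onto the coordinate subspaces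
  of dimension \<open>d \<in> D\<close>, and the inverse commutes with them as well.\<close>

lemma off_blocks_inv:
  assumes g: "g \<in> pattern N (off_blocks D)"
  shows "inv\<^bsub>GL N\<^esub> g \<in> pattern N (off_blocks D)"
proof -
  have GL: "g \<in> carrier (GL N)" using g by (auto simp: pattern_def)
  note h = GL_inv[OF GL] and gc = GL_carrier[OF GL]
  define h where "h = inv\<^bsub>GL N\<^esub> g"
  have hc: "h \<in> carrier_mat N N" using h by (simp add: h_def)
  have "h $$ (i, j) = 0" if ij: "i < N" "j < N" and d: "d \<in> D" "(i < d) \<noteq> (j < d)" for i j d
  proof -
    \<comment> \<open>the projection onto the first \<open>d\<close> coordinates\<close>
    define P :: "complex mat" where "P = mat N N (\<lambda>(i, j). if i = j \<and> i < d then 1 else 0)"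
    have Pc: "P \<in> carrier_mat N N" by (simp add: P_def)
    have AP: "(A * P) $$ (i, j) = (if j < d then A $$ (i, j) else 0)"
      "(P * A) $$ (i, j) = (if i < d then A $$ (i, j) else 0)"
      if A: "A \<in> carrier_mat N N" and ij: "i < N" "j < N" for A i j
    proof -
      have "(A * P) $$ (i, j) = (\<Sum>k<N. A $$ (i, k) * P $$ (k, j))"
        using A Pc ij by (intro mat_mult_entry)
      also have "\<dots> = (\<Sum>k\<in>{j}. A $$ (i, k) * P $$ (k, j))"
        using ij by (intro sum.mono_neutral_right) (auto simp: P_def)
      finally show "(A * P) $$ (i, j) = (if j < d then A $$ (i, j) else 0)" using ij by (simp add: P_def)
      have "(P * A) $$ (i, j) = (\<Sum>k<N. P $$ (i, k) * A $$ (k, j))"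
        using A Pc ij by (intro mat_mult_entry)
      also have "\<dots> = (\<Sum>k\<in>{i}. P $$ (i, k) * A $$ (k, j))"
        using ij by (intro sum.mono_neutral_right) (auto simp: P_def)
      finally show "(P * A) $$ (i, j) = (if i < d then A $$ (i, j) else 0)" using ij by (simp add: P_def)
    qed
    have g0: "g $$ (i, j) = 0" if "i < N" "j < N" "(i < d) \<noteq> (j < d)" for i j
      using g that d(1) unfolding pattern_def off_blocks_def by blast
    have comm: "g * P = P * g"
    proof (rule eq_matI)
      fix i j assume "i < dim_row (P * g)" "j < dim_col (P * g)"
      then have "i < N" "j < N" using Pc gc by auto
      then show "(g * P) $$ (i, j) = (P * g) $$ (i, j)"
        using AP[OF gc, of i j] g0[of i j] by (auto simp del: index_mult_mat(1))
    qed (use Pc gc in auto)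
    have "P * h = (h * g) * (P * h)" using h hc Pc by (simp add: h_def)
    also have "\<dots> = h * (g * P) * h"
      using hc gc Pc by (simp add: assoc_mult_mat[of _ N N _ N _ N])
    also have "\<dots> = (h * P) * (g * h)"
      using hc gc Pc by (simp add: comm assoc_mult_mat[of _ N N _ N _ N])
    also have "\<dots> = h * P" using h hc Pc by (simp add: h_def)
    finally have "(P * h) $$ (i, j) = (h * P) $$ (i, j)" by simp
    then show ?thesis using AP[OF hc ij] d(2) by (auto split: if_splits)
  qed
  then show ?thesis using h(1) by (auto simp: pattern_def off_blocks_def h_def)
qed

lemma subgroup_pattern:
  assumes "\<And>i. (i, i) \<notin> Z" "\<And>i j k. (i, j) \<in> Z \<Longrightarrow> (i, k) \<in> Z \<or> (k, j) \<in> Z"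
    and "\<And>g. g \<in> pattern N Z \<Longrightarrow> inv\<^bsub>GL N\<^esub> g \<in> pattern N Z"
  shows "subgroup (pattern N Z) (GL N)"
proof (rule group.subgroupI[OF group_GL])
  show "pattern N Z \<subseteq> carrier (GL N)" by (auto simp: pattern_def)
  show "pattern N Z \<noteq> {}" using pattern_one[OF assms(1)] by blast
  show "g \<otimes>\<^bsub>GL N\<^esub> h \<in> pattern N Z" if "g \<in> pattern N Z" "h \<in> pattern N Z" for g h
    using pattern_mult[OF assms(2)] that by simp
qed (use assms(3) in blast)

lemma subgroup_blocks: "subgroup (pattern N (off_blocks D)) (GL N)"
proof (rule subgroup_pattern)
  show "(i, k) \<in> off_blocks D \<or> (k, j) \<in> off_blocks D" if "(i, j) \<in> off_blocks D" for i j k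
    using that by (auto simp: off_blocks_def)
qed (auto simp: off_blocks_inv, auto simp: off_blocks_def)

lemma subgroup_upper_blocks: "subgroup (pattern N (off_blocks D \<union> below_diag)) (GL N)"
proof (rule subgroup_pattern)
  show "(i, k) \<in> off_blocks D \<union> below_diag \<or> (k, j) \<in> off_blocks D \<union> below_diag"
    if "(i, j) \<in> off_blocks D \<union> below_diag" for i j k
    using that unfolding off_blocks_def below_diag_def by auto
  show "inv\<^bsub>GL N\<^esub> g \<in> pattern N (off_blocks D \<union> below_diag)"
    if "g \<in> pattern N (off_blocks D \<union> below_diag)" for g
    using that by (simp add: pattern_Un off_blocks_inv below_diag_inv)
  show "(i, i) \<notin> off_blocks D \<union> below_diag" for i
    by (auto simp: off_blocks_def below_diag_def)
qed

lemma transv_pattern_blocks: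
  assumes "p < N" "q < N" "p \<noteq> q" "(p, q) \<notin> off_blocks D"
  shows "transv N p q c \<in> pattern N (off_blocks D)"
proof -
  have "transv N p q c $$ (i, j) = 0" if "i < N" "j < N" "(i, j) \<in> off_blocks D" for i j
  proof -
    have "i \<noteq> j" "\<not> (i = p \<and> j = q)" using that(3) assms(4) by (auto simp: off_blocks_def)
    then show ?thesis using that by (auto simp: emb2_def)
  qed
  then show ?thesis using transv_GL(1)[OF assms(1-3)] by (simp add: pattern_def)
qed

text \<open>With \<open>E\<close> the elementary matrix at \<open>(p, q)\<close>, the terms linear in \<open>E\<close> of the trace of
  \<open>u (1 + E) u (1 - E)\<close> cancel, and the quadratic one is minus the square of a single entry of \<open>u\<close>.\<close>

lemma tr_transv_conj:
  assumes u: "u \<in> carrier_mat N N" and pq: "p < N" "q < N" "p \<noteq> q"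
  shows "tr N ((u * transv N p q 1) * (u * transv N p q (- 1))) = tr N (u * u) - u $$ (q, p) ^ 2"
proof -
  have right: "(u * transv N p q c) $$ (a, b) = u $$ (a, b) + (if b = q then c * u $$ (a, p) else 0)"
    if "a < N" "b < N" for a b c
    using emb2_right_entry[OF pq u that, of 1 c 0 1] pq(3) by auto
  let ?u = "\<lambda>a b. u $$ (a, b)"
  have "tr N ((u * transv N p q 1) * (u * transv N p q (- 1))) =
      (\<Sum>a<N. \<Sum>b<N. (?u a b + (if b = q then ?u a p else 0)) * (?u b a + (if a = q then - ?u b p else 0)))"
    unfolding tr_def using u
    by (intro sum.cong refl, subst mat_mult_entry[where N = N]) (auto simp: right simp del: index_mult_mat(1) intro!: sum.cong)
  also have "\<dots> = (\<Sum>a<N. \<Sum>b<N. ?u a b * ?u b a + (if b = q then ?u a p * ?u b a else 0)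
      - (if a = q then ?u a b * ?u b p else 0) - (if a = q then if b = q then ?u a p * ?u b p else 0 else 0))"
    by (intro sum.cong refl) (auto simp: algebra_simps)
  also have "\<dots> = (\<Sum>a<N. \<Sum>b<N. ?u a b * ?u b a) + (\<Sum>a<N. ?u a p * ?u q a)
      - (\<Sum>b<N. ?u q b * ?u b p) - ?u q p * ?u q p"
  proof -
    have "(\<Sum>a<N. \<Sum>b<N. if b = q then ?u a p * ?u b a else 0) = (\<Sum>a<N. ?u a p * ?u q a)"
      using pq by (intro sum.cong refl) simp
    moreover have "(\<Sum>a<N. \<Sum>b<N. if a = q then ?u a b * ?u b p else 0) = (\<Sum>b<N. ?u q b * ?u b p)"
      using pq by (subst sum.swap) simp
    moreover have "(\<Sum>a<N. \<Sum>b<N. if a = q then if b = q then ?u a p * ?u b p else 0 else 0) = ?u q p * ?u q p"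
      using pq by (subst sum.swap) (simp add: sum.delta)
    ultimately show ?thesis by (simp add: sum.distrib sum_subtractf)
  qed
  also have "\<dots> = (\<Sum>a<N. \<Sum>b<N. ?u a b * ?u b a) - ?u q p ^ 2"
    by (simp add: mult.commute power2_eq_square)
  also have "(\<Sum>a<N. \<Sum>b<N. ?u a b * ?u b a) = tr N (u * u)"
    unfolding tr_def using u by (intro sum.cong refl) (simp add: mat_mult_entry del: index_mult_mat(1))
  finally show ?thesis .
qed

text \<open>If \<open>U\<close> is normal and unipotent, then \<open>u\<close>, \<open>u\<^sup>2\<close> and \<open>u h u h'\<close>, with \<open>h = 1 + E\<close> elementary in the
  group and \<open>h' = 1 - E\<close> its inverse, all lie in \<open>U\<close> and have trace \<open>N\<close>. By the trace formula all
  off-diagonal entries of \<open>u\<close> within the blocks vanish, and a diagonal unipotent matrix is \<open>1\<close>.\<close>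

lemma normal_unipotent_trivial:
  assumes U: "subgroup U (GL N)"
    and normal: "U \<lhd> (GL N)\<lparr>carrier := pattern N (off_blocks D)\<rparr>" and unip: "unipotent N U"
  shows "U = {1\<^sub>m N}"
proof -
  let ?L = "pattern N (off_blocks D)"
  interpret G: group "GL N" by (rule group_GL)
  note L = subgroup_blocks[of N D]
  have UL: "U \<subseteq> ?L"
    using normal subgroup.subset[OF normal_imp_subgroup[OF normal]] by simp
  have conj: "h * u * inv\<^bsub>GL N\<^esub> h \<in> U" if "h \<in> ?L" "u \<in> U" for h u
    using normal.inv_op_closed2[OF normal, of h u] that G.m_inv_consistent[OF L, of h] by simp
  have mult: "u * v \<in> U" if "u \<in> U" "v \<in> U" for u v
    using subgroup.m_closed[OF U that] by simp
  have Uc: "u \<in> carrier_mat N N" if "u \<in> U" for u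
    using subgroup.mem_carrier[OF U that] by (rule GL_carrier)
  have tr: "tr N u = of_nat N" if "u \<in> U" for u
    using unip that unipotent_tr[OF Uc[OF that]] unfolding unipotent_def by blast
  have "u = 1\<^sub>m N" if u: "u \<in> U" for u
  proof -
    have off: "u $$ (q, p) = 0" if pq: "p < N" "q < N" "p \<noteq> q" for p q
    proof (cases "(p, q) \<in> off_blocks D")
      case True
      then have "(q, p) \<in> off_blocks D" by (auto simp: off_blocks_def)
      then show ?thesis using UL u pq by (auto simp: pattern_def)
    next
      case False
      have h: "transv N p q 1 \<in> ?L" using transv_pattern_blocks[OF pq False] .
      have "u * (transv N p q 1 * u * transv N p q (- 1)) \<in> U"
        using mult[OF u conj[OF h u]] transv_GL(2)[OF pq, of 1] by simp
      also have "u * (transv N p q 1 * u * transv N p q (- 1)) =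
          (u * transv N p q 1) * (u * transv N p q (- 1))"
        using Uc[OF u] by (simp add: assoc_mult_mat[of _ N N _ N _ N])
      finally have "tr N ((u * transv N p q 1) * (u * transv N p q (- 1))) = of_nat N" by (rule tr)
      moreover have "tr N (u * u) = of_nat N" using tr[OF mult[OF u u]] .
      ultimately show ?thesis using tr_transv_conj[OF Uc[OF u] pq] by simp
    qed
    obtain k where k: "(u - 1\<^sub>m N) ^\<^sub>m k = 0\<^sub>m N N" using unip u by (auto simp: unipotent_def)
    have "upper_triangular (u - 1\<^sub>m N)"
      using Uc[OF u] off by (intro upper_triangularI) auto
    then have "(u - 1\<^sub>m N) $$ (i, i) = 0" if "i < N" for i
      using upper_triangular_nilpotent_diag[OF minus_carrier_mat[OF one_carrier_mat] _ k that] by blast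
    then have diag: "u $$ (i, i) = 1" if "i < N" for i
      using that Uc[OF u] by simp
    show ?thesis
      using Uc[OF u] off diag by (intro eq_matI) auto
  qed
  moreover have "1\<^sub>m N \<in> U" using subgroup.one_closed[OF U] by simp
  ultimately show ?thesis by blast
qed

lemma connected_reductive_blocks: "connected_reductive N (pattern N (off_blocks D))"
  unfolding connected_reductive_def closed_subgroup_def
  using subgroup_blocks closedin_pattern connectedin_pattern normal_unipotent_trivial by blast


section \<open>Solvability\<close>

lemma (in group) solvable_restrict_iff:
  assumes H: "subgroup H G"
  shows "solvable (G\<lparr>carrier := H\<rparr>) \<longleftrightarrow> (\<exists>n. (derived G ^^ n) H = {\<one>})"
proof -
  interpret K: group "G\<lparr>carrier := H\<rparr>" using subgroup_imp_group[OF H] .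
  have sub: "(derived G ^^ n) H \<subseteq> H" for n
    by (induction n) (simp_all add: derived_incl[OF _ H])
  have "(derived (G\<lparr>carrier := H\<rparr>) ^^ n) H = (derived G ^^ n) H" for n
    by (induction n) (simp_all add: derived_consistent[OF sub H])
  then show ?thesis using K.solvable_iff_trivial_derived_seq by simp
qed

text \<open>Vanishing below the \<open>k\<close>-th superdiagonal.\<close>

definition band :: "nat \<Rightarrow> nat \<Rightarrow> complex mat \<Rightarrow> bool" where
  "band N k A \<longleftrightarrow> (\<forall>i<N. \<forall>j<N. j < i + k \<longrightarrow> A $$ (i, j) = 0)"

lemma band_mult:
  assumes "A \<in> carrier_mat N N" "B \<in> carrier_mat N N" "band N k A" "band N l B"
  shows "band N (k + l) (A * B)"
  unfolding band_def
proof (intro allI impI)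
  fix i j assume ij: "i < N" "j < N" "j < i + (k + l)"
  have "(A * B) $$ (i, j) = (\<Sum>m<N. A $$ (i, m) * B $$ (m, j))"
    using assms ij by (intro mat_mult_entry)
  also have "\<dots> = 0"
  proof (intro sum.neutral ballI)
    fix m assume "m \<in> {..<N}"
    then show "A $$ (i, m) * B $$ (m, j) = 0"
      using assms(3,4) ij by (cases "m < i + k") (auto simp: band_def)
  qed
  finally show "(A * B) $$ (i, j) = 0" .
qed

lemma band_add: "A \<in> carrier_mat N N \<Longrightarrow> B \<in> carrier_mat N N \<Longrightarrow> band N k A \<Longrightarrow> band N k B \<Longrightarrow> band N k (A + B)"
  by (auto simp: band_def)

lemma band_diff: "A \<in> carrier_mat N N \<Longrightarrow> B \<in> carrier_mat N N \<Longrightarrow> band N k A \<Longrightarrow> band N k B \<Longrightarrow> band N k (A - B)"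
  by (auto simp: band_def)

lemma band_mono: "band N k A \<Longrightarrow> l \<le> k \<Longrightarrow> band N l A"
  by (auto simp: band_def)

text \<open>The group of upper triangular matrices (\<open>k = 0\<close>) and its descending series of unipotent subgroups.\<close>

definition upper_filtration :: "nat \<Rightarrow> nat \<Rightarrow> complex mat set" where
  "upper_filtration N k = {g \<in> pattern N below_diag. band N k (g - 1\<^sub>m N)}"

lemma pattern_below_diag_iff: "g \<in> pattern N below_diag \<longleftrightarrow> g \<in> carrier (GL N) \<and> band N 0 g"
  by (auto simp: pattern_def below_diag_def band_def)

lemma subgroup_upper: "subgroup (pattern N below_diag) (GL N)"
  using subgroup_upper_blocks[of N "{}"] by (simp add: off_blocks_def)

lemma subgroup_upper_filtration: "subgroup (upper_filtration N k) (GL N)"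
proof (rule group.subgroupI[OF group_GL])
  show "upper_filtration N k \<subseteq> carrier (GL N)" by (auto simp: upper_filtration_def pattern_def)
  have "1\<^sub>m N \<in> upper_filtration N k"
    using subgroup.one_closed[OF subgroup_upper[of N]] by (auto simp: upper_filtration_def band_def)
  then show "upper_filtration N k \<noteq> {}" by blast
  fix g assume g: "g \<in> upper_filtration N k"
  then have GL: "g \<in> carrier (GL N)" and b0: "band N 0 g" and b: "band N k (g - 1\<^sub>m N)"
    by (auto simp: upper_filtration_def pattern_below_diag_iff)
  note gc = GL_carrier[OF GL] and gi = GL_inv[OF GL]
  let ?h = "inv\<^bsub>GL N\<^esub> g"
  have h: "?h \<in> pattern N below_diag" using g below_diag_inv by (auto simp: upper_filtration_def)
  have "?h - 1\<^sub>m N = 0\<^sub>m N N - (g - 1\<^sub>m N) * ?h"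
  proof -
    have "(g - 1\<^sub>m N) * ?h = 1\<^sub>m N - ?h"
      using gc gi by (simp add: minus_mult_distrib_mat[of _ N N _ _ N])
    then show ?thesis using gi(2) by (intro eq_matI) auto
  qed
  moreover have "band N (k + 0) ((g - 1\<^sub>m N) * ?h)"
    using gc gi b h by (intro band_mult) (auto simp: pattern_below_diag_iff)
  ultimately have "band N k (?h - 1\<^sub>m N)"
    using gc gi by (auto simp: band_def)
  then show "?h \<in> upper_filtration N k" using h by (simp add: upper_filtration_def)
  fix g' assume g': "g' \<in> upper_filtration N k"
  then have GL': "g' \<in> carrier (GL N)" and b0': "band N 0 g'" and b': "band N k (g' - 1\<^sub>m N)"
    by (auto simp: upper_filtration_def pattern_below_diag_iff)
  note gc' = GL_carrier[OF GL']
  have "(g - 1\<^sub>m N) * g' = g * g' - g'"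
    using gc gc' by (simp add: minus_mult_distrib_mat[of _ N N _ _ N])
  then have "g * g' - 1\<^sub>m N = (g - 1\<^sub>m N) * g' + (g' - 1\<^sub>m N)"
    using gc gc' by (intro eq_matI) (auto simp del: index_mult_mat(1))
  moreover have "band N (k + 0) ((g - 1\<^sub>m N) * g')"
    using gc gc' b b0' by (intro band_mult) auto
  ultimately have "band N k (g * g' - 1\<^sub>m N)"
    using gc gc' b' by (auto intro!: band_add)
  moreover have "g * g' \<in> pattern N below_diag"
    using subgroup.m_closed[OF subgroup_upper, of g N g'] g g' by (auto simp: upper_filtration_def)
  ultimately show "g \<otimes>\<^bsub>GL N\<^esub> g' \<in> upper_filtration N k" by (simp add: upper_filtration_def)
qed

text \<open>For \<open>k > 0\<close> write \<open>x = 1 + a\<close> and \<open>y = 1 + b\<close>; then \<open>x y - y x = a b - b a\<close> vanishes even below the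
  superdiagonal \<open>2 k\<close>. For \<open>k = 0\<close> only the diagonal matters, on which \<open>x\<close> and \<open>y\<close> multiply
  entrywise.\<close>

lemma band_commutator:
  assumes x: "x \<in> carrier_mat N N" "band N 0 x" "band N k (x - 1\<^sub>m N)"
    and y: "y \<in> carrier_mat N N" "band N 0 y" "band N k (y - 1\<^sub>m N)"
  shows "band N (Suc k) (x * y - y * x)"
proof (cases k)
  case 0
  have up: "upper_triangular x" "upper_triangular y"
    using x y by (auto simp: band_def intro!: upper_triangularI)
  have "(x * y - y * x) $$ (i, j) = 0" if "i < N" "j < N" "j < i + 1" for i j
  proof (cases "j = i")
    case True
    then show ?thesis
      using that x y upper_triangular_mult_entry(2)[OF x(1) y(1) up] upper_triangular_mult_entry(2)[OF y(1) x(1) up(2,1)]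
      by (simp del: index_mult_mat(1) add: mult.commute)
  next
    case False
    then show ?thesis
      using that x y upper_triangularD[OF upper_triangular_mult_entry(1)[OF x(1) y(1) up], of j i]
        upper_triangularD[OF upper_triangular_mult_entry(1)[OF y(1) x(1) up(2,1)], of j i]
      by (simp del: index_mult_mat(1))
  qed
  then show ?thesis using 0 by (simp add: band_def)
next
  case (Suc l)
  let ?a = "x - 1\<^sub>m N" and ?b = "y - 1\<^sub>m N"
  have expand: "(A - 1\<^sub>m N) * (B - 1\<^sub>m N) = A * B - A - (B - 1\<^sub>m N)"
    if "A \<in> carrier_mat N N" "B \<in> carrier_mat N N" for A B :: "complex mat"
  proof -
    have B1: "B - 1\<^sub>m N \<in> carrier_mat N N" by (rule minus_carrier_mat) simp
    have "(A - 1\<^sub>m N) * (B - 1\<^sub>m N) = A * (B - 1\<^sub>m N) - 1\<^sub>m N * (B - 1\<^sub>m N)"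
      using that B1 by (intro minus_mult_distrib_mat) auto
    also have "A * (B - 1\<^sub>m N) = A * B - A * 1\<^sub>m N"
      using that by (intro mult_minus_distrib_mat) auto
    finally show ?thesis using that B1 by simp
  qed
  have "x * y - y * x = ?a * ?b - ?b * ?a"
    unfolding expand[OF x(1) y(1)] expand[OF y(1) x(1)]
    using x(1) y(1) by (intro eq_matI) (auto simp del: index_mult_mat(1))
  moreover have "band N (k + k) (?a * ?b)" "band N (k + k) (?b * ?a)"
    using x y by (auto intro!: band_mult)
  ultimately have "band N (k + k) (x * y - y * x)"
    using x y by (auto intro!: band_diff)
  then show ?thesis by (rule band_mono) (simp add: Suc)
qed

text \<open>A commutator minus \<open>1\<close> equals \<open>(x y - y x)\<close> times an upper triangular matrix.\<close>

lemma derived_upper_filtration: "derived (GL N) (upper_filtration N k) \<subseteq> upper_filtration N (Suc k)"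
proof -
  interpret group "GL N" by (rule group_GL)
  have "x * y * inv\<^bsub>GL N\<^esub> x * inv\<^bsub>GL N\<^esub> y \<in> upper_filtration N (Suc k)"
    if x: "x \<in> upper_filtration N k" and y: "y \<in> upper_filtration N k" for x y
  proof -
    have GL: "x \<in> carrier (GL N)" "y \<in> carrier (GL N)"
      and b: "band N 0 x" "band N 0 y" "band N k (x - 1\<^sub>m N)" "band N k (y - 1\<^sub>m N)"
      and up: "x \<in> pattern N below_diag" "y \<in> pattern N below_diag"
      using x y by (auto simp: upper_filtration_def pattern_below_diag_iff)
    let ?x = "inv\<^bsub>GL N\<^esub> x" and ?y = "inv\<^bsub>GL N\<^esub> y"
    note c = GL_carrier[OF GL(1)] GL_carrier[OF GL(2)] GL_inv(2)[OF GL(1)] GL_inv(2)[OF GL(2)]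
    have bi: "band N 0 ?x" "band N 0 ?y"
      using below_diag_inv up by (auto simp: pattern_below_diag_iff)
    have "(x * y - y * x) * (?x * ?y) = x * y * (?x * ?y) - y * x * (?x * ?y)"
      using c by (intro minus_mult_distrib_mat[of _ N N _ _ N]) auto
    also have "y * x * (?x * ?y) = y * (x * ?x) * ?y"
      using c by (simp add: assoc_mult_mat[of _ N N _ N _ N])
    also have "\<dots> = 1\<^sub>m N" using c GL_inv(3)[OF GL(1)] GL_inv(3)[OF GL(2)] by simp
    also have "x * y * (?x * ?y) = x * y * ?x * ?y"
      using c by (simp add: assoc_mult_mat[of _ N N _ N _ N])
    finally have eq: "x * y * ?x * ?y - 1\<^sub>m N = (x * y - y * x) * (?x * ?y)" ..
    have "band N (Suc k + (0 + 0)) ((x * y - y * x) * (?x * ?y))"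
      using c b bi by (intro band_mult band_commutator) auto
    moreover have "x * y * ?x * ?y \<in> pattern N below_diag"
      using subgroup.m_closed[OF subgroup_upper[of N]] subgroup.m_inv_closed[OF subgroup_upper[of N]] up
      by simp
    ultimately show ?thesis by (simp only: upper_filtration_def mem_Collect_eq eq add_0_right)
  qed
  then have "derived_set (GL N) (upper_filtration N k) \<subseteq> upper_filtration N (Suc k)" by auto
  then show ?thesis
    unfolding derived_def by (rule generate_subgroup_incl[OF _ subgroup_upper_filtration])
qed

lemma upper_filtration_N: "upper_filtration N N = {1\<^sub>m N}"
proof
  show "upper_filtration N N \<subseteq> {1\<^sub>m N}"
  proof
    fix g assume "g \<in> upper_filtration N N"
    then have g: "g \<in> carrier_mat N N" "band N N (g - 1\<^sub>m N)"
      by (auto simp: upper_filtration_def pattern_def GL_iff)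
    then have "g $$ (i, j) - 1\<^sub>m N $$ (i, j) = 0" if "i < N" "j < N" for i j
      using that unfolding band_def by (metis carrier_matD index_minus_mat(1) index_one_mat(2,3) trans_less_add2)
    then have "g = 1\<^sub>m N" using g by (intro eq_matI) auto
    then show "g \<in> {1\<^sub>m N}" by simp
  qed
  show "{1\<^sub>m N} \<subseteq> upper_filtration N N"
    using subgroup.one_closed[OF subgroup_upper_filtration[of N N]] by simp
qed

lemma solvable_upper_blocks:
  "solvable ((GL N)\<lparr>carrier := pattern N (off_blocks D \<union> below_diag)\<rparr>)"
proof -
  interpret group "GL N" by (rule group_GL)
  let ?H = "pattern N (off_blocks D \<union> below_diag)"
  have "(derived (GL N) ^^ k) ?H \<subseteq> upper_filtration N k" for k
  proof (induction k)
    case 0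
    then show ?case
      by (auto simp: upper_filtration_def pattern_Un pattern_below_diag_iff GL_iff band_def)
  next
    case (Suc k)
    then show ?case using mono_derived[OF Suc] derived_upper_filtration[of N k] by simp
  qed
  from this[of N] have "(derived (GL N) ^^ N) ?H \<subseteq> {1\<^sub>m N}" by (simp add: upper_filtration_N)
  moreover have "1\<^sub>m N \<in> (derived (GL N) ^^ N) ?H"
    using subgroup.one_closed[OF exp_of_derived_is_subgroup[OF subgroup_upper_blocks]] by simp
  ultimately show ?thesis
    unfolding solvable_restrict_iff[OF subgroup_upper_blocks] by (intro exI[of _ N]) auto
qed

text \<open>The torus element \<open>diag (2, 1/2)\<close> is a product of root elements, and commutators with it scale the
  parameter of a root element by \<open>3\<close> or \<open>-3/4\<close>. Hence no term of the derived series loses the two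
  root subgroups.\<close>

lemma opposite_transv_derived:
  assumes pq: "p < N" "q < N" "p \<noteq> q" and S: "subgroup S (GL N)"
    and U: "\<And>c. emb2 N p q 1 c 0 1 \<in> S" and L: "\<And>c. emb2 N p q 1 0 c 1 \<in> S"
  shows "emb2 N p q 1 c 0 1 \<in> derived (GL N) S" "emb2 N p q 1 0 c 1 \<in> derived (GL N) S"
proof -
  interpret group "GL N" by (rule group_GL)
  have mult: "x * y \<in> S" if "x \<in> S" "y \<in> S" for x y
    using subgroup.m_closed[OF S that] by simp
  have com: "x * y * x' * y' \<in> derived (GL N) S"
    if "x \<in> S" "y \<in> S" "inv\<^bsub>GL N\<^esub> x = x'" "inv\<^bsub>GL N\<^esub> y = y'" for x y x' y'
    unfolding derived_def using that by (intro generate.incl) auto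
  have inv: "inv\<^bsub>GL N\<^esub> (emb2 N p q a b c d) = emb2 N p q a' b' c' d'"
    if "a * a' + b * c' = 1" "a * b' + b * d' = 0" "c * a' + d * c' = 0" "c * b' + d * d' = 1"
    for a b c d a' b' c' d'
    using that by (intro GL_I(3)[OF emb2_carrier emb2_carrier]) (simp add: emb2_mult[OF pq] emb2_one)
  \<comment> \<open>lower times upper times lower times upper root element\<close>
  have "emb2 N p q 1 0 (- 1/2) 1 * (emb2 N p q 1 1 0 1 * (emb2 N p q 1 0 1 1 * emb2 N p q 1 (- 1/2) 0 1)) \<in> S"
    by (intro mult U L)
  then have T: "emb2 N p q 2 0 0 (1/2) \<in> S" by (simp add: emb2_mult[OF pq])
  have Ti: "inv\<^bsub>GL N\<^esub> (emb2 N p q 2 0 0 (1/2)) = emb2 N p q (1/2) 0 0 2" by (rule inv) auto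
  have Ui: "inv\<^bsub>GL N\<^esub> (emb2 N p q 1 c 0 1) = emb2 N p q 1 (- c) 0 1" for c by (rule inv) auto
  have Li: "inv\<^bsub>GL N\<^esub> (emb2 N p q 1 0 c 1) = emb2 N p q 1 0 (- c) 1" for c by (rule inv) auto
  show "emb2 N p q 1 c 0 1 \<in> derived (GL N) S"
    using com[OF T U Ti Ui, of "c / 3"] by (simp add: emb2_mult[OF pq] field_simps)
  show "emb2 N p q 1 0 c 1 \<in> derived (GL N) S"
    using com[OF T L Ti Li, of "- 4 * c / 3"] by (simp add: emb2_mult[OF pq] field_simps)
qed

lemma not_solvable_opposite_transv:
  assumes pq: "p < N" "q < N" "p \<noteq> q" and S: "subgroup S (GL N)"
    and U: "\<And>c. emb2 N p q 1 c 0 1 \<in> S" and L: "\<And>c. emb2 N p q 1 0 c 1 \<in> S"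
  shows "\<not> solvable ((GL N)\<lparr>carrier := S\<rparr>)"
proof -
  interpret group "GL N" by (rule group_GL)
  have "\<forall>c. emb2 N p q 1 c 0 1 \<in> (derived (GL N) ^^ n) S \<and> emb2 N p q 1 0 c 1 \<in> (derived (GL N) ^^ n) S" for n
  proof (induction n)
    case (Suc n)
    then show ?case
      using opposite_transv_derived[OF pq exp_of_derived_is_subgroup[OF S, of n]] by simp
  qed (use U L in simp)
  moreover have "emb2 N p q 1 1 0 1 \<noteq> 1\<^sub>m N"
  proof
    assume "emb2 N p q 1 1 0 1 = 1\<^sub>m N"
    then have "emb2 N p q 1 1 0 1 $$ (p, q) = 1\<^sub>m N $$ (p, q)" by simp
    then show False using pq by (simp add: emb2_def)
  qed
  ultimately show ?thesis unfolding solvable_restrict_iff[OF S] by fastforce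
qed

text \<open>Let \<open>q\<close> be the first column in which \<open>g\<close> is not upper triangular and \<open>p > q\<close> the last row with a
  nonzero entry there. Left multiplication of \<open>g\<close> by an upper triangular matrix gives an element \<open>h\<close>
  of the larger group that maps the unit vector \<open>e\<close> at \<open>q\<close> to the one at \<open>p\<close> and still preserves the
  flag before \<open>q\<close>. So row \<open>q\<close> of \<open>h\<close>, call it \<open>r\<close>, vanishes up to column \<open>q\<close>, the matrix
  \<open>1 + c e r\<close> is upper triangular, and conjugation by \<open>h\<close> turns it into the root element at the
  lower position \<open>(p, q)\<close>. The upper root elements at \<open>(q, p)\<close> belong to the smaller
  group already.\<close>

lemma borel_maximal:
  assumes sub: "pattern N (off_blocks D \<union> below_diag) \<subseteq> H'" and H'L: "H' \<subseteq> pattern N (off_blocks D)"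
    and H': "subgroup H' (GL N)" and g: "g \<in> H'" "g \<notin> pattern N (off_blocks D \<union> below_diag)"
  shows "\<not> solvable ((GL N)\<lparr>carrier := H'\<rparr>)"
proof -
  let ?H = "pattern N (off_blocks D \<union> below_diag)"
  interpret group "GL N" by (rule group_GL)
  have mult: "x * y \<in> H'" if "x \<in> H'" "y \<in> H'" for x y
    using subgroup.m_closed[OF H' that] by simp
  have inv: "inv\<^bsub>GL N\<^esub> x \<in> H'" if "x \<in> H'" for x
    using subgroup.m_inv_closed[OF H' that] .
  have gL: "g \<in> pattern N (off_blocks D)" using g H'L by blast
  then have gGL: "g \<in> carrier (GL N)" by (simp add: pattern_def)
  have gc: "g \<in> carrier_mat N N" using gGL by (rule GL_carrier)
  define bad where "bad q \<longleftrightarrow> (\<exists>p. q < p \<and> p < N \<and> g $$ (p, q) \<noteq> 0)" for q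
  have "\<exists>q. bad q"
    using g(2) gL by (auto simp: pattern_def below_diag_def bad_def)
  then obtain q where q: "bad q" and qmin: "\<And>j. j < q \<Longrightarrow> \<not> bad j"
    using LeastI_ex[of bad] not_less_Least[of _ bad] by blast
  \<comment> \<open>the lowest nonzero entry of that column\<close>
  define p where "p = Max {p. p < N \<and> g $$ (p, q) \<noteq> 0}"
  have fin: "finite {p. p < N \<and> g $$ (p, q) \<noteq> 0}" by simp
  have "p \<in> {p. p < N \<and> g $$ (p, q) \<noteq> 0}"
    unfolding p_def using q by (intro Max_in[OF fin]) (auto simp: bad_def)
  then have p: "p < N" "g $$ (p, q) \<noteq> 0" by auto
  have pmax: "g $$ (i, q) = 0" if "p < i" "i < N" for i
  proof (rule ccontr)
    assume "g $$ (i, q) \<noteq> 0"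
    then have "i \<le> p" unfolding p_def using that by (intro Max_ge[OF fin]) simp
    then show False using that by simp
  qed
  obtain p' where "q < p'" "p' < N" "g $$ (p', q) \<noteq> 0" using q by (auto simp: bad_def)
  then have qp: "q < p" using pmax[of p'] by (cases "p < p'") auto
  have pq: "p < N" "q < N" "p \<noteq> q" using p qp by auto
  have gcol: "g $$ (i, j) = 0" if "j < q" "j < i" "i < N" for i j
    using qmin[OF that(1)] that by (auto simp: bad_def)
  have same: "(p, q) \<notin> off_blocks D" using gL p pq by (auto simp: pattern_def)

  \<comment> \<open>\<open>b\<close> maps the unit vector at \<open>p\<close> to column \<open>q\<close> of \<open>g\<close>\<close>
  define b where "b = mat N N (\<lambda>(i, j). if j = p then g $$ (i, q) else if i = j then 1 else (0 :: complex))"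
  have bc: "b \<in> carrier_mat N N" by (simp add: b_def)
  have b_up: "upper_triangular b"
    using pmax by (intro upper_triangularI) (auto simp: b_def)
  have bGL: "b \<in> carrier (GL N)"
    using upper_triangular_imp_det_eq_0_iff[OF bc b_up] bc p by (auto simp: GL_iff diag_mat_def b_def)
  have bH: "b \<in> ?H"
  proof -
    have "b $$ (i, j) = 0" if "i < N" "j < N" "(i, j) \<in> off_blocks D \<union> below_diag" for i j
    proof (cases "j = p \<and> i \<noteq> p")
      case True
      have "g $$ (i, q) = 0"
      proof (cases "p < i")
        case False
        then have "(i, p) \<in> off_blocks D" using that(3) True by (auto simp: below_diag_def)
        then have "(i, q) \<in> off_blocks D" using same by (auto simp: off_blocks_def)
        then show ?thesis using gL that pq by (auto simp: pattern_def)
      qed (use pmax that in auto)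
      then show ?thesis using True that by (simp add: b_def)
    next
      case False
      moreover have "i \<noteq> j" using that(3) by (auto simp: off_blocks_def below_diag_def)
      ultimately show ?thesis using that by (auto simp: b_def)
    qed
    then show ?thesis using bGL by (auto simp: pattern_def)
  qed
  note bi = GL_inv[OF bGL]
  define h where "h = inv\<^bsub>GL N\<^esub> b * g"
  have hc: "h \<in> carrier_mat N N" using bi gc by (simp add: h_def)
  have hH': "h \<in> H'" unfolding h_def using bH sub g by (intro mult inv) auto
  have hL: "h \<in> pattern N (off_blocks D)" using hH' H'L by blast
  have hGL: "h \<in> carrier (GL N)" using hL by (simp add: pattern_def)
  have hcol: "h $$ (i, q) = (if i = p then 1 else 0)" if "i < N" for i
  proof -
    have "h $$ (i, q) = (\<Sum>k<N. (inv\<^bsub>GL N\<^esub> b) $$ (i, k) * g $$ (k, q))"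
      unfolding h_def using bi gc that pq by (intro mat_mult_entry) auto
    also have "\<dots> = (\<Sum>k<N. (inv\<^bsub>GL N\<^esub> b) $$ (i, k) * b $$ (k, p))"
      using pq by (intro sum.cong) (auto simp: b_def)
    also have "\<dots> = (inv\<^bsub>GL N\<^esub> b * b) $$ (i, p)"
      using bi bc that pq by (intro mat_mult_entry[symmetric]) auto
    finally show ?thesis using bi that pq by simp
  qed
  have hrow: "h $$ (q, j) = 0" if "j < q" for j
  proof -
    have "inv\<^bsub>GL N\<^esub> b \<in> ?H" using subgroup.m_inv_closed[OF subgroup_upper_blocks bH] .
    then have up: "(inv\<^bsub>GL N\<^esub> b) $$ (q, k) = 0" if "k < q" for k
      using that pq by (auto simp: pattern_def below_diag_def)
    have "h $$ (q, j) = (\<Sum>k<N. (inv\<^bsub>GL N\<^esub> b) $$ (q, k) * g $$ (k, j))"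
      unfolding h_def using bi gc that pq by (intro mat_mult_entry) auto
    also have "\<dots> = 0"
    proof (intro sum.neutral ballI)
      fix k assume "k \<in> {..<N}"
      then show "(inv\<^bsub>GL N\<^esub> b) $$ (q, k) * g $$ (k, j) = 0"
        using up[of k] gcol[OF that, of k] that by (cases "k < q") auto
    qed
    finally show ?thesis .
  qed

  have lower: "emb2 N p q 1 c 0 1 \<in> H'" for c
  proof -
    define x where "x = mat N N (\<lambda>(i, j). (if i = j then 1 else 0) + (if i = q then c * h $$ (q, j) else 0))"
    have xc: "x \<in> carrier_mat N N" by (simp add: x_def)
    have x_up: "upper_triangular x" using hrow by (intro upper_triangularI) (auto simp: x_def)
    have xGL: "x \<in> carrier (GL N)"
      using upper_triangular_imp_det_eq_0_iff[OF xc x_up] xc hcol[of q] pq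
      by (auto simp: GL_iff diag_mat_def x_def split: if_splits)
    have "x $$ (i, j) = 0" if "i < N" "j < N" "(i, j) \<in> off_blocks D \<union> below_diag" for i j
    proof -
      have "i \<noteq> j" using that(3) by (auto simp: off_blocks_def below_diag_def)
      moreover have "h $$ (q, j) = 0" if "i = q"
        using hrow[of j] hL \<open>(i, j) \<in> _\<close> that \<open>j < N\<close> \<open>i < N\<close>
        by (auto simp: pattern_def below_diag_def)
      ultimately show ?thesis using that by (auto simp: x_def)
    qed
    then have xH: "x \<in> H'" using xGL sub by (auto simp: pattern_def)
    have "h * x = emb2 N p q 1 c 0 1 * h"
    proof (rule eq_matI)
      fix i j assume "i < dim_row (emb2 N p q 1 c 0 1 * h)" "j < dim_col (emb2 N p q 1 c 0 1 * h)"
      then have ij: "i < N" "j < N" using hc by (auto simp: emb2_def)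
      have "(h * x) $$ (i, j) = (\<Sum>k<N. h $$ (i, k) * x $$ (k, j))"
        using hc xc ij by (intro mat_mult_entry)
      also have "\<dots> = (\<Sum>k<N. (if k = j then h $$ (i, k) else 0) + (if k = q then h $$ (i, k) * (c * h $$ (q, j)) else 0))"
        using ij by (intro sum.cong) (auto simp: x_def algebra_simps)
      also have "\<dots> = h $$ (i, j) + h $$ (i, q) * (c * h $$ (q, j))"
        using ij pq by (simp add: sum.distrib)
      also have "\<dots> = (emb2 N p q 1 c 0 1 * h) $$ (i, j)"
        using emb2_left_entry[OF pq hc ij, of 1 c 0 1] hcol[OF ij(1)] by (auto simp del: index_mult_mat(1))
      finally show "(h * x) $$ (i, j) = (emb2 N p q 1 c 0 1 * h) $$ (i, j)" .
    qed (use hc xc in \<open>auto simp: emb2_def\<close>)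
    then have "h * x * inv\<^bsub>GL N\<^esub> h = emb2 N p q 1 c 0 1"
      using GL_inv[OF hGL] hc
      by (simp add: assoc_mult_mat[of _ N N _ N _ N] right_mult_one_mat[OF emb2_carrier])
    then show ?thesis using mult[OF mult[OF hH' xH] inv[OF hH']] by simp
  qed
  have upper: "emb2 N p q 1 0 c 1 \<in> H'" for c
  proof -
    have "emb2 N p q 1 0 c 1 \<in> carrier (GL N)"
      using transv_GL(1)[of q N p c] pq emb2_swap[of p q N 1 c 0 1] by simp
    moreover have "emb2 N p q 1 0 c 1 $$ (i, j) = 0"
      if "i < N" "j < N" "(i, j) \<in> off_blocks D \<union> below_diag" for i j
    proof -
      have "i \<noteq> j" "\<not> (i = q \<and> j = p)"
        using that(3) same qp by (auto simp: off_blocks_def below_diag_def)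
      then show ?thesis using that by (auto simp: emb2_def)
    qed
    ultimately have "emb2 N p q 1 0 c 1 \<in> ?H" by (simp add: pattern_def)
    then show ?thesis using sub by blast
  qed
  show ?thesis by (rule not_solvable_opposite_transv[OF pq H' lower upper])
qed

lemma borel_subgroup_upper_blocks:
  "borel_subgroup N (pattern N (off_blocks D)) (pattern N (off_blocks D \<union> below_diag))"
  unfolding borel_subgroup_def connected_solvable_def closed_subgroup_def
proof (intro conjI allI impI)
  show "pattern N (off_blocks D \<union> below_diag) \<subseteq> pattern N (off_blocks D)" by (auto simp: pattern_Un)
  fix H' assume H': "pattern N (off_blocks D \<union> below_diag) \<subseteq> H' \<and> H' \<subseteq> pattern N (off_blocks D) \<and>
    (subgroup H' (GL N) \<and> closedin (zariski_GL N) H') \<and>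
    connectedin (zariski_GL N) H' \<and> solvable ((GL N)\<lparr>carrier := H'\<rparr>)"
  then show "H' = pattern N (off_blocks D \<union> below_diag)"
    using borel_maximal[of N D H'] by blast
qed (rule subgroup_upper_blocks closedin_pattern connectedin_pattern solvable_upper_blocks)+

section \<open>Decomposable bivectors\<close>

lemma wedge_carrier [simp]: "wedge N v w \<in> carrier_mat N N"
  by (simp add: wedge_def)

lemma wedge_entry: "i < N \<Longrightarrow> j < N \<Longrightarrow> wedge N v w $$ (i, j) = v $ i * w $ j - w $ i * v $ j"
  by (simp add: wedge_def)

lemma wedge_dim [simp]: "dim_row (wedge N v w) = N" "dim_col (wedge N v w) = N"
  by (simp_all add: wedge_def)

lemma wedge_eq_zeroD: "wedge N v w = 0\<^sub>m N N \<Longrightarrow> i < N \<Longrightarrow> j < N \<Longrightarrow> v $ i * w $ j = w $ i * v $ j"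
  using wedge_entry[of i N j v w] by simp

lemma wedge_skew: "transpose_mat (wedge N v w) = - wedge N v w"
  by (rule eq_matI) (auto simp: wedge_def)

lemma wedge_comb:
  assumes "v \<in> carrier_vec N" "w \<in> carrier_vec N"
  shows "wedge N (a \<cdot>\<^sub>v v + b \<cdot>\<^sub>v w) (c \<cdot>\<^sub>v v + d \<cdot>\<^sub>v w) = (a * d - b * c) \<cdot>\<^sub>m wedge N v w"
  using assms by (intro eq_matI) (auto simp: wedge_def algebra_simps)

lemma wedge_comb_smult:
  assumes "x \<in> carrier_vec N"
  shows "wedge N (a \<cdot>\<^sub>v x) (b \<cdot>\<^sub>v x) = 0\<^sub>m N N"
  using assms by (intro eq_matI) (auto simp: wedge_def)

definition coord_space :: "nat \<Rightarrow> nat \<Rightarrow> complex vec set" where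
  "coord_space N d = {v \<in> carrier_vec N. \<forall>i<N. d \<le> i \<longrightarrow> v $ i = 0}"

text \<open>The planes in \<open>E b\<close> that meet \<open>E a\<close> (for \<open>a \<le> b\<close>). For \<open>a = b = N\<close> this is the whole Grassmannian.\<close>

definition planes :: "nat \<Rightarrow> nat \<Rightarrow> nat \<Rightarrow> complex mat set set" where
  "planes N a b = {line (wedge N v w) | v w.
     v \<in> coord_space N a \<and> w \<in> coord_space N b \<and> wedge N v w \<noteq> 0\<^sub>m N N}"

definition pluecker_rel :: "nat \<Rightarrow> complex mat \<Rightarrow> bool" where
  "pluecker_rel N A \<longleftrightarrow> (\<forall>i<N. \<forall>j<N. \<forall>k<N. \<forall>l<N.
     A $$ (i, k) * A $$ (j, l) - A $$ (j, k) * A $$ (i, l) = A $$ (i, j) * A $$ (k, l))"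

definition schubert_rel :: "nat \<Rightarrow> nat \<Rightarrow> nat \<Rightarrow> complex mat \<Rightarrow> bool" where
  "schubert_rel N a b A \<longleftrightarrow>
     (\<forall>i<N. \<forall>j<N. b \<le> i \<or> b \<le> j \<or> (a \<le> i \<and> a \<le> j) \<longrightarrow> A $$ (i, j) = 0)"

lemma planes_subset_proj: "planes N a b \<subseteq> proj_space N"
  unfolding planes_def proj_space_def using wedge_skew wedge_carrier by blast

lemma pluecker_rel_wedge: "pluecker_rel N (wedge N v w)"
  unfolding pluecker_rel_def by (simp add: wedge_entry algebra_simps)

lemma schubert_rel_wedge:
  assumes "v \<in> coord_space N a" "w \<in> coord_space N b" "a \<le> b"
  shows "schubert_rel N a b (wedge N v w)"
  unfolding schubert_rel_def using assms by (auto simp: wedge_entry coord_space_def)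

lemma pluecker_rel_smult: "A \<in> carrier_mat N N \<Longrightarrow> pluecker_rel N A \<Longrightarrow> pluecker_rel N (c \<cdot>\<^sub>m A)"
  unfolding pluecker_rel_def
proof (intro allI impI)
  fix i j k l assume A: "A \<in> carrier_mat N N" and ijkl: "i < N" "j < N" "k < N" "l < N"
    and *: "\<forall>i<N. \<forall>j<N. \<forall>k<N. \<forall>l<N.
      A $$ (i, k) * A $$ (j, l) - A $$ (j, k) * A $$ (i, l) = A $$ (i, j) * A $$ (k, l)"
  have "c * c * (A $$ (i, k) * A $$ (j, l) - A $$ (j, k) * A $$ (i, l)) = c * c * (A $$ (i, j) * A $$ (k, l))"
    using * ijkl by simp
  then show "(c \<cdot>\<^sub>m A) $$ (i, k) * (c \<cdot>\<^sub>m A) $$ (j, l) - (c \<cdot>\<^sub>m A) $$ (j, k) * (c \<cdot>\<^sub>m A) $$ (i, l) =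
      (c \<cdot>\<^sub>m A) $$ (i, j) * (c \<cdot>\<^sub>m A) $$ (k, l)"
    using A ijkl by (simp add: algebra_simps)
qed

lemma schubert_rel_smult: "A \<in> carrier_mat N N \<Longrightarrow> schubert_rel N a b A \<Longrightarrow> schubert_rel N a b (c \<cdot>\<^sub>m A)"
  by (auto simp: schubert_rel_def)

lemma line_smult:
  assumes "A \<in> carrier_mat N N" "A \<noteq> 0\<^sub>m N N" "c \<noteq> 0"
  shows "line (c \<cdot>\<^sub>m A) = line A"
proof (rule line_eqI[of _ _ N])
  show "c \<cdot>\<^sub>m A \<in> line A" by (auto simp: line_def)
  show "c \<cdot>\<^sub>m A \<noteq> 0\<^sub>m N N" using smult_mat_eq_zero assms by blast
qed fact

lemma nonzero_entry:
  assumes "A \<in> carrier_mat N N" "A \<noteq> 0\<^sub>m N N"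
  obtains i j where "i < N" "j < N" "A $$ (i, j) \<noteq> 0"
proof -
  have "\<exists>i<N. \<exists>j<N. A $$ (i, j) \<noteq> 0"
  proof (rule ccontr)
    assume "\<not> ?thesis"
    then have "A = 0\<^sub>m N N" using assms(1) by (intro eq_matI) auto
    then show False using assms(2) by simp
  qed
  then show thesis using that by blast
qed

text \<open>By the Pluecker relations, any two rows \<open>i, j\<close> of \<open>A\<close> with \<open>A $$ (i, j) \<noteq> 0\<close> have wedge product
  proportional to \<open>A\<close>. The coordinate relations put every row into \<open>E b\<close>, and one of the two
  rows can be chosen in \<open>E a\<close>: any nonzero row \<open>i \<ge> a\<close>, or, if all these rows vanish, any
  nonzero row at all.\<close>

lemma planesI_rel:
  assumes A: "A \<in> carrier_mat N N" "transpose_mat A = - A" "A \<noteq> 0\<^sub>m N N"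
    and rel: "pluecker_rel N A" "schubert_rel N a b A" and "a \<le> b"
  shows "line A \<in> planes N a b"
proof -
  have skew: "A $$ (j, i) = - A $$ (i, j)" if "i < N" "j < N" for i j
    using arg_cong[OF A(2), of "\<lambda>M. M $$ (i, j)"] that A(1) by simp
  obtain i0 j0 where ij0: "i0 < N" "j0 < N" "A $$ (i0, j0) \<noteq> 0"
    using nonzero_entry[OF A(1,3)] .
  have "\<exists>i j. i < N \<and> j < N \<and> A $$ (i, j) \<noteq> 0 \<and> (\<forall>k<N. a \<le> k \<longrightarrow> A $$ (i, k) = 0)"
  proof (cases "\<exists>i j. i < N \<and> j < N \<and> A $$ (i, j) \<noteq> 0 \<and> a \<le> i")
    case True
    then obtain i j where "i < N" "j < N" "A $$ (i, j) \<noteq> 0" "a \<le> i" by blast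
    then show ?thesis using rel(2) unfolding schubert_rel_def by blast
  next
    case False
    have "A $$ (i0, k) = 0" if "k < N" "a \<le> k" for k
    proof -
      have "A $$ (k, i0) = 0" using False that ij0(1) by blast
      then show ?thesis using skew[OF that(1) ij0(1)] by simp
    qed
    then show ?thesis using ij0 by blast
  qed
  then obtain i j where ij: "i < N" "j < N" "A $$ (i, j) \<noteq> 0"
    and i: "\<And>k. k < N \<Longrightarrow> a \<le> k \<Longrightarrow> A $$ (i, k) = 0" by blast
  let ?v = "vec N (\<lambda>k. A $$ (i, k))" and ?w = "vec N (\<lambda>k. A $$ (j, k))"
  have eq: "wedge N ?v ?w = A $$ (i, j) \<cdot>\<^sub>m A"
  proof (rule eq_matI)
    fix k l assume "k < dim_row (A $$ (i, j) \<cdot>\<^sub>m A)" "l < dim_col (A $$ (i, j) \<cdot>\<^sub>m A)"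
    then have kl: "k < N" "l < N" using A(1) by auto
    have "A $$ (i, k) * A $$ (j, l) - A $$ (j, k) * A $$ (i, l) = A $$ (i, j) * A $$ (k, l)"
      using rel(1) kl ij(1,2) unfolding pluecker_rel_def by blast
    then show "wedge N ?v ?w $$ (k, l) = (A $$ (i, j) \<cdot>\<^sub>m A) $$ (k, l)"
      using kl A(1) by (simp add: wedge_entry)
  qed (use A in auto)
  have "?v \<in> coord_space N a" using i by (auto simp: coord_space_def)
  moreover have "?w \<in> coord_space N b"
    using rel(2) ij(2) unfolding schubert_rel_def coord_space_def by auto
  moreover have "wedge N ?v ?w \<noteq> 0\<^sub>m N N"
    unfolding eq using smult_mat_eq_zero[OF A(1,3)] ij(3) by blast
  moreover have "line A = line (wedge N ?v ?w)" unfolding eq using line_smult[OF A(1,3) ij(3)] ..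
  ultimately show ?thesis unfolding planes_def by blast
qed

lemma planes_rel:
  assumes p: "p \<in> planes N a b" and "a \<le> b" and A: "A \<in> p"
  shows "A \<in> carrier_mat N N" "pluecker_rel N A" "schubert_rel N a b A"
proof -
  obtain v w where vw: "v \<in> coord_space N a" "w \<in> coord_space N b" and p: "p = line (wedge N v w)"
    using p unfolding planes_def by blast
  obtain c where "A = c \<cdot>\<^sub>m wedge N v w" using A p by (auto simp: line_def)
  then show "A \<in> carrier_mat N N" "pluecker_rel N A" "schubert_rel N a b A"
    using pluecker_rel_smult[OF wedge_carrier pluecker_rel_wedge]
      schubert_rel_smult[OF wedge_carrier schubert_rel_wedge[OF vw assms(2)]] by auto
qed

lemma closedin_planes:
  assumes "a \<le> b"
  shows "closedin (zariski N) (planes N a b)"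
  unfolding closedin_def openin_zariski_iff
proof (intro conjI ballI)
  show "planes N a b \<subseteq> topspace (zariski N)" using planes_subset_proj by simp
  show "topspace (zariski N) - planes N a b \<subseteq> proj_space N" by auto
  fix p assume "p \<in> topspace (zariski N) - planes N a b"
  then have p: "p \<in> proj_space N" "p \<notin> planes N a b" by auto
  obtain A where A: "p = line A" "A \<in> carrier_mat N N" "transpose_mat A = - A" "A \<noteq> 0\<^sub>m N N"
    using p(1) by (rule proj_spaceE)
  have witness: "\<exists>f d. f \<in> hom_poly_fun N d \<and> p \<in> basic_open N f \<and> basic_open N f \<subseteq> topspace (zariski N) - planes N a b"
    if f: "f \<in> hom_poly_fun N d" "f A \<noteq> 0"
      and zero: "\<And>B. pluecker_rel N B \<Longrightarrow> schubert_rel N a b B \<Longrightarrow> f B = 0" for f d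
  proof (rule exI, rule exI, intro conjI subsetI)
    show "f \<in> hom_poly_fun N d" by fact
    show "p \<in> basic_open N f" using p f A line_refl by (auto simp: basic_open_def)
    fix r assume "r \<in> basic_open N f"
    then obtain B where r: "r \<in> proj_space N" "B \<in> r" "f B \<noteq> 0" by (auto simp: basic_open_def)
    have "r \<notin> planes N a b" using planes_rel[OF _ assms r(2)] zero r(3) by blast
    then show "r \<in> topspace (zariski N) - planes N a b" using r by simp
  qed
  have "\<not> (pluecker_rel N A \<and> schubert_rel N a b A)"
    using planesI_rel[OF A(2-4) _ _ assms] p A(1) by blast
  then show "\<exists>f d. f \<in> hom_poly_fun N d \<and> p \<in> basic_open N f \<and> basic_open N f \<subseteq> topspace (zariski N) - planes N a b"
  proof (cases "pluecker_rel N A")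
    case False
    then obtain i j k l where ijkl: "i < N" "j < N" "k < N" "l < N"
      and ne: "A $$ (i, k) * A $$ (j, l) - A $$ (j, k) * A $$ (i, l) \<noteq> A $$ (i, j) * A $$ (k, l)"
      unfolding pluecker_rel_def by blast
    show ?thesis
    proof (rule witness)
      show "(\<lambda>A. (A $$ (i, k) * A $$ (j, l) - A $$ (j, k) * A $$ (i, l)) - A $$ (i, j) * A $$ (k, l))
          \<in> hom_poly_fun N (1 + 1)"
        using ijkl by (intro hom_poly_fun_diff hom_poly_fun_mult hom_poly_fun_coord)
    qed (use ijkl ne in \<open>auto simp: pluecker_rel_def\<close>)
  next
    case True
    assume "\<not> (pluecker_rel N A \<and> schubert_rel N a b A)"
    then obtain i j where ij: "i < N" "j < N" "b \<le> i \<or> b \<le> j \<or> (a \<le> i \<and> a \<le> j)" "A $$ (i, j) \<noteq> 0"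
      using True unfolding schubert_rel_def by blast
    show ?thesis
      by (rule witness[OF hom_poly_fun_coord[OF ij(1,2)] ij(4)]) (use ij in \<open>auto simp: schubert_rel_def\<close>)
  qed
qed


section \<open>The Grassmannian\<close>

lemma coord_space_N: "coord_space N N = carrier_vec N"
  by (auto simp: coord_space_def)

lemma wedge_zero_imp_multiple:
  assumes "v \<in> carrier_vec N" "w \<in> carrier_vec N" "wedge N v w = 0\<^sub>m N N" "w \<noteq> 0\<^sub>v N"
  shows "\<exists>c. v = c \<cdot>\<^sub>v w"
proof -
  obtain i where i: "i < N" "w $ i \<noteq> 0"
  proof -
    have "\<exists>i<N. w $ i \<noteq> 0"
    proof (rule ccontr)
      assume "\<not> ?thesis"
      then have "w = 0\<^sub>v N" using assms(2) by (intro eq_vecI) auto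
      then show False using assms(4) by simp
    qed
    then show ?thesis using that by blast
  qed
  have "v = (v $ i / w $ i) \<cdot>\<^sub>v w"
  proof (rule eq_vecI)
    fix j assume "j < dim_vec ((v $ i / w $ i) \<cdot>\<^sub>v w)"
    then have j: "j < N" using assms(2) by simp
    show "v $ j = ((v $ i / w $ i) \<cdot>\<^sub>v w) $ j"
      using wedge_eq_zeroD[OF assms(3) i(1) j] i j assms(2) by (simp add: field_simps)
  qed (use assms in auto)
  then show ?thesis by blast
qed

lemma line_wedge_eq:
  assumes "v \<in> carrier_vec N" "w \<in> carrier_vec N"
  shows "line (wedge N v w) = {wedge N x y | x y.
    (\<exists>a b. x = a \<cdot>\<^sub>v v + b \<cdot>\<^sub>v w) \<and> (\<exists>c d. y = c \<cdot>\<^sub>v v + d \<cdot>\<^sub>v w)}"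
    (is "_ = ?R")
proof
  show "line (wedge N v w) \<subseteq> ?R"
  proof
    fix A assume "A \<in> line (wedge N v w)"
    then obtain c where "A = c \<cdot>\<^sub>m wedge N v w" by (auto simp: line_def)
    then have "A = wedge N (c \<cdot>\<^sub>v v + 0 \<cdot>\<^sub>v w) (0 \<cdot>\<^sub>v v + 1 \<cdot>\<^sub>v w)"
      using wedge_comb[OF assms, of c 0 0 1] by simp
    then show "A \<in> ?R" by blast
  qed
  show "?R \<subseteq> line (wedge N v w)"
    using wedge_comb[OF assms] by (auto simp: line_def)
qed

text \<open>A plane with basis \<open>v, w\<close> goes to the line through \<open>v \<and> w\<close>. Since the dimension is defined as the
  least size of a finite generating set, it must first be known that a subspace is finitely
  generated; a maximal linearly independent subset serves.\<close>

lemma pluecker_grassmannian2: "pluecker N ` grassmannian2 N = planes N N N"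
proof -
  interpret vec_space "TYPE(complex)" N .
  have sub_comb: "submodule class_ring {a \<cdot>\<^sub>v v + b \<cdot>\<^sub>v w | a b. True} V"
    if "v \<in> carrier_vec N" "w \<in> carrier_vec N" for v w :: "complex vec"
  proof (unfold_locales, goal_cases)
    case 1
    then show ?case using that by auto
  next
    case (2 x y)
    then obtain a b c d where "x = a \<cdot>\<^sub>v v + b \<cdot>\<^sub>v w" "y = c \<cdot>\<^sub>v v + d \<cdot>\<^sub>v w" by auto
    then have "x + y = (a + c) \<cdot>\<^sub>v v + (b + d) \<cdot>\<^sub>v w"
      using that by (intro eq_vecI) (auto simp: algebra_simps)
    then show ?case by auto
  next
    case 3
    have "0\<^sub>v N = 0 \<cdot>\<^sub>v v + 0 \<cdot>\<^sub>v w" using that by auto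
    then show ?case by auto
  next
    case (4 c x)
    then obtain a b where "x = a \<cdot>\<^sub>v v + b \<cdot>\<^sub>v w" by auto
    then have "c \<cdot>\<^sub>v x = (c * a) \<cdot>\<^sub>v v + (c * b) \<cdot>\<^sub>v w"
      using that by (intro eq_vecI) (auto simp: algebra_simps)
    then show ?case by auto
  qed
  have span_eq: "span {v, w} = {a \<cdot>\<^sub>v v + b \<cdot>\<^sub>v w | a b. True}"
    if vw: "v \<in> carrier_vec N" "w \<in> carrier_vec N" for v w :: "complex vec"
  proof
    have "v = 1 \<cdot>\<^sub>v v + 0 \<cdot>\<^sub>v w" "w = 0 \<cdot>\<^sub>v v + 1 \<cdot>\<^sub>v w" using vw by auto
    then have "{v, w} \<subseteq> {a \<cdot>\<^sub>v v + b \<cdot>\<^sub>v w | a b. True}" by blast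
    then show "span {v, w} \<subseteq> {a \<cdot>\<^sub>v v + b \<cdot>\<^sub>v w | a b. True}"
      by (rule span_is_subset[OF _ sub_comb[OF vw]])
    have sub: "submodule class_ring (span {v, w}) V" using vw by (intro span_is_submodule) auto
    have "{v, w} \<subseteq> span {v, w}" using vw by (intro in_own_span) auto
    then have "a \<cdot>\<^sub>v v + b \<cdot>\<^sub>v w \<in> span {v, w}" for a b
      using submodule.m_closed[OF sub] submodule.smult_closed[OF sub] by (auto simp: class_ring_simps)
    then show "{a \<cdot>\<^sub>v v + b \<cdot>\<^sub>v w | a b. True} \<subseteq> span {v, w}" by blast
  qed
  show ?thesis
  proof (intro equalityI subsetI)
    fix p assume "p \<in> pluecker N ` grassmannian2 N"
    then obtain W where W: "subspace class_ring W V" "vectorspace.dim class_ring (V\<lparr>carrier := W\<rparr>) = 2"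
      and p: "p = pluecker N W" by (auto simp: grassmannian2_def)
    interpret W: vectorspace class_ring "V\<lparr>carrier := W\<rparr>" using subspace_is_vs[OF W(1)] .
    have subm: "submodule class_ring W V" using W(1) by (simp add: subspace_def)
    have WN: "W \<subseteq> carrier_vec N" using submodule.subset[OF subm] by simp
    have spanW: "W.span S = span S" if "S \<subseteq> W" for S
      using span_li_not_depend(1)[OF that subm] .
    have "\<exists>A. finite A \<and> maximal A (\<lambda>S. S \<subseteq> W \<and> W.lin_indpt S)"
    proof (rule maximal_exists[where B = "{}" and N = dim])
      show "{} \<subseteq> W \<and> W.lin_indpt {}" by (auto simp: W.lin_dep_def)
      fix A assume A: "A \<subseteq> W \<and> W.lin_indpt A"
      then have "lin_indpt A" using span_li_not_depend(2)[of A W] subm by simp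
      then show "finite A \<and> card A \<le> dim" using li_le_dim[OF fin_dim, of A] A WN by auto
    qed
    then obtain A where A: "finite A" "maximal A (\<lambda>S. S \<subseteq> W \<and> W.lin_indpt S)" by blast
    then have gA: "W.gen_set A" "A \<subseteq> W"
      using W.max_li_is_gen[of A] by (simp_all add: maximal_def)
    have "\<exists>n A. finite A \<and> card A = n \<and> A \<subseteq> carrier (V\<lparr>carrier := W\<rparr>) \<and> W.gen_set A"
      using A(1) gA by (intro exI[of _ "card A"] exI[of _ A]) simp
    from LeastI_ex[OF this] obtain S where S: "finite S" "card S = 2" "S \<subseteq> W" "W.gen_set S"
      using W(2) unfolding W.dim_def by auto
    then obtain v w where vw: "S = {v, w}" "v \<noteq> w" by (auto simp: card_2_iff)
    have c: "v \<in> carrier_vec N" "w \<in> carrier_vec N" using S(3) vw WN by auto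
    have Weq: "W = {a \<cdot>\<^sub>v v + b \<cdot>\<^sub>v w | a b. True}"
      using S(3,4) spanW[of S] span_eq[OF c] vw by simp
    have "wedge N v w \<noteq> 0\<^sub>m N N"
    proof
      assume 0: "wedge N v w = 0\<^sub>m N N"
      have "\<exists>u\<in>{v, w}. W \<subseteq> {a \<cdot>\<^sub>v u + b \<cdot>\<^sub>v u | a b. True}"
      proof (cases "w = 0\<^sub>v N")
        case True
        have "a \<cdot>\<^sub>v v + b \<cdot>\<^sub>v w = a \<cdot>\<^sub>v v + 0 \<cdot>\<^sub>v v" for a b
          using True c by (intro eq_vecI) auto
        then show ?thesis unfolding Weq by blast
      next
        case False
        then obtain r where "v = r \<cdot>\<^sub>v w" using wedge_zero_imp_multiple[OF c 0] by blast
        then have "a \<cdot>\<^sub>v v + b \<cdot>\<^sub>v w = (a * r) \<cdot>\<^sub>v w + b \<cdot>\<^sub>v w" for a b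
          using c by (intro eq_vecI) auto
        then show ?thesis unfolding Weq by blast
      qed
      then obtain u where u: "u \<in> W" "W \<subseteq> {a \<cdot>\<^sub>v u + b \<cdot>\<^sub>v u | a b. True}"
        using S(3) vw by auto
      then have uc: "u \<in> carrier_vec N" using WN by blast
      have "W \<subseteq> span {u}" using span_eq[OF uc uc] u(2) by simp
      moreover have "span {u} \<subseteq> W" using u by (intro span_is_subset[OF _ subm]) auto
      ultimately have "W.gen_set {u}" using spanW[of "{u}"] u by simp
      then have "W.dim \<le> card {u}" using u by (intro W.gen_ge_dim) auto
      then show False using W(2) by simp
    qed
    moreover have "p = line (wedge N v w)"
      unfolding p pluecker_def line_wedge_eq[OF c] Weq by blast
    ultimately show "p \<in> planes N N N" using c unfolding planes_def coord_space_N by blast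
  next
    fix p assume "p \<in> planes N N N"
    then obtain v w where c: "v \<in> carrier_vec N" "w \<in> carrier_vec N"
      and ne: "wedge N v w \<noteq> 0\<^sub>m N N" and p: "p = line (wedge N v w)"
      unfolding planes_def coord_space_N by blast
    define W where "W = span {v, w}"
    have W: "subspace class_ring W V" unfolding W_def using c by (intro span_is_subspace) auto
    interpret W: vectorspace class_ring "V\<lparr>carrier := W\<rparr>" using subspace_is_vs[OF W] .
    have subm: "submodule class_ring W V" using W(1) by (simp add: subspace_def)
    have WN: "W \<subseteq> carrier_vec N" using submodule.subset[OF subm] by simp
    have spanW: "W.span S = span S" if "S \<subseteq> W" for S
      using span_li_not_depend(1)[OF that subm] .
    have vwW: "{v, w} \<subseteq> W" unfolding W_def using c by (intro in_own_span) auto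
    have neq: "v \<noteq> w"
    proof
      assume "v = w"
      then have "wedge N v w = 0\<^sub>m N N" by (intro eq_matI) (auto simp: wedge_def)
      then show False using ne by simp
    qed
    have "W.dim = 2" unfolding W.dim_def
    proof (rule Least_equality)
      have "W.gen_set {v, w}" using spanW[OF vwW] by (simp add: W_def)
      then show "\<exists>A. finite A \<and> card A = 2 \<and> A \<subseteq> carrier (V\<lparr>carrier := W\<rparr>) \<and> W.gen_set A"
        using vwW neq by (intro exI[of _ "{v, w}"]) simp
      fix n assume "\<exists>A. finite A \<and> card A = n \<and> A \<subseteq> carrier (V\<lparr>carrier := W\<rparr>) \<and> W.gen_set A"
      then obtain A where A: "finite A" "card A = n" "A \<subseteq> W" "W.gen_set A" by auto
      show "2 \<le> n"
      proof (rule ccontr)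
        assume "\<not> 2 \<le> n"
        then have "card A \<le> 1" using A(2) by simp
        obtain u where u: "A \<subseteq> {u}" "u \<in> carrier_vec N"
        proof (cases "A = {}")
          case True
          then show ?thesis using that[of "0\<^sub>v N"] by simp
        next
          case False
          then have "card A = 1" using \<open>card A \<le> 1\<close> A(1) by (simp add: le_Suc_eq)
          then obtain u where "A = {u}" by (rule card_1_singletonE)
          then show ?thesis using that[of u] A(3) WN by blast
        qed
        have "W \<subseteq> span {u}"
          using A(3,4) spanW[OF A(3)] span_is_monotone[OF u(1)] by auto
        then have "v \<in> span {u, u}" "w \<in> span {u, u}" using vwW by auto
        then obtain a b c' d where "v = a \<cdot>\<^sub>v u + b \<cdot>\<^sub>v u" "w = c' \<cdot>\<^sub>v u + d \<cdot>\<^sub>v u"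
          unfolding span_eq[OF u(2) u(2)] by auto
        then have "v = (a + b) \<cdot>\<^sub>v u" "w = (c' + d) \<cdot>\<^sub>v u" using u(2) by (auto simp: add_smult_distrib_vec)
        then show False using ne wedge_comb_smult[OF u(2)] by simp
      qed
    qed
    then have "W \<in> grassmannian2 N" using W by (simp add: grassmannian2_def)
    moreover have "p = pluecker N W"
      unfolding p pluecker_def line_wedge_eq[OF c] W_def span_eq[OF c] by blast
    ultimately show "p \<in> pluecker N ` grassmannian2 N" by blast
  qed
qed

section \<open>The action on bivectors\<close>

lemma mult_mat_vec_entry:
  assumes "g \<in> carrier_mat N N" "v \<in> carrier_vec N" "i < N"
  shows "(g *\<^sub>v v) $ i = (\<Sum>k<N. g $$ (i, k) * v $ k)"
  using assms by (simp add: scalar_prod_def atLeast0LessThan)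

lemma congruence_entry:
  assumes "g \<in> carrier_mat N N" "A \<in> carrier_mat N N" "i < N" "j < N"
  shows "(g * A * transpose_mat g) $$ (i, j) = (\<Sum>k<N. \<Sum>l<N. g $$ (i, k) * A $$ (k, l) * g $$ (j, l))"
proof -
  have "(g * A * transpose_mat g) $$ (i, j) = (\<Sum>l<N. (g * A) $$ (i, l) * transpose_mat g $$ (l, j))"
    using assms by (intro mat_mult_entry) auto
  also have "\<dots> = (\<Sum>l<N. \<Sum>k<N. g $$ (i, k) * A $$ (k, l) * g $$ (j, l))"
    using assms by (intro sum.cong refl)
      (simp add: mat_mult_entry sum_distrib_right del: index_mult_mat(1))
  also have "\<dots> = (\<Sum>k<N. \<Sum>l<N. g $$ (i, k) * A $$ (k, l) * g $$ (j, l))"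
    by (rule sum.swap)
  finally show ?thesis .
qed

lemma congruence_wedge:
  assumes g: "g \<in> carrier_mat N N" and v: "v \<in> carrier_vec N" and w: "w \<in> carrier_vec N"
  shows "g * wedge N v w * transpose_mat g = wedge N (g *\<^sub>v v) (g *\<^sub>v w)"
proof (rule eq_matI)
  fix i j assume "i < dim_row (wedge N (g *\<^sub>v v) (g *\<^sub>v w))" "j < dim_col (wedge N (g *\<^sub>v v) (g *\<^sub>v w))"
  then have ij: "i < N" "j < N" by simp_all
  have "(g * wedge N v w * transpose_mat g) $$ (i, j) =
      (\<Sum>k<N. \<Sum>l<N. g $$ (i, k) * wedge N v w $$ (k, l) * g $$ (j, l))"
    using g ij by (intro congruence_entry) auto
  also have "\<dots> = (\<Sum>k<N. \<Sum>l<N. g $$ (i, k) * v $ k * (g $$ (j, l) * w $ l))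
      - (\<Sum>k<N. \<Sum>l<N. g $$ (i, k) * w $ k * (g $$ (j, l) * v $ l))"
    unfolding sum_subtractf[symmetric]
    by (intro sum.cong refl) (simp add: wedge_entry algebra_simps)
  also have "\<dots> = (g *\<^sub>v v) $ i * (g *\<^sub>v w) $ j - (g *\<^sub>v w) $ i * (g *\<^sub>v v) $ j"
    unfolding mult_mat_vec_entry[OF g v ij(1)] mult_mat_vec_entry[OF g w ij(1)]
      mult_mat_vec_entry[OF g v ij(2)] mult_mat_vec_entry[OF g w ij(2)] sum_product ..
  finally show "(g * wedge N v w * transpose_mat g) $$ (i, j) = wedge N (g *\<^sub>v v) (g *\<^sub>v w) $$ (i, j)"
    using ij by (simp add: wedge_entry)
qed (use g in auto)

lemma act_line:
  assumes "g \<in> carrier_mat N N" "A \<in> carrier_mat N N"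
  shows "act g (line A) = line (g * A * transpose_mat g)"
proof -
  have "g * (c \<cdot>\<^sub>m A) * transpose_mat g = c \<cdot>\<^sub>m (g * A * transpose_mat g)" for c
    using assms by (simp add: mult_smult_distrib[of _ N N _ N] mult_smult_assoc_mat[of _ N N _ N])
  then show ?thesis unfolding act_def line_def by (simp add: image_image)
qed

lemma congruence_cancel:
  assumes g: "g \<in> carrier (GL N)" and A: "A \<in> carrier_mat N N"
  defines "h \<equiv> inv\<^bsub>GL N\<^esub> g"
  shows "h * (g * A * transpose_mat g) * transpose_mat h = A"
    and "g * (h * A * transpose_mat h) * transpose_mat g = A"
proof -
  have c: "g \<in> carrier_mat N N" "h \<in> carrier_mat N N" "h * g = 1\<^sub>m N" "g * h = 1\<^sub>m N"
    using GL_carrier[OF g] GL_inv[OF g] by (simp_all add: h_def)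
  have cancel: "x * (y * A * transpose_mat y) * transpose_mat x = A"
    if "x \<in> carrier_mat N N" "y \<in> carrier_mat N N" "x * y = 1\<^sub>m N" for x y
  proof -
    have "x * (y * A * transpose_mat y) * transpose_mat x = (x * y) * A * (transpose_mat y * transpose_mat x)"
      using that(1,2) A by (simp add: assoc_mult_mat[of _ N N _ N _ N])
    also have "transpose_mat y * transpose_mat x = transpose_mat (x * y)"
      using that(1,2) by (simp add: transpose_mult[of _ N N _ N])
    finally show ?thesis using that(3) A by simp
  qed
  show "h * (g * A * transpose_mat g) * transpose_mat h = A"
    "g * (h * A * transpose_mat h) * transpose_mat g = A"
    using cancel c by blast+
qed

lemma congruence_nonzero:
  assumes g: "g \<in> carrier (GL N)" and A: "A \<in> carrier_mat N N" "A \<noteq> 0\<^sub>m N N"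
  shows "g * A * transpose_mat g \<noteq> 0\<^sub>m N N"
proof
  assume "g * A * transpose_mat g = 0\<^sub>m N N"
  then have "A = inv\<^bsub>GL N\<^esub> g * 0\<^sub>m N N * transpose_mat (inv\<^bsub>GL N\<^esub> g)"
    using congruence_cancel(1)[OF g A(1)] by simp
  also have "\<dots> = 0\<^sub>m N N" using GL_inv(2)[OF g] by simp
  finally show False using A(2) by simp
qed

lemma act_act:
  assumes "g \<in> carrier_mat N N" "h \<in> carrier_mat N N" "p \<in> proj_space N"
  shows "act g (act h p) = act (g * h) p"
proof -
  obtain A where A: "p = line A" "A \<in> carrier_mat N N" using assms(3) by (rule proj_spaceE)
  have "g * (h * A * transpose_mat h) * transpose_mat g = (g * h) * A * transpose_mat (g * h)"
    using assms A by (simp add: transpose_mult[of _ N N _ N] assoc_mult_mat[of _ N N _ N _ N])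
  then show ?thesis using A assms by (simp add: act_line[where N = N])
qed

lemma act_inv:
  assumes "g \<in> carrier (GL N)" "p \<in> proj_space N"
  shows "act g (act (inv\<^bsub>GL N\<^esub> g) p) = p" "act (inv\<^bsub>GL N\<^esub> g) (act g p) = p"
proof -
  obtain A where A: "p = line A" "A \<in> carrier_mat N N" using assms(2) by (rule proj_spaceE)
  show "act g (act (inv\<^bsub>GL N\<^esub> g) p) = p" "act (inv\<^bsub>GL N\<^esub> g) (act g p) = p"
    using A GL_carrier[OF assms(1)] GL_inv[OF assms(1)] congruence_cancel[OF assms(1) A(2)]
    by (simp_all add: act_line[where N = N])
qed

definition preserves :: "nat \<Rightarrow> nat \<Rightarrow> complex mat \<Rightarrow> bool" where
  "preserves N d g \<longleftrightarrow> (\<forall>i<N. \<forall>j<N. j < d \<and> d \<le> i \<longrightarrow> g $$ (i, j) = 0)"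

lemma preserves_coord_space:
  assumes "g \<in> carrier_mat N N" "preserves N d g" "v \<in> coord_space N d"
  shows "g *\<^sub>v v \<in> coord_space N d"
proof -
  have "(g *\<^sub>v v) $ i = 0" if "i < N" "d \<le> i" for i
  proof -
    have "(g *\<^sub>v v) $ i = (\<Sum>k<N. g $$ (i, k) * v $ k)"
      using assms that by (intro mult_mat_vec_entry) (auto simp: coord_space_def)
    also have "\<dots> = 0"
    proof (intro sum.neutral ballI)
      fix k assume "k \<in> {..<N}"
      then show "g $$ (i, k) * v $ k = 0"
        using assms(2,3) that by (cases "k < d") (auto simp: preserves_def coord_space_def)
    qed
    finally show ?thesis .
  qed
  then show ?thesis using assms by (auto simp: coord_space_def)
qed

lemma act_wedge:
  assumes "g \<in> carrier_mat N N" "v \<in> carrier_vec N" "w \<in> carrier_vec N"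
  shows "act g (line (wedge N v w)) = line (wedge N (g *\<^sub>v v) (g *\<^sub>v w))"
  using assms by (simp add: act_line[where N = N] congruence_wedge)

lemma act_planes:
  assumes g: "g \<in> carrier (GL N)" and pres: "preserves N a g" "preserves N b g"
    and p: "p \<in> planes N a b"
  shows "act g p \<in> planes N a b"
proof -
  obtain v w where vw: "v \<in> coord_space N a" "w \<in> coord_space N b" "wedge N v w \<noteq> 0\<^sub>m N N"
    and p: "p = line (wedge N v w)" using p unfolding planes_def by blast
  have c: "v \<in> carrier_vec N" "w \<in> carrier_vec N" using vw by (auto simp: coord_space_def)
  have "wedge N (g *\<^sub>v v) (g *\<^sub>v w) \<noteq> 0\<^sub>m N N"
    using congruence_nonzero[OF g wedge_carrier vw(3)] congruence_wedge[OF GL_carrier[OF g] c] by simp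
  then show ?thesis
    unfolding p act_wedge[OF GL_carrier[OF g] c] planes_def
    using preserves_coord_space[OF GL_carrier[OF g] pres(1) vw(1)]
      preserves_coord_space[OF GL_carrier[OF g] pres(2) vw(2)] by blast
qed


section \<open>Irreducibility and the Schubert varieties\<close>

definition wedge_param :: "nat \<Rightarrow> nat \<Rightarrow> nat \<Rightarrow> (nat \<times> nat \<Rightarrow> complex) \<Rightarrow> complex mat" where
  "wedge_param N a b y =
     wedge N (vec N (\<lambda>i. if i < a then y (0, i) else 0)) (vec N (\<lambda>i. if i < b then y (1, i) else 0))"

lemma wedge_param_entry:
  assumes "i < N" "j < N"
  shows "(\<lambda>y. wedge_param N a b y $$ (i, j)) \<in> polyf"
proof -
  have "(\<lambda>y. if i < d then y (k, i) else 0) \<in> polyf" for i d and k :: nat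
    by (cases "i < d") (simp_all add: polyf.const polyf.var)
  then show ?thesis using assms
    by (simp add: wedge_param_def wedge_entry) (intro polyf_diff polyf.mult; assumption)
qed

lemma wedge_param_surj:
  assumes "v \<in> coord_space N a" "w \<in> coord_space N b"
  shows "\<exists>y. wedge_param N a b y = wedge N v w"
proof -
  have "vec N (\<lambda>i. if i < a then v $ i else 0) = v" "vec N (\<lambda>i. if i < b then w $ i else 0) = w"
    using assms by (auto simp: coord_space_def intro!: eq_vecI)
  then show ?thesis
    by (intro exI[of _ "\<lambda>(r, i). if r = 0 then v $ i else w $ i"]) (simp add: wedge_param_def cong: if_cong)
qed

lemma wedge_param_planes:
  assumes "wedge_param N a b y \<noteq> 0\<^sub>m N N"
  shows "line (wedge_param N a b y) \<in> planes N a b"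
proof -
  have "vec N (\<lambda>i. if i < a then y (0, i) else 0) \<in> coord_space N a"
    "vec N (\<lambda>i. if i < b then y (1, i) else 0) \<in> coord_space N b"
    by (auto simp: coord_space_def)
  then show ?thesis using assms unfolding planes_def wedge_param_def by blast
qed

text \<open>Irreducibility. The factor \<open>wedge_param N a b y $$ (i, j)\<close> keeps the parameter \<open>y\<close> away from the
  zero bivector, at which a form of degree \<open>0\<close> need not vanish.\<close>

lemma planes_meet:
  assumes U: "openin (zariski N) U" "p \<in> U" "p \<in> planes N a b"
    and V: "openin (zariski N) V" "q \<in> V" "q \<in> planes N a b"
  shows "\<exists>r \<in> planes N a b. r \<in> U \<and> r \<in> V"
proof -
  obtain f d where f: "f \<in> hom_poly_fun N d" "p \<in> basic_open N f" "basic_open N f \<subseteq> U"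
    using U(1,2) unfolding openin_zariski_iff by blast
  obtain g e where g: "g \<in> hom_poly_fun N e" "q \<in> basic_open N g" "basic_open N g \<subseteq> V"
    using V(1,2) unfolding openin_zariski_iff by blast
  obtain v w where vw: "v \<in> coord_space N a" "w \<in> coord_space N b" "wedge N v w \<noteq> 0\<^sub>m N N"
    and p: "p = line (wedge N v w)" using U(3) unfolding planes_def by blast
  obtain v' w' where vw': "v' \<in> coord_space N a" "w' \<in> coord_space N b" "wedge N v' w' \<noteq> 0\<^sub>m N N"
    and q: "q = line (wedge N v' w')" using V(3) unfolding planes_def by blast
  obtain y1 where y1: "wedge_param N a b y1 = wedge N v w" using wedge_param_surj[OF vw(1,2)] by blast
  obtain y2 where y2: "wedge_param N a b y2 = wedge N v' w'" using wedge_param_surj[OF vw'(1,2)] by blast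
  obtain i j where ij: "i < N" "j < N" "wedge N v w $$ (i, j) \<noteq> 0"
    using nonzero_entry[OF wedge_carrier vw(3)] .
  let ?F = "\<lambda>y. f (wedge_param N a b y) * wedge_param N a b y $$ (i, j)"
  let ?G = "\<lambda>y. g (wedge_param N a b y)"
  have pp: "p \<in> proj_space N" "q \<in> proj_space N" using U(3) V(3) planes_subset_proj by blast+
  have "f (wedge N v w) \<noteq> 0"
    using hom_nonzero_iff[OF pp(1) _ vw(3) f(1)] f(2) p line_refl by blast
  then have F: "?F y1 \<noteq> 0" using y1 ij by simp
  have "g (wedge N v' w') \<noteq> 0"
    using hom_nonzero_iff[OF pp(2) _ vw'(3) g(1)] g(2) q line_refl by blast
  then have G: "?G y2 \<noteq> 0" using y2 by simp
  have "?F \<in> polyf"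
    by (intro polyf.mult poly_fun_polyf[OF hom_poly_fun_D(1)[OF f(1)]] wedge_param_entry ij; assumption)
  moreover have "?G \<in> polyf"
    by (intro poly_fun_polyf[OF hom_poly_fun_D(1)[OF g(1)]] wedge_param_entry; assumption)
  ultimately obtain y where y: "?F y \<noteq> 0" "?G y \<noteq> 0" using polyf_nonzero_both F G by blast
  let ?A = "wedge_param N a b y"
  have "?A \<noteq> 0\<^sub>m N N" using y ij by auto
  then have r: "line ?A \<in> planes N a b" by (rule wedge_param_planes)
  have "line ?A \<in> basic_open N f" "line ?A \<in> basic_open N g"
    using y r planes_subset_proj line_refl[of ?A] by (auto simp: basic_open_def)
  then show ?thesis using r f(3) g(3) by blast
qed

text \<open>A plane spanned by \<open>v \<in> E a\<close> and \<open>w \<in> E b\<close> whose coordinate \<open>(a, b)\<close> is nonzero is the image of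
  the base point under the matrix obtained from the identity by putting \<open>v\<close> and \<open>w\<close> into columns
  \<open>a\<close> and \<open>b\<close>.\<close>

lemma orbit_upper_borel:
  assumes "0 < a" "a < b" "b \<le> N"
  defines "p \<equiv> line (wedge N (unit_vec N (a - 1)) (unit_vec N (b - 1)))"
  shows "planes N a b \<inter> basic_open N (\<lambda>A. A $$ (a - 1, b - 1)) \<subseteq> orbit_of (upper_borel N) p"
    and "orbit_of (upper_borel N) p \<subseteq> planes N a b"
    and "p \<in> planes N a b \<inter> basic_open N (\<lambda>A. A $$ (a - 1, b - 1))"
proof -
  let ?e = "unit_vec N (a - 1) :: complex vec" and ?f = "unit_vec N (b - 1) :: complex vec"
  have ef: "?e \<in> coord_space N a" "?f \<in> coord_space N b" using assms by (auto simp: coord_space_def)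
  have ne: "wedge N ?e ?f $$ (a - 1, b - 1) = 1" using assms by (simp add: wedge_entry)
  then have ne0: "wedge N ?e ?f \<noteq> 0\<^sub>m N N" using assms by auto
  have p: "p \<in> planes N a b" unfolding p_def planes_def using ef ne0 by blast
  then show "p \<in> planes N a b \<inter> basic_open N (\<lambda>A. A $$ (a - 1, b - 1))"
    using planes_subset_proj ne line_refl[of "wedge N ?e ?f"]
    by (auto simp: basic_open_def p_def intro!: bexI[of _ "wedge N ?e ?f"])
  show "orbit_of (upper_borel N) p \<subseteq> planes N a b"
  proof
    fix q assume "q \<in> orbit_of (upper_borel N) p"
    then obtain g where g: "g \<in> carrier (GL N)" "upper_triangular g" and q: "q = act g p"
      by (auto simp: orbit_of_def upper_borel_def)
    have "preserves N d g" for d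
      using upper_triangularD[OF g(2)] GL_carrier[OF g(1)] by (auto simp: preserves_def)
    then show "q \<in> planes N a b" unfolding q using act_planes[OF g(1) _ _ p] by blast
  qed
  show "planes N a b \<inter> basic_open N (\<lambda>A. A $$ (a - 1, b - 1)) \<subseteq> orbit_of (upper_borel N) p"
  proof
    fix q assume "q \<in> planes N a b \<inter> basic_open N (\<lambda>A. A $$ (a - 1, b - 1))"
    then have q: "q \<in> planes N a b" "q \<in> basic_open N (\<lambda>A. A $$ (a - 1, b - 1))" by auto
    obtain v w where vw: "v \<in> coord_space N a" "w \<in> coord_space N b" "wedge N v w \<noteq> 0\<^sub>m N N"
      and qe: "q = line (wedge N v w)" using q(1) unfolding planes_def by blast
    have c: "v \<in> carrier_vec N" "w \<in> carrier_vec N" using vw by (auto simp: coord_space_def)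
    have "wedge N v w $$ (a - 1, b - 1) \<noteq> 0"
      using hom_nonzero_iff[OF _ _ vw(3) hom_poly_fun_coord[of "a - 1" N "b - 1"]] q assms
        planes_subset_proj[of N a b] line_refl[of "wedge N v w"] unfolding qe by auto
    moreover have "v $ (b - 1) = 0" using vw(1) assms by (auto simp: coord_space_def)
    ultimately have diag: "v $ (a - 1) \<noteq> 0" "w $ (b - 1) \<noteq> 0"
      using assms by (auto simp: wedge_entry)
    define g where "g = mat N N (\<lambda>(i, j). if j = a - 1 then v $ i else if j = b - 1 then w $ i
      else if i = j then 1 else (0 :: complex))"
    have gc: "g \<in> carrier_mat N N" by (simp add: g_def)
    have up: "upper_triangular g"
      using vw(1,2) assms by (intro upper_triangularI) (auto simp: g_def coord_space_def)
    have "g \<in> carrier (GL N)"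
      using upper_triangular_imp_det_eq_0_iff[OF gc up] gc diag
      by (auto simp: GL_iff diag_mat_def g_def split: if_splits)
    then have "g \<in> upper_borel N" using up by (simp add: upper_borel_def)
    moreover have "g *\<^sub>v ?e = v" "g *\<^sub>v ?f = w"
      using assms c gc by (auto intro!: eq_vecI simp: g_def)
    then have "act g p = q" unfolding p_def qe using act_wedge[OF gc, of ?e ?f] by simp
    ultimately show "q \<in> orbit_of (upper_borel N) p" unfolding orbit_of_def by blast
  qed
qed

lemma schubert_eq_planes:
  assumes "1 \<le> a" "a < b" "b \<le> N"
  shows "schubert N a b = planes N a b"
proof -
  let ?p = "line (wedge N (unit_vec N (a - 1)) (unit_vec N (b - 1)))"
  let ?O = "orbit_of (upper_borel N) ?p"
  let ?T = "subtopology (zariski N) (planes N N N)"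
  note orb = orbit_upper_borel[of a b N]
  have coord: "(\<lambda>A. A $$ (a - 1, b - 1)) \<in> hom_poly_fun N 1"
    using assms by (intro hom_poly_fun_coord) auto
  have sub: "planes N a b \<subseteq> planes N N N"
  proof -
    have "coord_space N d \<subseteq> coord_space N N" for d by (auto simp: coord_space_def)
    then show ?thesis unfolding planes_def by blast
  qed
  have top: "topspace ?T = planes N N N" using planes_subset_proj by auto
  have "?T closure_of ?O = planes N a b"
  proof (intro equalityI subsetI)
    fix q assume q: "q \<in> planes N a b"
    show "q \<in> ?T closure_of ?O" unfolding in_closure_of top
    proof (intro conjI allI impI)
      show "q \<in> planes N N N" using q sub by blast
      fix T assume T: "q \<in> T \<and> openin ?T T"
      then obtain U where U: "openin (zariski N) U" "T = U \<inter> planes N N N"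
        unfolding openin_subtopology by blast
      have "\<exists>r\<in>planes N a b. r \<in> U \<and> r \<in> basic_open N (\<lambda>A. A $$ (a - 1, b - 1))"
        using planes_meet[OF U(1) _ q openin_basic_open[OF coord]] orb(3) assms T U(2) by auto
      then obtain r where "r \<in> planes N a b" "r \<in> U" "r \<in> basic_open N (\<lambda>A. A $$ (a - 1, b - 1))" by blast
      then show "\<exists>y. y \<in> ?O \<and> y \<in> T" using orb(1) assms U(2) sub by auto
    qed
  next
    fix q assume "q \<in> ?T closure_of ?O"
    moreover have "?T closure_of ?O \<subseteq> planes N a b"
    proof (rule closure_of_minimal)
      show "?O \<subseteq> planes N a b" using orb(2) assms by auto
      show "closedin ?T (planes N a b)"
        using closedin_planes[of a b N] assms sub by (auto intro: closedin_subset_topspace)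
    qed
    ultimately show "q \<in> planes N a b" by blast
  qed
  then show ?thesis unfolding schubert_def pluecker_grassmannian2 by simp
qed

lemma irreducible_variety_planes:
  assumes "0 < a" "a < b" "b \<le> N"
  shows "irreducible_variety N (planes N a b)"
  unfolding irreducible_variety_def irreducible_space_def
proof (intro conjI allI impI)
  have "openin (zariski N) (proj_space N)" using openin_topspace[of "zariski N"] by simp
  moreover have "planes N a b = proj_space N \<inter> planes N a b" using planes_subset_proj by auto
  ultimately show "\<exists>U C. openin (zariski N) U \<and> closedin (zariski N) C \<and> planes N a b = U \<inter> C"
    using closedin_planes[of a b N] assms by auto
  have "topspace (subtopology (zariski N) (planes N a b)) = planes N a b"
    using planes_subset_proj by auto
  then show "topspace (subtopology (zariski N) (planes N a b)) \<noteq> {}"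
    using orbit_upper_borel(3)[OF assms] by blast
  fix U V assume "openin (subtopology (zariski N) (planes N a b)) U \<and>
    openin (subtopology (zariski N) (planes N a b)) V \<and> U \<noteq> {} \<and> V \<noteq> {}"
  then obtain U' V' p q where "openin (zariski N) U'" "U = U' \<inter> planes N a b"
    "openin (zariski N) V'" "V = V' \<inter> planes N a b" "p \<in> U" "q \<in> V"
    unfolding openin_subtopology by blast
  then show "U \<inter> V \<noteq> {}" using planes_meet[of N U' p a b V' q] by blast
qed

section \<open>Normality from polynomial charts\<close>

lemma polyf_poly_fun:
  assumes "h \<in> polyf" "\<And>m. (\<lambda>A. \<tau> A m) \<in> poly_fun N"
  shows "(\<lambda>A. h (\<tau> A)) \<in> poly_fun N"
  using assms(1) by induction (simp_all add: poly_fun.const poly_fun.add poly_fun.mult assms(2))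

lemma homogenize:
  assumes "H \<in> poly_fun N" "i < N" "j < N"
  shows "\<exists>D F. F \<in> hom_poly_fun N D \<and> (\<forall>A. A $$ (i, j) = 1 \<longrightarrow> F A = H A)"
  using assms(1)
proof induction
  case (const c)
  show ?case by (rule exI, rule exI, rule conjI, rule hom_poly_fun_const[of c]) simp
next
  case (coord k l)
  show ?case by (rule exI, rule exI, rule conjI, rule hom_poly_fun_coord[OF coord]) simp
next
  case (add f g)
  then obtain D1 F1 D2 F2 where F: "F1 \<in> hom_poly_fun N D1" "\<forall>A. A $$ (i, j) = 1 \<longrightarrow> F1 A = f A"
    and G: "F2 \<in> hom_poly_fun N D2" "\<forall>A. A $$ (i, j) = 1 \<longrightarrow> F2 A = g A" by blast
  have x: "(\<lambda>A. A $$ (i, j) ^ m) \<in> hom_poly_fun N m" for m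
    using hom_poly_fun_power[OF hom_poly_fun_coord[OF assms(2,3)], of m] by simp
  have "(\<lambda>A. F1 A * A $$ (i, j) ^ D2 + F2 A * A $$ (i, j) ^ D1) \<in> hom_poly_fun N (D1 + D2)"
    using hom_poly_fun_add[OF hom_poly_fun_mult[OF F(1) x[of D2]]
      hom_poly_fun_mult[OF G(1) x[of D1], unfolded add.commute[of D2]]] .
  then show ?case
  proof (intro exI conjI)
    show "\<forall>A. A $$ (i, j) = 1 \<longrightarrow> F1 A * A $$ (i, j) ^ D2 + F2 A * A $$ (i, j) ^ D1 = f A + g A"
      using F(2) G(2) by simp
  qed
next
  case (mult f g)
  then obtain D1 F1 D2 F2 where F: "F1 \<in> hom_poly_fun N D1" "\<forall>A. A $$ (i, j) = 1 \<longrightarrow> F1 A = f A"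
    and G: "F2 \<in> hom_poly_fun N D2" "\<forall>A. A $$ (i, j) = 1 \<longrightarrow> F2 A = g A" by blast
  have "(\<lambda>A. F1 A * F2 A) \<in> hom_poly_fun N (D1 + D2)" using hom_poly_fun_mult[OF F(1) G(1)] .
  then show ?case
  proof (intro exI conjI)
    show "\<forall>A. A $$ (i, j) = 1 \<longrightarrow> F1 A * F2 A = f A * g A" using F(2) G(2) by simp
  qed
qed

text \<open>Multiplying an integral equation of degree \<open>n\<close> by the \<open>n\<close>-th power of a common denominator \<open>B\<close> of
  the coefficients gives one for \<open>B f / g\<close> without denominators.\<close>

lemma integral_equation_clear_denominators:
  fixes f g :: complex and a b :: "nat \<Rightarrow> complex"
  assumes "g \<noteq> 0" "\<And>k. k < n \<Longrightarrow> b k \<noteq> 0"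
    and eq: "(f / g) ^ n + (\<Sum>k<n. a k / b k * (f / g) ^ k) = 0"
  defines "B \<equiv> \<Prod>k<n. b k"
  shows "(B * f) ^ n + (\<Sum>k<n. a k * (\<Prod>l\<in>{..<n} - {k}. b l) * B ^ (n - Suc k) * g ^ (n - k) * (B * f) ^ k) = 0"
proof -
  have "a k * (\<Prod>l\<in>{..<n} - {k}. b l) * B ^ (n - Suc k) * g ^ (n - k) * (B * f) ^ k
      = B ^ n * g ^ n * (a k / b k * (f / g) ^ k)" if k: "k < n" for k
  proof -
    have "B = b k * (\<Prod>l\<in>{..<n} - {k}. b l)" unfolding B_def using k by (intro prod.remove) auto
    then have 1: "(\<Prod>l\<in>{..<n} - {k}. b l) = B / b k" using assms(2)[OF k] by simp
    have "B ^ n = B ^ (Suc (n - Suc k) + k)" using k by simp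
    then have "B ^ n = B * B ^ (n - Suc k) * B ^ k" by (simp only: power_add power_Suc)
    moreover have "g ^ n = g ^ (n - k) * g ^ k" using k by (simp flip: power_add)
    ultimately show ?thesis
      using assms(1) assms(2)[OF k] unfolding 1 by (simp add: power_divide power_mult_distrib)
  qed
  then have "(\<Sum>k<n. a k * (\<Prod>l\<in>{..<n} - {k}. b l) * B ^ (n - Suc k) * g ^ (n - k) * (B * f) ^ k)
      = B ^ n * g ^ n * (\<Sum>k<n. a k / b k * (f / g) ^ k)"
    by (simp add: sum_distrib_left)
  moreover have "(B * f) ^ n = B ^ n * g ^ n * (f / g) ^ n"
    using assms(1) by (simp add: power_divide power_mult_distrib)
  ultimately show ?thesis using eq by (simp flip: distrib_left)
qed

text \<open>A polynomial parametrization \<open>\<sigma>\<close> of the part of \<open>X\<close> where the coordinate \<open>(i, j)\<close> is nonzero. It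
  need not be injective; the condition \<open>descent\<close> says that a polynomial on the parameter space which
  is generically constant on the fibres of \<open>\<sigma>\<close> is a polynomial in the coordinates of \<open>X\<close>. This is
  what remains to be known about the fibres for normality of \<open>X\<close> to follow from that of affine
  space.\<close>

locale polynomial_chart =
  fixes N :: nat and X :: "complex mat set set" and i j :: nat
    and \<sigma> :: "('i \<Rightarrow> complex) \<Rightarrow> complex mat"
  assumes irr: "irreducible_variety N X"
    and ij: "i < N" "j < N"
    and carrier: "\<sigma> y \<in> carrier_mat N N"
    and entry: "k < N \<Longrightarrow> l < N \<Longrightarrow> (\<lambda>y. \<sigma> y $$ (k, l)) \<in> polyf"
    and normalized: "\<sigma> y $$ (i, j) = 1"
    and chart_in: "line (\<sigma> y) \<in> X"
    and chart_onto: "p \<in> X \<Longrightarrow> p \<in> basic_open N (\<lambda>A. A $$ (i, j)) \<Longrightarrow> \<exists>y. p = line (\<sigma> y)"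
    and descent: "h \<in> polyf \<Longrightarrow> e \<in> polyf \<Longrightarrow> e y0 \<noteq> 0 \<Longrightarrow>
      (\<And>y y'. \<sigma> y = \<sigma> y' \<Longrightarrow> e y \<noteq> 0 \<Longrightarrow> h y = h y') \<Longrightarrow>
      \<exists>H\<in>poly_fun N. \<forall>y. h y = H (\<sigma> y)"
begin

lemma X_proj: "X \<subseteq> proj_space N"
proof -
  obtain U C where "openin (zariski N) U" "X = U \<inter> C"
    using irr unfolding irreducible_variety_def by blast
  then show ?thesis using openin_subset[of "zariski N" U] by auto
qed

lemma topspace_X: "topspace (subtopology (zariski N) X) = X"
  using X_proj by auto

lemma meet:
  assumes "openin (subtopology (zariski N) X) U" "openin (subtopology (zariski N) X) V" "U \<noteq> {}" "V \<noteq> {}"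
  shows "U \<inter> V \<noteq> {}"
  using irr assms unfolding irreducible_variety_def irreducible_space_def by blast

lemma openin_X_basic_open: "f \<in> hom_poly_fun N d \<Longrightarrow> openin (subtopology (zariski N) X) (X \<inter> basic_open N f)"
  using openin_basic_open openin_subtopology_Int2 by blast

lemma nonzero: "\<sigma> y \<noteq> 0\<^sub>m N N"
  using normalized[of y] ij by auto

lemma pull_polyf: "f \<in> hom_poly_fun N d \<Longrightarrow> (\<lambda>y. f (\<sigma> y)) \<in> polyf"
  by (rule poly_fun_polyf[OF hom_poly_fun_D(1)]) (assumption, rule entry)

lemma chart_basic_open:
  assumes "f \<in> hom_poly_fun N d"
  shows "line (\<sigma> y) \<in> basic_open N f \<longleftrightarrow> f (\<sigma> y) \<noteq> 0"
  using hom_nonzero_iff[OF _ line_refl nonzero assms] chart_in X_proj by blast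

text \<open>Near the point \<open>p\<close> write the coefficients of the integral equation as \<open>a k / b k\<close> and, on an open set
  that need not contain \<open>p\<close>, write \<open>\<phi> = f / g\<close>. With \<open>B\<close> the product of the \<open>b k\<close>, the pullback of \<open>B \<phi>\<close> is integral
  over the polynomials, hence equal to a polynomial \<open>h\<close>, which descends to \<open>H\<close>. Homogenizing \<open>H\<close> with
  powers of the coordinate \<open>(i, j)\<close> gives a quotient \<open>num / den\<close> of forms that is regular at \<open>p\<close> and
  agrees with \<open>\<phi>\<close> on an open set, hence wherever both are defined.\<close>

lemma in_local_ring_if_integral:
  assumes p: "p \<in> X" "p \<in> basic_open N (\<lambda>A. A $$ (i, j))"
    and U: "U \<noteq> {}" and reg: "regular_on N X U \<phi>" and int: "integral_over_local_ring N X p U \<phi>"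
  shows "in_local_ring N X p U \<phi>"
proof -
  let ?T = "subtopology (zariski N) X"
  have x: "(\<lambda>A. A $$ (i, j)) \<in> hom_poly_fun N 1" using ij by (rule hom_poly_fun_coord)
  obtain q where q: "q \<in> U" using U by blast
  obtain V0 d f g where V0: "openin ?T V0" "q \<in> V0" "V0 \<subseteq> U"
    and f: "f \<in> hom_poly_fun N d" and g: "g \<in> hom_poly_fun N d"
    and fg: "\<And>r A. r \<in> V0 \<Longrightarrow> A \<in> r \<Longrightarrow> A \<noteq> 0\<^sub>m N N \<Longrightarrow> g A \<noteq> 0 \<and> \<phi> r = f A / g A"
    using reg q unfolding regular_on_def by metis
  obtain W n c where W: "p \<in> W" "openin ?T W" and c: "\<And>k. k < n \<Longrightarrow> regular_on N X W (c k)"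
    and monic: "\<And>r. r \<in> U \<inter> W \<Longrightarrow> \<phi> r ^ n + (\<Sum>k<n. c k r * \<phi> r ^ k) = 0"
    using int unfolding integral_over_local_ring_def by blast
  have "\<forall>k\<in>{..<n}. \<exists>z. case z of (V, d, a, b) \<Rightarrow> openin ?T V \<and> p \<in> V \<and>
      a \<in> hom_poly_fun N d \<and> b \<in> hom_poly_fun N d \<and>
      (\<forall>r\<in>V. \<forall>A\<in>r. A \<noteq> 0\<^sub>m N N \<longrightarrow> b A \<noteq> 0 \<and> c k r = a A / b A)"
  proof
    fix k assume "k \<in> {..<n}"
    then have "regular_on N X W (c k)" using c by simp
    then obtain V d a b where "openin ?T V" "p \<in> V" "a \<in> hom_poly_fun N d" "b \<in> hom_poly_fun N d"
      "\<forall>r\<in>V. \<forall>A\<in>r. A \<noteq> 0\<^sub>m N N \<longrightarrow> b A \<noteq> 0 \<and> c k r = a A / b A"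
      using W(1) unfolding regular_on_def by metis
    then show "\<exists>z. case z of (V, d, a, b) \<Rightarrow> openin ?T V \<and> p \<in> V \<and>
      a \<in> hom_poly_fun N d \<and> b \<in> hom_poly_fun N d \<and>
      (\<forall>r\<in>V. \<forall>A\<in>r. A \<noteq> 0\<^sub>m N N \<longrightarrow> b A \<noteq> 0 \<and> c k r = a A / b A)"
      by (intro exI[of _ "(V, d, a, b)"]) simp
  qed
  from bchoice[OF this] obtain z where z: "\<forall>k\<in>{..<n}. case z k of (V, d, a, b) \<Rightarrow> openin ?T V \<and> p \<in> V \<and>
      a \<in> hom_poly_fun N d \<and> b \<in> hom_poly_fun N d \<and>
      (\<forall>r\<in>V. \<forall>A\<in>r. A \<noteq> 0\<^sub>m N N \<longrightarrow> b A \<noteq> 0 \<and> c k r = a A / b A)" ..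
  define Vk where "Vk k = fst (z k)" for k
  define dk where "dk k = fst (snd (z k))" for k
  define a where "a k = fst (snd (snd (z k)))" for k
  define b where "b k = snd (snd (snd (z k)))" for k
  have Vk: "openin ?T (Vk k)" "p \<in> Vk k" and ab: "a k \<in> hom_poly_fun N (dk k)" "b k \<in> hom_poly_fun N (dk k)"
    and cab: "\<And>r A. r \<in> Vk k \<Longrightarrow> A \<in> r \<Longrightarrow> A \<noteq> 0\<^sub>m N N \<Longrightarrow> b k A \<noteq> 0 \<and> c k r = a k A / b k A"
    if "k < n" for k
    using bspec[OF z, of k] that by (auto simp: Vk_def dk_def a_def b_def split_beta)

  define Vp where "Vp = W \<inter> (X \<inter> basic_open N (\<lambda>A. A $$ (i, j))) \<inter> (X \<inter> (\<Inter>k\<in>{..<n}. Vk k))"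
  have "openin ?T (topspace ?T \<inter> (\<Inter>k\<in>{..<n}. Vk k))"
    using openin_INT[of "{..<n}" ?T Vk] Vk(1) by (simp only: Int_commute finite_lessThan lessThan_iff)
  then have "openin ?T (X \<inter> (\<Inter>k\<in>{..<n}. Vk k))" unfolding topspace_X .
  then have Vp: "openin ?T Vp" "p \<in> Vp"
    unfolding Vp_def using W Vk(2) p openin_X_basic_open[OF x] by auto
  then obtain r0 where r0: "r0 \<in> V0 \<inter> Vp" using meet[OF V0(1) Vp(1)] V0(2) by blast
  obtain O' where O': "openin (zariski N) O'" "V0 \<inter> Vp = O' \<inter> X"
    using openin_Int[OF V0(1) Vp(1)] unfolding openin_subtopology by blast
  \<comment> \<open>\<open>e\<close> cuts out a locus on which both descriptions, of \<open>\<phi>\<close> and of the coefficients, are valid\<close>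
  obtain e m where e: "e \<in> hom_poly_fun N m" "r0 \<in> basic_open N e" "basic_open N e \<subseteq> O'"
    using O' r0 unfolding openin_zariski_iff by blast
  obtain y0 where y0: "r0 = line (\<sigma> y0)" using chart_onto[of r0] r0 by (auto simp: Vp_def)
  have ey0: "e (\<sigma> y0) \<noteq> 0" using e(2) chart_basic_open[OF e(1)] by (simp add: y0)
  have generic: "line (\<sigma> y) \<in> V0 \<inter> Vp" if "e (\<sigma> y) \<noteq> 0" for y
    using that chart_basic_open[OF e(1)] e(3) O'(2) chart_in by blast
  note ep = pull_polyf[OF e(1)] and fp = pull_polyf[OF f] and gp = pull_polyf[OF g]

  define B where "B A = (\<Prod>k<n. b k A)" for A
  have B: "B \<in> hom_poly_fun N (\<Sum>k<n. dk k)"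
    unfolding B_def[abs_def] using ab by (intro hom_poly_fun_prod) auto
  note Bp = pull_polyf[OF B]
  define a' where "a' k y = a k (\<sigma> y) * (\<Prod>l\<in>{..<n} - {k}. b l (\<sigma> y)) * B (\<sigma> y) ^ (n - Suc k)" for k y
  have a'p: "a' k \<in> polyf" if "k < n" for k
    unfolding a'_def[abs_def] using pull_polyf ab that
    by (intro polyf.mult polyf_prod polyf_power Bp) auto
  have eq: "(B (\<sigma> y) * f (\<sigma> y)) ^ n + (\<Sum>k<n. a' k y * g (\<sigma> y) ^ (n - k) * (B (\<sigma> y) * f (\<sigma> y)) ^ k) = 0"
    for y
  proof (rule polyf_eq_zero_if_generic[OF _ ep ey0, where f = "\<lambda>y. (B (\<sigma> y) * f (\<sigma> y)) ^ n +
      (\<Sum>k<n. a' k y * g (\<sigma> y) ^ (n - k) * (B (\<sigma> y) * f (\<sigma> y)) ^ k)"])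
    show "(\<lambda>y. (B (\<sigma> y) * f (\<sigma> y)) ^ n + (\<Sum>k<n. a' k y * g (\<sigma> y) ^ (n - k) * (B (\<sigma> y) * f (\<sigma> y)) ^ k)) \<in> polyf"
      by (intro polyf.add polyf_power polyf_sum polyf.mult Bp fp gp a'p) simp
    fix y assume "e (\<sigma> y) \<noteq> 0"
    then have r: "line (\<sigma> y) \<in> V0" "line (\<sigma> y) \<in> W" "\<And>k. k < n \<Longrightarrow> line (\<sigma> y) \<in> Vk k"
      using generic by (auto simp: Vp_def)
    note val = fg[OF r(1) line_refl nonzero] cab[OF _ r(3) line_refl nonzero]
    have "(\<Sum>k<n. c k (line (\<sigma> y)) * \<phi> (line (\<sigma> y)) ^ k)
        = (\<Sum>k<n. a k (\<sigma> y) / b k (\<sigma> y) * (f (\<sigma> y) / g (\<sigma> y)) ^ k)"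
      using val by (intro sum.cong) auto
    then have "(f (\<sigma> y) / g (\<sigma> y)) ^ n + (\<Sum>k<n. a k (\<sigma> y) / b k (\<sigma> y) * (f (\<sigma> y) / g (\<sigma> y)) ^ k) = 0"
      using monic[of "line (\<sigma> y)"] r V0(3) val(1) by auto
    from integral_equation_clear_denominators[OF _ _ this]
    show "(B (\<sigma> y) * f (\<sigma> y)) ^ n + (\<Sum>k<n. a' k y * g (\<sigma> y) ^ (n - k) * (B (\<sigma> y) * f (\<sigma> y)) ^ k) = 0"
      using val unfolding B_def a'_def by simp
  qed
  have gy0: "g (\<sigma> y0) \<noteq> 0" using fg[OF _ line_refl nonzero] generic[OF ey0] by blast
  have "\<exists>h\<in>polyf. \<forall>y. B (\<sigma> y) * f (\<sigma> y) = g (\<sigma> y) * h y"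
    by (rule polyf_integrally_closed[OF polyf.mult[OF Bp fp] gp gy0, of n a']) (use a'p eq in auto)
  then obtain h where h: "h \<in> polyf" "\<And>y. B (\<sigma> y) * f (\<sigma> y) = g (\<sigma> y) * h y" by blast
  have gne: "g (\<sigma> y) \<noteq> 0" if "e (\<sigma> y) \<noteq> 0" for y
    using fg[OF _ line_refl nonzero] generic[OF that] by blast
  have "\<exists>H\<in>poly_fun N. \<forall>y. h y = H (\<sigma> y)"
  proof (rule descent[OF h(1) ep ey0])
    fix y y' assume "\<sigma> y = \<sigma> y'" "e (\<sigma> y) \<noteq> 0"
    then have "g (\<sigma> y) * h y = g (\<sigma> y) * h y'" "g (\<sigma> y) \<noteq> 0" using h(2)[of y] h(2)[of y'] gne by simp_all
    then show "h y = h y'" by simp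
  qed
  then obtain H where H: "H \<in> poly_fun N" "\<And>y. h y = H (\<sigma> y)" by blast
  obtain D F where F: "F \<in> hom_poly_fun N D" "\<And>A. A $$ (i, j) = 1 \<Longrightarrow> F A = H A"
    using homogenize[OF H(1) ij] by blast
  define M where "M = (\<Sum>k<n. dk k)"
  define num where "num A = F A * A $$ (i, j) ^ M" for A
  define den where "den A = B A * A $$ (i, j) ^ D" for A
  have num: "num \<in> hom_poly_fun N (D + M)"
    unfolding num_def[abs_def] using hom_poly_fun_mult[OF F(1) hom_poly_fun_power[OF x, of M]] by simp
  have den: "den \<in> hom_poly_fun N (D + M)"
    unfolding den_def[abs_def] using hom_poly_fun_mult[OF B hom_poly_fun_power[OF x, of D]]
    by (simp add: M_def add.commute)
  define V where "V = X \<inter> basic_open N den"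
  have V: "openin ?T V" unfolding V_def by (rule openin_X_basic_open[OF den])
  obtain A0 where A0: "p = line A0" "A0 \<noteq> 0\<^sub>m N N" using p(1) X_proj by (auto elim: proj_spaceE)
  have pV: "p \<in> V"
  proof -
    have pp: "p \<in> proj_space N" "A0 \<in> p" using p X_proj A0 line_refl by auto
    have "b k A0 \<noteq> 0" if "k < n" for k using cab[OF that Vk(2)[OF that] pp(2) A0(2)] by blast
    moreover have "A0 $$ (i, j) \<noteq> 0" using hom_nonzero_iff[OF pp A0(2) x] p(2) by simp
    ultimately have "den A0 \<noteq> 0" by (simp add: den_def B_def)
    then show ?thesis using hom_nonzero_iff[OF pp A0(2) den] p(1) by (simp add: V_def)
  qed
  define \<psi> where "\<psi> r = (let A = (SOME A. A \<in> r \<and> A \<noteq> 0\<^sub>m N N) in num A / den A)" for r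
  have \<psi>: "den A \<noteq> 0 \<and> \<psi> r = num A / den A" if r: "r \<in> V" and A: "A \<in> r" "A \<noteq> 0\<^sub>m N N" for r A
  proof -
    have rp: "r \<in> proj_space N" "r \<in> basic_open N den" using r X_proj by (auto simp: V_def)
    define A' where "A' = (SOME A. A \<in> r \<and> A \<noteq> 0\<^sub>m N N)"
    have A': "A' \<in> r" "A' \<noteq> 0\<^sub>m N N"
      unfolding A'_def using someI[of "\<lambda>A. A \<in> r \<and> A \<noteq> 0\<^sub>m N N" A] A by auto
    have rep: "r = line A" "A \<in> carrier_mat N N" using proj_space_rep[OF rp(1) A] by auto
    obtain t where t: "A' = t \<cdot>\<^sub>m A" using A'(1) rep(1) by (auto simp: line_def)
    have "t \<noteq> 0"
    proof
      assume "t = 0"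
      then have "A' = 0\<^sub>m N N" using t rep(2) by (intro eq_matI) auto
      then show False using A'(2) by simp
    qed
    then have "num A' / den A' = num A / den A"
      unfolding t using hom_poly_fun_D(2)[OF num rep(2)] hom_poly_fun_D(2)[OF den rep(2)] by simp
    then show ?thesis
      using hom_nonzero_iff[OF rp(1) A den] rp(2) by (simp add: \<psi>_def A'_def[symmetric] Let_def)
  qed
  have "regular_on N X V \<psi>"
    unfolding regular_on_def using V num den \<psi> by blast
  moreover have "\<phi> r = \<psi> r" if r: "r \<in> U \<inter> V" for r
  proof (rule ccontr)
    assume ne: "\<phi> r \<noteq> \<psi> r"
    obtain V2 d2 f2 g2 where V2: "openin ?T V2" "r \<in> V2"
      and f2: "f2 \<in> hom_poly_fun N d2" and g2: "g2 \<in> hom_poly_fun N d2"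
      and fg2: "\<And>r A. r \<in> V2 \<Longrightarrow> A \<in> r \<Longrightarrow> A \<noteq> 0\<^sub>m N N \<Longrightarrow> g2 A \<noteq> 0 \<and> \<phi> r = f2 A / g2 A"
      using reg r unfolding regular_on_def by (metis IntD1)
    \<comment> \<open>\<open>G\<close> detects a difference of \<open>\<phi>\<close> and \<open>\<psi>\<close>: nonzero at \<open>r\<close>, but zero where \<open>e\<close> is nonzero\<close>
    define G where "G A = f2 A * den A - g2 A * num A" for A
    have G: "G \<in> hom_poly_fun N (d2 + (D + M))"
      unfolding G_def[abs_def] by (intro hom_poly_fun_diff hom_poly_fun_mult f2 g2 num den)
    have rX: "r \<in> X" "r \<in> proj_space N" using r X_proj by (auto simp: V_def)
    then obtain A where A: "r = line A" "A \<noteq> 0\<^sub>m N N" by (auto elim: proj_spaceE)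
    have Ar: "A \<in> r" using A line_refl by simp
    have "G A \<noteq> 0"
    proof
      assume "G A = 0"
      then have "f2 A / g2 A = num A / den A"
        using fg2[OF V2(2) Ar A(2)] \<psi>[OF _ Ar A(2)] r by (simp add: G_def frac_eq_eq algebra_simps)
      then show False using ne fg2[OF V2(2) Ar A(2)] \<psi>[OF _ Ar A(2)] r by simp
    qed
    then have rG: "r \<in> X \<inter> basic_open N G" using hom_nonzero_iff[OF rX(2) Ar A(2) G] rX by simp
    have "openin ?T (V2 \<inter> V \<inter> (X \<inter> basic_open N G))"
      by (rule openin_Int[OF openin_Int[OF V2(1) V] openin_X_basic_open[OF G]])
    moreover have "r0 \<in> X \<inter> basic_open N e" using e(2) y0 chart_in by auto
    ultimately obtain s where s: "s \<in> V2" "s \<in> V" "s \<in> X" "s \<in> basic_open N G" "s \<in> basic_open N e"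
      using meet[OF _ openin_X_basic_open[OF e(1)], of "V2 \<inter> V \<inter> (X \<inter> basic_open N G)"] V2(2) r rG by blast
    have "s \<in> V0 \<inter> Vp" using s e(3) O'(2) by blast
    then obtain y where y: "s = line (\<sigma> y)" using chart_onto[of s] by (auto simp: Vp_def)
    have sy: "\<sigma> y \<in> s" using y line_refl by simp
    have ey: "e (\<sigma> y) \<noteq> 0" using s(5) chart_basic_open[OF e(1)] y by simp
    have "f2 (\<sigma> y) / g2 (\<sigma> y) = f (\<sigma> y) / g (\<sigma> y)"
      using fg2[OF s(1) sy nonzero] fg[OF _ sy nonzero] \<open>s \<in> V0 \<inter> Vp\<close> by auto
    moreover have "num (\<sigma> y) / den (\<sigma> y) = f (\<sigma> y) / g (\<sigma> y)"
    proof -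
      have "num (\<sigma> y) = h y" "den (\<sigma> y) = B (\<sigma> y)"
        using F(2)[OF normalized] H(2) by (simp_all add: num_def den_def normalized)
      then show ?thesis
        using h(2)[of y] gne[OF ey] \<psi>[OF s(2) sy nonzero] by (simp add: frac_eq_eq mult.commute)
    qed
    ultimately have "f2 (\<sigma> y) / g2 (\<sigma> y) = num (\<sigma> y) / den (\<sigma> y)" by simp
    moreover have "g2 (\<sigma> y) \<noteq> 0" "den (\<sigma> y) \<noteq> 0"
      using fg2[OF s(1) sy nonzero] \<psi>[OF s(2) sy nonzero] by auto
    ultimately have "G (\<sigma> y) = 0" by (simp add: G_def frac_eq_eq mult.commute)
    then show False using s(4) chart_basic_open[OF G] y by simp
  qed
  ultimately show ?thesis unfolding in_local_ring_def using pV by blast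
qed

end

section \<open>Charts of the Schubert varieties\<close>

lemma polyf_if: "(P \<Longrightarrow> f \<in> polyf) \<Longrightarrow> (\<not> P \<Longrightarrow> g \<in> polyf) \<Longrightarrow> (\<lambda>y. if P then f y else g y) \<in> polyf"
  by (cases P) simp_all

text \<open>The chart at a plane not contained in \<open>E a\<close>: such a plane has a unique basis consisting of a
  vector of \<open>E a\<close> with coordinate \<open>1\<close> at \<open>i < a\<close> and a vector of \<open>E b\<close> with coordinates \<open>0\<close> at \<open>i\<close>
  and \<open>1\<close> at \<open>j \<ge> a\<close>. The remaining coordinates are free parameters.\<close>

definition smooth_v :: "nat \<Rightarrow> nat \<Rightarrow> nat \<Rightarrow> (nat \<times> nat \<Rightarrow> complex) \<Rightarrow> nat \<Rightarrow> complex" where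
  "smooth_v a i j y k = (if k = i then 1 else if k < a then y (0, k) else 0)"

definition smooth_w :: "nat \<Rightarrow> nat \<Rightarrow> nat \<Rightarrow> (nat \<times> nat \<Rightarrow> complex) \<Rightarrow> nat \<Rightarrow> complex" where
  "smooth_w b i j y k = (if k = i then 0 else if k = j then 1 else if k < b then y (1, k) else 0)"

definition smooth_chart :: "nat \<Rightarrow> nat \<Rightarrow> nat \<Rightarrow> nat \<Rightarrow> nat \<Rightarrow> (nat \<times> nat \<Rightarrow> complex) \<Rightarrow> complex mat" where
  "smooth_chart N a b i j y = wedge N (vec N (smooth_v a i j y)) (vec N (smooth_w b i j y))"

text \<open>The parameters are themselves coordinates on \<open>X\<close>, namely the entries in column \<open>j\<close> and in row \<open>i\<close>.
  So there is a polynomial inverse \<open>\<tau>\<close>, and descent is composition with \<open>\<tau>\<close>.\<close>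

lemma polynomial_chart_smooth:
  assumes ab: "0 < a" "a < b" "b \<le> N" and ij: "i < a" "a \<le> j" "j < b"
  shows "polynomial_chart N (planes N a b) i j (smooth_chart N a b i j)"
proof
  let ?\<sigma> = "smooth_chart N a b i j"
  show "irreducible_variety N (planes N a b)" using ab by (rule irreducible_variety_planes)
  show "i < N" "j < N" using ij ab by auto
  show "?\<sigma> y \<in> carrier_mat N N" for y by (simp add: smooth_chart_def)
  have v: "(\<lambda>y. smooth_v a i j y k) \<in> polyf" and w: "(\<lambda>y. smooth_w b i j y k) \<in> polyf" for k
    unfolding smooth_v_def smooth_w_def by (intro polyf_if polyf.const polyf.var)+
  have entry: "?\<sigma> y $$ (k, l) = smooth_v a i j y k * smooth_w b i j y l - smooth_w b i j y k * smooth_v a i j y l"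
    if "k < N" "l < N" for k l y
    using that by (simp add: smooth_chart_def wedge_entry)
  show entry_polyf: "(\<lambda>y. ?\<sigma> y $$ (k, l)) \<in> polyf" if "k < N" "l < N" for k l
    unfolding entry[OF that] by (intro polyf_diff polyf.mult v w)
  show norm: "?\<sigma> y $$ (i, j) = 1" for y
    using ij ab by (simp add: entry smooth_v_def smooth_w_def)
  show "line (?\<sigma> y) \<in> planes N a b" for y
  proof -
    have "?\<sigma> y \<noteq> 0\<^sub>m N N" using norm[of y] ij ab by auto
    moreover have "vec N (smooth_v a i j y) \<in> coord_space N a" "vec N (smooth_w b i j y) \<in> coord_space N b"
      using ij ab by (auto simp: coord_space_def smooth_v_def smooth_w_def)
    ultimately show ?thesis unfolding planes_def smooth_chart_def by blast
  qed
  show "\<exists>y. p = line (?\<sigma> y)" if p: "p \<in> planes N a b" "p \<in> basic_open N (\<lambda>A. A $$ (i, j))" for p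
  proof -
    obtain v w where vw: "v \<in> coord_space N a" "w \<in> coord_space N b" "wedge N v w \<noteq> 0\<^sub>m N N"
      and pe: "p = line (wedge N v w)" using p(1) unfolding planes_def by blast
    have c: "v \<in> carrier_vec N" "w \<in> carrier_vec N" using vw by (auto simp: coord_space_def)
    have "wedge N v w $$ (i, j) \<noteq> 0"
      using hom_nonzero_iff[OF _ _ vw(3) hom_poly_fun_coord[of i N j]] p ij ab
        planes_subset_proj[of N a b] line_refl[of "wedge N v w"] unfolding pe by auto
    moreover have vj: "v $ j = 0" using vw(1) ij ab by (auto simp: coord_space_def)
    ultimately have ne: "v $ i \<noteq> 0" "w $ j \<noteq> 0" using ij ab by (auto simp: wedge_entry)
    define \<alpha> where "\<alpha> = 1 / v $ i"
    define \<gamma> where "\<gamma> = - w $ i / (v $ i * w $ j)"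
    define \<delta> where "\<delta> = 1 / w $ j"
    \<comment> \<open>the normalized basis \<open>\<alpha> v\<close>, \<open>\<gamma> v + \<delta> w\<close>; recall \<open>v $ j = 0\<close>\<close>
    define y where "y = (\<lambda>(r :: nat, k). if r = 0 then \<alpha> * v $ k else \<gamma> * v $ k + \<delta> * w $ k)"
    have "vec N (smooth_v a i j y) = \<alpha> \<cdot>\<^sub>v v + 0 \<cdot>\<^sub>v w"
      using vw(1) c ne ij ab by (intro eq_vecI) (auto simp: smooth_v_def y_def \<alpha>_def coord_space_def)
    moreover have "vec N (smooth_w b i j y) = \<gamma> \<cdot>\<^sub>v v + \<delta> \<cdot>\<^sub>v w"
      using vw c ne ij ab vj
      by (intro eq_vecI) (auto simp: smooth_w_def y_def \<gamma>_def \<delta>_def coord_space_def field_simps)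
    ultimately have "?\<sigma> y = (\<alpha> * \<delta>) \<cdot>\<^sub>m wedge N v w"
      unfolding smooth_chart_def using wedge_comb[OF c, of \<alpha> 0 \<gamma> \<delta>] by simp
    moreover have "\<alpha> * \<delta> \<noteq> 0" using ne by (simp add: \<alpha>_def \<delta>_def)
    ultimately have "line (?\<sigma> y) = p" unfolding pe using line_smult[OF wedge_carrier vw(3)] by simp
    then show ?thesis by blast
  qed
  fix h e :: "(nat \<times> nat \<Rightarrow> complex) \<Rightarrow> complex" and y0
  assume h: "h \<in> polyf" and e: "e \<in> polyf" "e y0 \<noteq> 0"
    and fib: "\<And>y y'. ?\<sigma> y = ?\<sigma> y' \<Longrightarrow> e y \<noteq> 0 \<Longrightarrow> h y = h y'"
  define \<tau> :: "complex mat \<Rightarrow> nat \<times> nat \<Rightarrow> complex"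
    where "\<tau> A = (\<lambda>(r, k). if k < N then if r = 0 then A $$ (k, j) else A $$ (i, k) else 0)" for A
  have "smooth_v a i j (\<tau> (?\<sigma> y)) k = smooth_v a i j y k" if "k < N" for y k
    using that ij ab by (simp add: smooth_v_def smooth_w_def \<tau>_def entry)
  moreover have "smooth_w b i j (\<tau> (?\<sigma> y)) k = smooth_w b i j y k" if "k < N" for y k
    using that ij ab by (simp add: smooth_v_def smooth_w_def \<tau>_def entry)
  ultimately have retract: "?\<sigma> (\<tau> (?\<sigma> y)) = ?\<sigma> y" for y
    by (intro eq_matI) (auto simp: smooth_chart_def wedge_entry)
  have \<tau>\<sigma>: "(\<lambda>y. \<tau> (?\<sigma> y) m) \<in> polyf" for m
  proof (cases m)
    case (Pair r k)
    then show ?thesis using entry_polyf[of k j] entry_polyf[of i k] ij ab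
      by (cases "k < N"; cases "r = 0") (simp_all add: \<tau>_def polyf.const)
  qed
  have "h y = h (\<tau> (?\<sigma> y))" for y
  proof -
    have "h y - h (\<tau> (?\<sigma> y)) = 0"
    proof (rule polyf_eq_zero_if_generic[OF _ e, where f = "\<lambda>y. h y - h (\<tau> (?\<sigma> y))"])
      show "(\<lambda>y. h y - h (\<tau> (?\<sigma> y))) \<in> polyf" by (intro polyf_diff h polyf_subst[OF h] \<tau>\<sigma>)
      show "h y - h (\<tau> (?\<sigma> y)) = 0" if "e y \<noteq> 0" for y
        using fib[OF retract[symmetric] that] by simp
    qed
    then show ?thesis by simp
  qed
  moreover have "(\<lambda>A. h (\<tau> A)) \<in> poly_fun N"
  proof (rule polyf_poly_fun[OF h])
    fix m :: "nat \<times> nat"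
    obtain r k where m: "m = (r, k)" by (cases m)
    show "(\<lambda>A. \<tau> A m) \<in> poly_fun N"
      using ij ab unfolding m
      by (cases "k < N"; cases "r = 0") (simp_all add: \<tau>_def poly_fun.const poly_fun.coord)
  qed
  ultimately show "\<exists>H\<in>poly_fun N. \<forall>y. h y = H (?\<sigma> y)"
    by (intro bexI[of _ "\<lambda>A. h (\<tau> A)"]) simp_all
qed

text \<open>The chart at a plane inside \<open>E a\<close>: the basis is normalized at \<open>i, j < a\<close>. The coordinates from \<open>a\<close>
  on form a matrix of rank at most one, since some combination of the two basis vectors lies in
  \<open>E a\<close>; it is parametrized as \<open>s t\<^sup>T\<close> with \<open>s = (y (2, 0), y (2, 1))\<close> and \<open>t k = y (3, k)\<close>.\<close>

definition cone_v :: "nat \<Rightarrow> nat \<Rightarrow> nat \<Rightarrow> nat \<Rightarrow> (nat \<times> nat \<Rightarrow> complex) \<Rightarrow> nat \<Rightarrow> complex" where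
  "cone_v a b i j y k = (if k = i then 1 else if k = j then 0 else if k < a then y (0, k)
     else if k < b then y (2, 0) * y (3, k) else 0)"

definition cone_w :: "nat \<Rightarrow> nat \<Rightarrow> nat \<Rightarrow> nat \<Rightarrow> (nat \<times> nat \<Rightarrow> complex) \<Rightarrow> nat \<Rightarrow> complex" where
  "cone_w a b i j y k = (if k = i then 0 else if k = j then 1 else if k < a then y (1, k)
     else if k < b then y (2, 1) * y (3, k) else 0)"

definition cone_chart :: "nat \<Rightarrow> nat \<Rightarrow> nat \<Rightarrow> nat \<Rightarrow> nat \<Rightarrow> (nat \<times> nat \<Rightarrow> complex) \<Rightarrow> complex mat" where
  "cone_chart N a b i j y = wedge N (vec N (cone_v a b i j y)) (vec N (cone_w a b i j y))"

definition cone_wt :: "nat \<times> nat \<Rightarrow> int" where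
  "cone_wt m = (if fst m = 2 then 1 else if fst m = 3 then -1 else 0)"

text \<open>The parameter space has a variable for every pair of numbers; these are the pairs whose variables
  occur in the chart. Descent needs to get rid of the others.\<close>

definition cone_used :: "nat \<Rightarrow> nat \<Rightarrow> nat \<Rightarrow> nat \<Rightarrow> nat \<times> nat \<Rightarrow> bool" where
  "cone_used a b i j m \<longleftrightarrow> fst m \<in> {0, 1} \<and> snd m < a \<and> snd m \<noteq> i \<and> snd m \<noteq> j \<or>
     fst m = 2 \<and> snd m \<in> {0, 1} \<or> fst m = 3 \<and> a \<le> snd m \<and> snd m < b"

text \<open>Normalize the bivector to have entry \<open>1\<close> at \<open>(i, j)\<close>. By the Pluecker relations it is the wedge
  product of its column \<open>j\<close> and its row \<open>i\<close>, and the relation that its entries at \<open>k, l \<ge> a\<close> vanish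
  says that the tails of these two vectors are proportional.\<close>

lemma cone_chart_onto:
  assumes ab: "0 < a" "a < b" "b \<le> N" and ij: "i < a" "j < a" "i \<noteq> j"
    and p: "p \<in> planes N a b" "p \<in> basic_open N (\<lambda>A. A $$ (i, j))"
  shows "\<exists>y. p = line (cone_chart N a b i j y)"
proof -
  have pp: "p \<in> proj_space N" using p planes_subset_proj by blast
  obtain A' where A': "A' \<in> p" "A' $$ (i, j) \<noteq> 0" using p(2) by (auto simp: basic_open_def)
  have A'c: "A' \<in> carrier_mat N N" using planes_rel(1)[OF p(1) _ A'(1)] ab by simp
  have A'0: "A' \<noteq> 0\<^sub>m N N" using A'(2) ij ab by auto
  define A where "A = (1 / A' $$ (i, j)) \<cdot>\<^sub>m A'"
  have A0: "A \<noteq> 0\<^sub>m N N" unfolding A_def using smult_mat_eq_zero[OF A'c A'0, of "1 / A' $$ (i, j)"] A'(2) by auto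
  have pA: "p = line A"
    using proj_space_rep(1)[OF pp A'(1) A'0] line_smult[OF A'c A'0, of "1 / A' $$ (i, j)"] A'(2)
    by (simp add: A_def)
  have Ap: "A \<in> p" unfolding pA by (rule line_refl)
  have "a \<le> b" using ab by simp
  note rel = planes_rel[OF p(1) this Ap]
  have Aij: "A $$ (i, j) = 1" using A'(2) A'c ij ab by (simp add: A_def)
  have skew: "A $$ (l, k) = - A $$ (k, l)" if "k < N" "l < N" for k l
    using arg_cong[OF proj_space_rep(3)[OF pp Ap A0], of "\<lambda>M. M $$ (k, l)"] that rel(1) by simp
  have diag: "A $$ (k, k) = 0" if "k < N" for k using skew[OF that that] by simp
  have iN: "i < N" "j < N" using ij ab by auto
  have decomp: "A $$ (k, l) = A $$ (k, j) * A $$ (i, l) - A $$ (i, k) * A $$ (l, j)" if kl: "k < N" "l < N" for k l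
  proof -
    have "A $$ (i, k) * A $$ (j, l) - A $$ (j, k) * A $$ (i, l) = A $$ (i, j) * A $$ (k, l)"
      using rel(2) kl iN unfolding pluecker_rel_def by blast
    then show ?thesis
      using skew[OF kl(1) iN(2)] skew[OF kl(2) iN(2)] Aij by simp
  qed
  have zero: "A $$ (k, l) = 0" if "k < N" "l < N" "b \<le> k \<or> b \<le> l \<or> (a \<le> k \<and> a \<le> l)" for k l
    using rel(3) that unfolding schubert_rel_def by blast
  have "\<exists>s0 s1 t. \<forall>k. a \<le> k \<and> k < b \<longrightarrow> A $$ (k, j) = s0 * t k \<and> A $$ (i, k) = s1 * t k"
  proof (cases "\<exists>k0. a \<le> k0 \<and> k0 < b \<and> A $$ (k0, j) \<noteq> 0")
    case True
    then obtain k0 where k0: "a \<le> k0" "k0 < b" "A $$ (k0, j) \<noteq> 0" by blast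
    have "A $$ (i, k) = A $$ (i, k0) / A $$ (k0, j) * A $$ (k, j)" if "a \<le> k" "k < b" for k
      using decomp[of k0 k] zero[of k0 k] that k0 ab by (simp add: field_simps)
    then show ?thesis
      by (intro exI[of _ 1] exI[of _ "A $$ (i, k0) / A $$ (k0, j)"] exI[of _ "\<lambda>k. A $$ (k, j)"]) auto
  next
    case False
    then show ?thesis
      by (intro exI[of _ 0] exI[of _ 1] exI[of _ "\<lambda>k. A $$ (i, k)"]) auto
  qed
  then obtain s0 s1 t where st: "\<And>k. a \<le> k \<Longrightarrow> k < b \<Longrightarrow> A $$ (k, j) = s0 * t k \<and> A $$ (i, k) = s1 * t k"
    by blast
  define y where "y = (\<lambda>(m :: nat, k :: nat). if m = 0 then A $$ (k, j) else if m = 1 then A $$ (i, k)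
    else if m = 2 then if k = 0 then s0 else s1 else t k)"
  have v: "cone_v a b i j y k = A $$ (k, j)" if "k < N" for k
    using that st[of k] Aij diag[OF iN(2)] zero[of k j] iN by (auto simp: cone_v_def y_def)
  have w: "cone_w a b i j y k = A $$ (i, k)" if "k < N" for k
    using that st[of k] Aij diag[OF iN(1)] zero[of i k] iN by (auto simp: cone_w_def y_def)
  have "cone_chart N a b i j y = A"
  proof (rule eq_matI)
    fix k l assume "k < dim_row A" "l < dim_col A"
    then have kl: "k < N" "l < N" using rel(1) by auto
    show "cone_chart N a b i j y $$ (k, l) = A $$ (k, l)"
      using decomp[OF kl] kl by (simp add: cone_chart_def wedge_entry v w)
  qed (use rel(1) in \<open>auto simp: cone_chart_def\<close>)
  then show ?thesis using pA by blast
qed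

text \<open>A function that is constant on the fibres of the chart can be evaluated after setting the unused
  parameters to \<open>0\<close>, and it is invariant under the torus that scales \<open>s\<close> and \<open>t\<close> inversely. So it is
  a polynomial in the other parameters and the products \<open>s k * t l\<close>, which are all entries of the
  bivector in column \<open>j\<close> or row \<open>i\<close>.\<close>

lemma polynomial_chart_cone:
  assumes ab: "0 < a" "a < b" "b \<le> N" and ij: "i < a" "j < a" "i \<noteq> j"
  shows "polynomial_chart N (planes N a b) i j (cone_chart N a b i j)"
proof
  let ?\<sigma> = "cone_chart N a b i j"
  show "irreducible_variety N (planes N a b)" using ab by (rule irreducible_variety_planes)
  show ijN: "i < N" "j < N" using ij ab by auto
  show carrier: "?\<sigma> y \<in> carrier_mat N N" for y by (simp add: cone_chart_def)
  have v: "(\<lambda>y. cone_v a b i j y k) \<in> polyf" and w: "(\<lambda>y. cone_w a b i j y k) \<in> polyf" for k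
    unfolding cone_v_def cone_w_def by (intro polyf_if polyf.const polyf.var polyf.mult)+
  have entry: "?\<sigma> y $$ (k, l) = cone_v a b i j y k * cone_w a b i j y l - cone_w a b i j y k * cone_v a b i j y l"
    if "k < N" "l < N" for k l y
    using that by (simp add: cone_chart_def wedge_entry)
  show "(\<lambda>y. ?\<sigma> y $$ (k, l)) \<in> polyf" if "k < N" "l < N" for k l
    unfolding entry[OF that] by (intro polyf_diff polyf.mult v w)
  show norm: "?\<sigma> y $$ (i, j) = 1" for y
    using ij ijN by (simp add: entry cone_v_def cone_w_def)
  show "line (?\<sigma> y) \<in> planes N a b" for y
  proof (rule planesI_rel[OF carrier])
    show "transpose_mat (?\<sigma> y) = - ?\<sigma> y" unfolding cone_chart_def by (rule wedge_skew)
    show "?\<sigma> y \<noteq> 0\<^sub>m N N" using norm[of y] ijN by auto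
    show "pluecker_rel N (?\<sigma> y)" unfolding cone_chart_def by (rule pluecker_rel_wedge)
    show "schubert_rel N a b (?\<sigma> y)"
      using ij ab by (auto simp: schubert_rel_def entry cone_v_def cone_w_def)
  qed (use ab in simp)
  show "\<exists>y. p = line (?\<sigma> y)" if "p \<in> planes N a b" "p \<in> basic_open N (\<lambda>A. A $$ (i, j))" for p
    by (rule cone_chart_onto[OF ab ij that])
  fix h e :: "(nat \<times> nat \<Rightarrow> complex) \<Rightarrow> complex" and y0
  assume h: "h \<in> polyf" and e: "e \<in> polyf" "e y0 \<noteq> 0"
    and fib: "\<And>y y'. ?\<sigma> y = ?\<sigma> y' \<Longrightarrow> e y \<noteq> 0 \<Longrightarrow> h y = h y'"
  have everywhere: "h (s y) = h y"
    if s: "\<And>y. ?\<sigma> (s y) = ?\<sigma> y" "\<And>m. (\<lambda>y. s y m) \<in> polyf" for s y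
  proof -
    have "h y - h (s y) = 0"
    proof (rule polyf_eq_zero_if_generic[OF _ e, where f = "\<lambda>y. h y - h (s y)"])
      show "(\<lambda>y. h y - h (s y)) \<in> polyf" by (intro polyf_diff h polyf_subst[OF h] s)
      show "h y - h (s y) = 0" if "e y \<noteq> 0" for y using fib[OF s(1)[symmetric] that] by simp
    qed
    then show ?thesis by simp
  qed
  define r :: "(nat \<times> nat \<Rightarrow> complex) \<Rightarrow> nat \<times> nat \<Rightarrow> complex"
    where "r y m = (if cone_used a b i j m then y m else 0)" for y m
  have "cone_v a b i j (r y) = cone_v a b i j y" "cone_w a b i j (r y) = cone_w a b i j y" for y
    by (auto simp: fun_eq_iff cone_v_def cone_w_def r_def cone_used_def)
  then have "?\<sigma> (r y) = ?\<sigma> y" for y by (simp add: cone_chart_def)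
  then have hr: "h (r y) = h y" for y
    by (rule everywhere) (unfold r_def, intro polyf_if polyf.var polyf.const)
  have "h (torus_act cone_wt c y) = h y" if c: "c \<noteq> 0" for c y
  proof (rule everywhere)
    have "cone_v a b i j (torus_act cone_wt c y) = cone_v a b i j y"
      "cone_w a b i j (torus_act cone_wt c y) = cone_w a b i j y" for y
      using c by (auto simp: fun_eq_iff cone_v_def cone_w_def torus_act_def cone_wt_def power_int_minus field_simps)
    then show "?\<sigma> (torus_act cone_wt c y) = ?\<sigma> y" for y by (simp add: cone_chart_def)
    show "(\<lambda>y. torus_act cone_wt c y m) \<in> polyf" for m
      unfolding torus_act_def by (intro polyf.mult polyf.const polyf.var)
  qed
  moreover have "cone_wt m \<in> {-1, 0, 1}" for m by (simp add: cone_wt_def)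
  ultimately have "h \<in> inv_poly cone_wt" using torus_invariant_imp_inv_poly[OF h, of cone_wt] by blast
  then have "\<exists>H\<in>poly_fun N. \<forall>y. h (r y) = H (?\<sigma> y)"
  proof induction
    case (const c)
    show ?case by (rule bexI[OF _ poly_fun.const[of c]]) simp
  next
    case (var m)
    obtain l k where m: "m = (l, k)" by (cases m)
    show ?case
    proof (cases "cone_used a b i j m")
      case False
      then show ?thesis by (intro bexI[OF _ poly_fun.const[of 0]]) (simp add: r_def)
    next
      case True
      then have used: "l = 0 \<or> l = 1" "k < a" "k \<noteq> i" "k \<noteq> j"
        using var unfolding m by (auto simp: cone_used_def cone_wt_def)
      then have kN: "k < N" using ab by simp
      show ?thesis
      proof (cases "l = 0")
        case True
        then have "r y m = ?\<sigma> y $$ (k, j)" for y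
          using used ij \<open>cone_used a b i j m\<close> m by (simp add: entry[OF kN ijN(2)] cone_v_def cone_w_def r_def)
        then show ?thesis by (intro bexI[OF _ poly_fun.coord[OF kN ijN(2)]]) simp
      next
        case False
        then have "r y m = ?\<sigma> y $$ (i, k)" for y
          using used ij \<open>cone_used a b i j m\<close> m by (simp add: entry[OF ijN(1) kN] cone_v_def cone_w_def r_def)
        then show ?thesis by (intro bexI[OF _ poly_fun.coord[OF ijN(1) kN]]) simp
      qed
    qed
  next
    case (pair m m')
    obtain l k l' k' where m: "m = (l, k)" "m' = (l', k')" by (cases m, cases m')
    have l: "l = 2" "l' = 3" using pair unfolding m by (auto simp: cone_wt_def split: if_splits)
    show ?case
    proof (cases "cone_used a b i j m \<and> cone_used a b i j m'")
      case False
      then show ?thesis by (intro bexI[OF _ poly_fun.const[of 0]]) (auto simp: r_def)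
    next
      case True
      then have used: "k = 0 \<or> k = 1" "a \<le> k'" "k' < b" unfolding m l by (auto simp: cone_used_def)
      then have kN: "k' < N" using ab by simp
      show ?thesis
      proof (cases "k = 0")
        case k: True
        have "r y m * r y m' = ?\<sigma> y $$ (k', j)" for y
          using used ij True k l m by (simp add: entry[OF kN ijN(2)] cone_v_def cone_w_def r_def)
        then show ?thesis by (intro bexI[OF _ poly_fun.coord[OF kN ijN(2)]]) simp
      next
        case k: False
        then have "r y m * r y m' = ?\<sigma> y $$ (i, k')" for y
          using used ij True l m by (simp add: entry[OF ijN(1) kN] cone_v_def cone_w_def r_def)
        then show ?thesis by (intro bexI[OF _ poly_fun.coord[OF ijN(1) kN]]) simp
      qed
    qed
  next
    case (add f g)
    then obtain F G where "F \<in> poly_fun N" "\<forall>y. f (r y) = F (?\<sigma> y)" "G \<in> poly_fun N" "\<forall>y. g (r y) = G (?\<sigma> y)"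
      by blast
    then show ?case by (intro bexI[OF _ poly_fun.add[of F N G]]) simp_all
  next
    case (mult f g)
    then obtain F G where "F \<in> poly_fun N" "\<forall>y. f (r y) = F (?\<sigma> y)" "G \<in> poly_fun N" "\<forall>y. g (r y) = G (?\<sigma> y)"
      by blast
    then show ?case by (intro bexI[OF _ poly_fun.mult[of F N G]]) simp_all
  qed
  then show "\<exists>H\<in>poly_fun N. \<forall>y. h y = H (?\<sigma> y)" by (simp add: hr)
qed

lemma normal_variety_planes:
  assumes ab: "0 < a" "a < b" "b \<le> N"
  shows "normal_variety N (planes N a b)"
  unfolding normal_variety_def
proof (intro conjI ballI allI impI)
  show "irreducible_variety N (planes N a b)" using ab by (rule irreducible_variety_planes)
  fix p U \<phi> assume p: "p \<in> planes N a b"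
    and "U \<noteq> {} \<and> regular_on N (planes N a b) U \<phi> \<and> integral_over_local_ring N (planes N a b) p U \<phi>"
  then have U: "U \<noteq> {}" "regular_on N (planes N a b) U \<phi>" "integral_over_local_ring N (planes N a b) p U \<phi>"
    by auto
  have pp: "p \<in> proj_space N" using p planes_subset_proj by blast
  then obtain A where A: "p = line A" "A \<in> carrier_mat N N" "transpose_mat A = - A" "A \<noteq> 0\<^sub>m N N"
    by (rule proj_spaceE)
  have Ap: "A \<in> p" using A line_refl by simp
  have rel: "schubert_rel N a b A" using planes_rel(3)[OF p _ Ap] ab by simp
  have skew: "A $$ (l, k) = - A $$ (k, l)" if "k < N" "l < N" for k l
    using arg_cong[OF A(3), of "\<lambda>M. M $$ (k, l)"] that A(2) by simp
  obtain k l where kl: "k < N" "l < N" "A $$ (k, l) \<noteq> 0" using nonzero_entry[OF A(2,4)] .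
  have "\<exists>i j. i < a \<and> j < b \<and> A $$ (i, j) \<noteq> 0"
  proof (cases "k < a")
    case True
    then show ?thesis using kl rel unfolding schubert_rel_def by (meson not_le)
  next
    case False
    then have "l < a" "k < b" using kl rel unfolding schubert_rel_def by (meson not_le)+
    moreover have "A $$ (l, k) \<noteq> 0" using skew[OF kl(1,2)] kl(3) by simp
    ultimately show ?thesis by blast
  qed
  then obtain i j where ij: "i < a" "j < b" "A $$ (i, j) \<noteq> 0" by blast
  then have ijN: "i < N" "j < N" using ab by auto
  have pij: "p \<in> basic_open N (\<lambda>A. A $$ (i, j))"
    using hom_nonzero_iff[OF pp Ap A(4) hom_poly_fun_coord[OF ijN]] ij(3) by simp
  show "in_local_ring N (planes N a b) p U \<phi>"
  proof (cases "j < a")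
    case True
    have "i \<noteq> j" using skew[OF ijN] ij(3) by auto
    then show ?thesis
      using polynomial_chart.in_local_ring_if_integral[OF polynomial_chart_cone[OF ab ij(1) True] p pij U] by simp
  next
    case False
    then have "a \<le> j" by simp
    show ?thesis
      by (rule polynomial_chart.in_local_ring_if_integral[OF polynomial_chart_smooth[OF ab ij(1) \<open>a \<le> j\<close> ij(2)] p pij U])
  qed
qed

section \<open>The stabilizer of a Schubert variety and its Levi subgroup\<close>

lemma preserves_transv:
  assumes "d \<noteq> e" "0 < d" "d < N"
  shows "preserves N e (transv N d (d - 1) c)"
  using assms by (auto simp: preserves_def emb2_def)

lemma set_stabilizerI:
  assumes g: "g \<in> carrier (GL N)" and pres: "preserves N a g" "preserves N b g"
    and inv: "preserves N a (inv\<^bsub>GL N\<^esub> g)" "preserves N b (inv\<^bsub>GL N\<^esub> g)"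
  shows "g \<in> set_stabilizer N (planes N a b)"
proof -
  have "act g ` planes N a b = planes N a b"
  proof (intro equalityI subsetI)
    fix p assume p: "p \<in> planes N a b"
    have "p \<in> proj_space N" using p planes_subset_proj by blast
    then have "p = act g (act (inv\<^bsub>GL N\<^esub> g) p)" using act_inv(1)[OF g] by simp
    then show "p \<in> act g ` planes N a b"
      using act_planes[OF GL_inv(1)[OF g] inv p] by blast
  qed (use act_planes[OF g pres] in blast)
  then show ?thesis using g by (simp add: set_stabilizer_def)
qed

lemma set_stabilizer_inv:
  assumes X: "X \<subseteq> proj_space N" and g: "g \<in> set_stabilizer N X"
  shows "inv\<^bsub>GL N\<^esub> g \<in> set_stabilizer N X"
proof -
  have gG: "g \<in> carrier (GL N)" and gX: "act g ` X = X" using g by (auto simp: set_stabilizer_def)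
  have "act (inv\<^bsub>GL N\<^esub> g) ` act g ` X = X"
    unfolding image_image using act_inv(2)[OF gG] X by (simp add: subset_eq cong: image_cong)
  then show ?thesis using GL_inv(1)[OF gG] gX by (simp add: set_stabilizer_def)
qed

lemma wedge_row_zero:
  assumes "wedge N x y \<noteq> 0\<^sub>m N N" "i < N" "\<And>k. k < N \<Longrightarrow> wedge N x y $$ (i, k) = 0"
  shows "x $ i = 0" "y $ i = 0"
proof -
  have rel: "x $ i * y $ k = y $ i * x $ k" if "k < N" for k
    using assms(3)[OF that] assms(2) that by (simp add: wedge_entry)
  have "x $ i = 0 \<and> y $ i = 0"
  proof (rule ccontr)
    assume ne: "\<not> ?thesis"
    have "x $ k * y $ l - y $ k * x $ l = 0" if "k < N" "l < N" for k l
    proof -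
      have "x $ i * (x $ k * y $ l - y $ k * x $ l) = x $ k * (x $ i * y $ l) - (x $ i * y $ k) * x $ l"
        by (simp add: algebra_simps)
      also have "\<dots> = 0" unfolding rel[OF that(1)] rel[OF that(2)] by simp
      finally have 1: "x $ i * (x $ k * y $ l - y $ k * x $ l) = 0" .
      have "y $ i * (x $ k * y $ l - y $ k * x $ l) = (y $ i * x $ k) * y $ l - y $ k * (y $ i * x $ l)"
        by (simp add: algebra_simps)
      also have "\<dots> = 0" unfolding rel[OF that(1), symmetric] rel[OF that(2), symmetric] by simp
      finally show ?thesis using 1 ne by auto
    qed
    then have "wedge N x y = 0\<^sub>m N N" by (intro eq_matI) (auto simp: wedge_entry)
    then show False using assms(1) by simp
  qed
  then show "x $ i = 0" "y $ i = 0" by auto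
qed

text \<open>The coordinate point \<open>e i \<and> e j\<close> lies in \<open>X\<close>, and \<open>g\<close> maps it to the wedge product of two columns of
  \<open>g\<close>.\<close>

lemma stabilizer_columns:
  assumes ab: "a < b" "b \<le> N" and g: "g \<in> set_stabilizer N (planes N a b)"
    and ij: "i < a" "j < b" "i \<noteq> j"
  shows "wedge N (col g i) (col g j) \<noteq> 0\<^sub>m N N" "schubert_rel N a b (wedge N (col g i) (col g j))"
proof -
  let ?e = "unit_vec N i :: complex vec" and ?f = "unit_vec N j :: complex vec"
  have gG: "g \<in> carrier (GL N)" and gX: "act g ` planes N a b = planes N a b"
    using g by (auto simp: set_stabilizer_def)
  note gc = GL_carrier[OF gG]
  have "wedge N ?e ?f $$ (i, j) = 1" using ij ab by (simp add: wedge_entry)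
  then have ne: "wedge N ?e ?f \<noteq> 0\<^sub>m N N" using ij ab by auto
  have "?e \<in> coord_space N a" "?f \<in> coord_space N b" using ij ab by (auto simp: coord_space_def)
  then have "line (wedge N ?e ?f) \<in> planes N a b" using ne unfolding planes_def by blast
  then have "act g (line (wedge N ?e ?f)) \<in> planes N a b" using gX by blast
  moreover have "g *\<^sub>v ?e = col g i" "g *\<^sub>v ?f = col g j"
    using gc ij ab by (auto intro!: eq_vecI)
  then have eq: "act g (line (wedge N ?e ?f)) = line (wedge N (col g i) (col g j))"
    and nz: "g * wedge N ?e ?f * transpose_mat g = wedge N (col g i) (col g j)"
    using act_wedge[OF gc, of ?e ?f] congruence_wedge[OF gc, of ?e ?f] by simp_all
  ultimately have "line (wedge N (col g i) (col g j)) \<in> planes N a b" by simp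
  then show "schubert_rel N a b (wedge N (col g i) (col g j))"
    using planes_rel(3)[OF _ _ line_refl] ab by simp
  show "wedge N (col g i) (col g j) \<noteq> 0\<^sub>m N N"
    using congruence_nonzero[OF gG wedge_carrier ne] nz by simp
qed

text \<open>Every index \<open>j < b\<close> occurs in a coordinate point \<open>e k \<and> e l\<close> of \<open>X\<close>, whose image is again a plane in
  \<open>E b\<close>.\<close>

lemma stabilizer_preserves_outer:
  assumes ab: "0 < a" "a < b" "b \<le> N" and g: "g \<in> set_stabilizer N (planes N a b)"
  shows "preserves N b g"
  unfolding preserves_def
proof (intro allI impI)
  fix i j assume i: "i < N" and j: "j < N" and ji: "j < b \<and> b \<le> i"
  have gc: "g \<in> carrier_mat N N" using g by (auto simp: set_stabilizer_def GL_iff)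
  have zero: "g $$ (i, k) = 0 \<and> g $$ (i, l) = 0" if kl: "k < a" "l < b" "k \<noteq> l" for k l
  proof -
    note st = stabilizer_columns[OF ab(2,3) g kl]
    have "wedge N (col g k) (col g l) $$ (i, m) = 0" if "m < N" for m
      using st(2) that i ji unfolding schubert_rel_def by blast
    from wedge_row_zero[OF st(1) i this] show ?thesis using gc i kl ab by simp
  qed
  show "g $$ (i, j) = 0"
  proof (cases "j = 0")
    case True
    then show ?thesis using zero[of 0 1] ab by simp
  next
    case False
    then show ?thesis using zero[of 0 j] ab ji by simp
  qed
qed

text \<open>Let \<open>i < a\<close>, and let \<open>x\<close> be the image of the unit vector at \<open>i\<close>. For each \<open>j < b\<close> the
  image of \<open>e i \<and> e j\<close> lies in \<open>X\<close>, so modulo \<open>E a\<close> the image of every vector of \<open>E b\<close> is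
  proportional to \<open>x\<close>, if \<open>x\<close> is not in \<open>E a\<close>. As \<open>g\<close> maps \<open>E b\<close> onto itself and \<open>E b / E a\<close> has
  dimension at least two, this is impossible. In the calculation \<open>m\<close> is an index of the quotient
  other than \<open>k\<close>.\<close>

lemma stabilizer_preserves_inner:
  assumes ab: "0 < a" "a + 1 < b" "b \<le> N" and g: "g \<in> set_stabilizer N (planes N a b)"
  shows "preserves N a g"
  unfolding preserves_def
proof (intro allI impI)
  fix k i assume k: "k < N" and i: "i < N" and ik: "i < a \<and> a \<le> k"
  have gG: "g \<in> carrier (GL N)" using g by (simp add: set_stabilizer_def)
  have a_b: "a < b" using ab by simp
  define h where "h = inv\<^bsub>GL N\<^esub> g"
  have hc: "h \<in> carrier_mat N N" and gh: "g * h = 1\<^sub>m N" using GL_inv[OF gG] by (simp_all add: h_def)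
  have gc: "g \<in> carrier_mat N N" using gG by (rule GL_carrier)
  have hb: "preserves N b h"
    unfolding h_def by (rule stabilizer_preserves_outer[OF ab(1) a_b ab(3) set_stabilizer_inv[OF planes_subset_proj g]])
  show "g $$ (k, i) = 0"
  proof (cases "b \<le> k")
    case True
    then show ?thesis using stabilizer_preserves_outer[OF ab(1) a_b ab(3) g] k i ik ab
      unfolding preserves_def by simp
  next
    case False
    obtain m where m: "a \<le> m" "m < b" "m \<noteq> k"
    proof (cases "k = a")
      case True
      then show ?thesis using that[of "a + 1"] ab by simp
    next
      case False
      then show ?thesis using that[of a] ab by simp
    qed
    have mN: "m < N" using m ab by simp
    have minors: "g $$ (k, i) * g $$ (m, j) = g $$ (m, i) * g $$ (k, j)" if j: "j < b" for j
    proof (cases "j = i")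
      case False
      have "wedge N (col g i) (col g j) $$ (k, m) = 0"
        using stabilizer_columns(2)[OF a_b ab(3) g _ j, of i] False ik m k mN unfolding schubert_rel_def by auto
      then show ?thesis using gc k mN i j ab by (simp add: wedge_entry algebra_simps)
    qed simp
    have "g $$ (k, i) * (g * h) $$ (m, m) = (\<Sum>j<N. g $$ (k, i) * g $$ (m, j) * h $$ (j, m))"
      using mat_mult_entry[OF gc hc mN mN] by (simp add: sum_distrib_left mult.assoc del: index_mult_mat(1))
    also have "\<dots> = (\<Sum>j<N. g $$ (m, i) * g $$ (k, j) * h $$ (j, m))"
    proof (intro sum.cong refl)
      fix j assume "j \<in> {..<N}"
      then show "g $$ (k, i) * g $$ (m, j) * h $$ (j, m) = g $$ (m, i) * g $$ (k, j) * h $$ (j, m)"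
        using minors[of j] hb m mN by (cases "j < b") (auto simp: preserves_def)
    qed
    also have "\<dots> = g $$ (m, i) * (g * h) $$ (k, m)"
      using mat_mult_entry[OF gc hc k mN] by (simp add: sum_distrib_left mult.assoc del: index_mult_mat(1))
    finally show ?thesis unfolding gh using m k mN by simp
  qed
qed

lemma levi_subgroup_eq_pattern: "levi_subgroup N Q = pattern N (off_blocks (block_steps N Q))"
  unfolding levi_subgroup_def pattern_def off_blocks_def by blast

text \<open>At any other step \<open>d\<close> the elementary matrix with entry at \<open>(d, d - 1)\<close> preserves both \<open>E a\<close> and
  \<open>E b\<close>, hence stabilizes \<open>X\<close> without preserving \<open>E d\<close>.\<close>

lemma block_steps_planes:
  assumes ab: "0 < a" "a < b" "b \<le> N"
  defines "D \<equiv> block_steps N (set_stabilizer N (planes N a b))"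
  shows "D \<subseteq> {a, b}" "b < N \<Longrightarrow> b \<in> D" "a + 1 < b \<Longrightarrow> a \<in> D"
proof -
  show "D \<subseteq> {a, b}"
  proof
    fix d assume "d \<in> D"
    then have d: "0 < d" "d < N"
      and Q: "\<And>g. g \<in> set_stabilizer N (planes N a b) \<Longrightarrow> g $$ (d, d - 1) = 0"
      unfolding D_def block_steps_def by auto
    show "d \<in> {a, b}"
    proof (rule ccontr)
      assume n: "d \<notin> {a, b}"
      have pq: "d < N" "d - 1 < N" "d \<noteq> d - 1" using d by auto
      have "transv N d (d - 1) 1 \<in> set_stabilizer N (planes N a b)"
        using n d preserves_transv[of d _ N] transv_GL[OF pq] by (intro set_stabilizerI) auto
      from Q[OF this] show False using pq by (simp add: emb2_def)
    qed
  qed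
  show "b \<in> D" if "b < N"
    using stabilizer_preserves_outer[OF ab] that ab
    unfolding D_def block_steps_def preserves_def by auto
  show "a \<in> D" if "a + 1 < b"
    using stabilizer_preserves_inner[OF ab(1) that ab(3)] ab
    unfolding D_def block_steps_def preserves_def by auto
qed

text \<open>If \<open>b = a + 1\<close>, the group need not preserve \<open>E a\<close>; but then every plane in \<open>E b\<close> meets \<open>E a\<close> for
  dimension reasons, so that preserving \<open>E b\<close> suffices.\<close>

lemma levi_acts:
  assumes ab: "0 < a" "a < b" "b \<le> N"
    and g: "g \<in> pattern N (off_blocks (block_steps N (set_stabilizer N (planes N a b))))"
    and p: "p \<in> planes N a b"
  shows "act g p \<in> planes N a b"
proof -
  have gG: "g \<in> carrier (GL N)" using g by (simp add: pattern_def)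
  note gc = GL_carrier[OF gG]
  note D = block_steps_planes[OF ab]
  have step: "preserves N d g" if "d \<in> block_steps N (set_stabilizer N (planes N a b))" for d
    unfolding preserves_def
  proof (intro allI impI)
    fix i j assume ij: "i < N" "j < N" "j < d \<and> d \<le> i"
    then have "(i, j) \<in> off_blocks (block_steps N (set_stabilizer N (planes N a b)))"
      using that by (auto simp: off_blocks_def intro!: bexI[of _ d])
    then show "g $$ (i, j) = 0" using g ij by (simp add: pattern_def)
  qed
  have b: "preserves N b g"
  proof (cases "b < N")
    case True
    then show ?thesis using step D(2) by blast
  next
    case False
    then show ?thesis using ab by (auto simp: preserves_def)
  qed
  show ?thesis
  proof (cases "a + 1 < b")
    case True
    then show ?thesis using act_planes[OF gG _ b p] step D(3) by blast
  next
    case False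
    then have ba: "b = Suc a" using ab by simp
    obtain v w where vw: "v \<in> coord_space N a" "w \<in> coord_space N b" "wedge N v w \<noteq> 0\<^sub>m N N"
      and pe: "p = line (wedge N v w)" using p unfolding planes_def by blast
    have c: "v \<in> carrier_vec N" "w \<in> carrier_vec N" using vw by (auto simp: coord_space_def)
    have "v \<in> coord_space N b" using vw(1) ab by (auto simp: coord_space_def)
    then have gv: "g *\<^sub>v v \<in> coord_space N b" "g *\<^sub>v w \<in> coord_space N b"
      using preserves_coord_space[OF gc b] vw(2) by auto
    have "schubert_rel N a b (wedge N (g *\<^sub>v v) (g *\<^sub>v w))"
      unfolding schubert_rel_def
    proof (intro allI impI)
      fix i j assume ij: "i < N" "j < N" "b \<le> i \<or> b \<le> j \<or> a \<le> i \<and> a \<le> j"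
      show "wedge N (g *\<^sub>v v) (g *\<^sub>v w) $$ (i, j) = 0"
      proof (cases "b \<le> i \<or> b \<le> j")
        case True
        then show ?thesis using ij gv by (auto simp: wedge_entry coord_space_def)
      next
        case False
        then have "i = j" using ij ba by simp
        then show ?thesis using ij by (simp add: wedge_entry)
      qed
    qed
    moreover have "wedge N (g *\<^sub>v v) (g *\<^sub>v w) \<noteq> 0\<^sub>m N N"
      using congruence_nonzero[OF gG wedge_carrier vw(3)] congruence_wedge[OF gc c] by simp
    ultimately show ?thesis unfolding pe act_wedge[OF gc c]
      using planesI_rel[OF wedge_carrier wedge_skew _ pluecker_rel_wedge] ab by simp
  qed
qed


section \<open>The open orbit\<close>

lemma hom_poly_fun_congruence:
  assumes f: "f \<in> hom_poly_fun N d" and h: "h \<in> carrier_mat N N"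
  shows "\<exists>f'\<in>hom_poly_fun N d. \<forall>A\<in>carrier_mat N N. f' A = f (h * A * transpose_mat h)"
proof -
  define \<tau> where "\<tau> A = mat N N (\<lambda>(i, j). \<Sum>k<N. \<Sum>l<N. h $$ (i, k) * A $$ (k, l) * h $$ (j, l))"
    for A :: "complex mat"
  have eq: "\<tau> A = h * A * transpose_mat h" if "A \<in> carrier_mat N N" for A
  proof (rule eq_matI)
    fix i j assume "i < dim_row (h * A * transpose_mat h)" "j < dim_col (h * A * transpose_mat h)"
    then have ij: "i < N" "j < N" using h by auto
    then show "\<tau> A $$ (i, j) = (h * A * transpose_mat h) $$ (i, j)"
      unfolding congruence_entry[OF h that ij] by (simp add: \<tau>_def)
  qed (use h in \<open>auto simp: \<tau>_def\<close>)
  have "(\<lambda>A. f (\<tau> A)) \<in> poly_fun N"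
  proof (rule poly_fun_subst[OF hom_poly_fun_D(1)[OF f]])
    fix i j assume "i < N" "j < N"
    then show "(\<lambda>A. \<tau> A $$ (i, j)) \<in> poly_fun N"
      by (simp add: \<tau>_def) (intro poly_fun_sum poly_fun.mult poly_fun.const poly_fun.coord; simp)
  qed
  moreover have "f (\<tau> (c \<cdot>\<^sub>m A)) = c ^ d * f (\<tau> A)" if A: "A \<in> carrier_mat N N" for c A
  proof -
    have "\<tau> (c \<cdot>\<^sub>m A) = c \<cdot>\<^sub>m \<tau> A"
      using A by (intro eq_matI) (auto simp: \<tau>_def sum_distrib_left algebra_simps)
    then show ?thesis using hom_poly_fun_D(2)[OF f, of "\<tau> A" c] by (simp add: \<tau>_def)
  qed
  ultimately show ?thesis
    by (intro bexI[of _ "\<lambda>A. f (\<tau> A)"]) (auto simp: hom_poly_fun_def eq)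
qed

lemma openin_act_image:
  assumes X: "X \<subseteq> proj_space N" and g: "g \<in> carrier (GL N)"
    and pres: "\<And>p. p \<in> X \<Longrightarrow> act g p \<in> X" "\<And>p. p \<in> X \<Longrightarrow> act (inv\<^bsub>GL N\<^esub> g) p \<in> X"
    and V: "openin (subtopology (zariski N) X) V"
  shows "openin (subtopology (zariski N) X) (act g ` V)"
proof -
  let ?T = "subtopology (zariski N) X" and ?h = "inv\<^bsub>GL N\<^esub> g"
  obtain O' where O': "openin (zariski N) O'" "V = O' \<inter> X" using V unfolding openin_subtopology by blast
  have "\<exists>W. openin ?T W \<and> r \<in> W \<and> W \<subseteq> act g ` V" if "r \<in> act g ` V" for r
  proof -
    obtain s where s: "s \<in> V" "r = act g s" using \<open>r \<in> act g ` V\<close> by blast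
    obtain f d where f: "f \<in> hom_poly_fun N d" "s \<in> basic_open N f" "basic_open N f \<subseteq> O'"
      using O' s(1) unfolding openin_zariski_iff by blast
    obtain f' where f': "f' \<in> hom_poly_fun N d"
      "\<And>A. A \<in> carrier_mat N N \<Longrightarrow> f' A = f (?h * A * transpose_mat ?h)"
      using hom_poly_fun_congruence[OF f(1) GL_inv(2)[OF g]] by blast
    have iff: "q \<in> basic_open N f' \<longleftrightarrow> act ?h q \<in> basic_open N f" if q: "q \<in> X" for q
    proof -
      obtain A where A: "q = line A" "A \<in> carrier_mat N N" "A \<noteq> 0\<^sub>m N N"
        using q X by (meson proj_spaceE subsetD)
      have h: "act ?h q = line (?h * A * transpose_mat ?h)" unfolding A(1) using act_line[OF GL_inv(2)[OF g] A(2)] .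
      have "q \<in> basic_open N f' \<longleftrightarrow> f' A \<noteq> 0"
        using hom_nonzero_iff[OF _ _ A(3) f'(1), of q] q X A(1) line_refl[of A] by auto
      moreover have "act ?h q \<in> basic_open N f \<longleftrightarrow> f (?h * A * transpose_mat ?h) \<noteq> 0"
        using hom_nonzero_iff[OF _ _ congruence_nonzero[OF GL_inv(1)[OF g] A(2,3)] f(1), of "act ?h q"]
          pres(2)[OF q] X h line_refl[of "?h * A * transpose_mat ?h"] by auto
      ultimately show ?thesis using f'(2)[OF A(2)] by simp
    qed
    have sX: "s \<in> X" using s(1) O'(2) by blast
    have "r \<in> X \<inter> basic_open N f'"
      using iff[of r] pres(1)[OF sX] act_inv(2)[OF g, of s] sX X s(2) f(2) by auto
    moreover have "X \<inter> basic_open N f' \<subseteq> act g ` V"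
    proof
      fix q assume q: "q \<in> X \<inter> basic_open N f'"
      then have "act ?h q \<in> V" using iff[of q] f(3) O'(2) pres(2)[of q] by blast
      moreover have "q = act g (act ?h q)" using act_inv(1)[OF g, of q] q X by auto
      ultimately show "q \<in> act g ` V" by blast
    qed
    moreover have "openin ?T (X \<inter> basic_open N f')"
      using openin_basic_open[OF f'(1)] openin_subtopology_Int2 by blast
    ultimately show ?thesis by blast
  qed
  then show ?thesis by (subst openin_subopen) blast
qed

text \<open>The base point is the plane spanned by \<open>e a\<close> and \<open>e (a - 1) + e b\<close> (by \<open>e a\<close> and \<open>e b\<close> if \<open>a = 1\<close>),
  with indices starting at \<open>1\<close>. A plane spanned by \<open>v \<in> E a\<close> and \<open>w \<in> E b\<close> with \<open>v\<close> nonzero at \<open>a\<close>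
  has a second basis vector \<open>w'\<close> that vanishes at \<open>a\<close>. The matrix \<open>g\<close> with column \<open>a\<close> equal to \<open>v\<close>
  and with columns \<open>a - 1\<close> and \<open>b\<close> equal to the parts of \<open>w'\<close> in \<open>E a\<close> and beyond maps the
  base point to this plane. It is block diagonal and upper triangular, and it is invertible exactly
  if the two coordinates in the definition of \<open>f\<close> do not vanish.\<close>

lemma open_orbit_point:
  assumes ab: "0 < a" "a < b" "b \<le> N"
  shows "\<exists>p f d. p \<in> planes N a b \<and> f \<in> hom_poly_fun N d \<and> p \<in> basic_open N f \<and>
    planes N a b \<inter> basic_open N f \<subseteq> orbit_of (pattern N (off_blocks {a, b} \<union> below_diag)) p"
proof -
  let ?H = "pattern N (off_blocks {a, b} \<union> below_diag)"
  define v0 :: "complex vec" where "v0 = unit_vec N (a - 1)"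
  define w0 :: "complex vec"
    where "w0 = vec N (\<lambda>k. if k = b - 1 \<or> (Suc k = a - 1) then 1 else 0)"
  define f where "f A = A $$ (a - 1, b - 1) * (if a = 1 then 1 else A $$ (a - 2, a - 1))" for A :: "complex mat"
  define p where "p = line (wedge N v0 w0)"
  have aN: "a - 1 < N" "b - 1 < N" "a - 2 < N" "a - 1 < b - 1" using ab by auto
  have c0: "v0 \<in> carrier_vec N" "w0 \<in> carrier_vec N" by (simp_all add: v0_def w0_def)
  have f: "f \<in> hom_poly_fun N (1 + (if a = 1 then 0 else 1))"
  proof (cases "a = 1")
    case True
    then show ?thesis unfolding f_def[abs_def] using hom_poly_fun_coord[OF aN(1,2)] by simp
  next
    case False
    then show ?thesis unfolding f_def[abs_def]
      using hom_poly_fun_mult[OF hom_poly_fun_coord[OF aN(1,2)] hom_poly_fun_coord[OF aN(3,1)]] by simp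
  qed
  have f0: "f (wedge N v0 w0) \<noteq> 0"
    using aN ab by (auto simp: f_def wedge_entry v0_def w0_def)
  then have ne0: "wedge N v0 w0 \<noteq> 0\<^sub>m N N" using aN by (auto simp: f_def)
  have "v0 \<in> coord_space N a" "w0 \<in> coord_space N b"
    using ab by (auto simp: coord_space_def v0_def w0_def)
  then have p: "p \<in> planes N a b" using ne0 unfolding p_def planes_def by blast
  have pf: "p \<in> basic_open N f"
    using hom_nonzero_iff[OF _ _ ne0 f, of p] p planes_subset_proj[of N a b] f0 line_refl[of "wedge N v0 w0"]
    unfolding p_def by auto
  have "q \<in> orbit_of ?H p" if q: "q \<in> planes N a b" "q \<in> basic_open N f" for q
  proof -
    obtain v w where vw: "v \<in> coord_space N a" "w \<in> coord_space N b" "wedge N v w \<noteq> 0\<^sub>m N N"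
      and qe: "q = line (wedge N v w)" using q(1) unfolding planes_def by blast
    have c: "v \<in> carrier_vec N" "w \<in> carrier_vec N" using vw by (auto simp: coord_space_def)
    have fq: "f (wedge N v w) \<noteq> 0"
      using hom_nonzero_iff[OF _ _ vw(3) f, of q] q planes_subset_proj[of N a b] line_refl[of "wedge N v w"]
      unfolding qe by auto
    have "v $ (b - 1) = 0" using vw(1) aN by (auto simp: coord_space_def)
    then have d1: "v $ (a - 1) \<noteq> 0" "w $ (b - 1) \<noteq> 0"
      using fq aN by (auto simp: f_def wedge_entry)
    define w' where "w' = (- w $ (a - 1) / v $ (a - 1)) \<cdot>\<^sub>v v + 1 \<cdot>\<^sub>v w"
    have c': "w' \<in> carrier_vec N" using c by (simp add: w'_def)
    have w'k: "w' $ k = w $ k - w $ (a - 1) / v $ (a - 1) * v $ k" if "k < N" for k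
      using c that by (simp add: w'_def)
    have ww': "wedge N v w' = wedge N v w"
    proof -
      have "1 \<cdot>\<^sub>v v + 0 \<cdot>\<^sub>v w = v" using c by (intro eq_vecI) auto
      then have "wedge N v w' = 1 \<cdot>\<^sub>m wedge N v w"
        using wedge_comb[OF c, of 1 0 "- w $ (a - 1) / v $ (a - 1)" 1] unfolding w'_def by simp
      also have "\<dots> = wedge N v w" by (rule eq_matI) auto
      finally show ?thesis .
    qed
    have w'0: "w' $ (a - 1) = 0" using w'k[OF aN(1)] d1 by simp
    have w'b: "w' $ (b - 1) \<noteq> 0" using w'k[OF aN(2)] d1 \<open>v $ (b - 1) = 0\<close> by simp
    have w'out: "w' $ k = 0" if "b \<le> k" "k < N" for k
      using w'k[OF that(2)] that vw ab by (auto simp: coord_space_def)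
    have w'a: "w' $ (a - 2) \<noteq> 0" if "a \<noteq> 1"
    proof
      assume "w' $ (a - 2) = 0"
      then have "wedge N v w' $$ (a - 2, a - 1) = 0" using aN w'0 by (simp add: wedge_entry)
      then show False using fq that unfolding ww' f_def by simp
    qed
    define g where "g = mat N N (\<lambda>(i, j). if j = a - 1 then v $ i
      else if j = b - 1 then if a \<le> i then w' $ i else 0
      else if Suc j = a - 1 then if i < a then w' $ i else 0
      else if i = j then 1 else (0 :: complex))"
    have gc: "g \<in> carrier_mat N N" by (simp add: g_def)
    have zero: "g $$ (i, j) = 0" if ij: "i < N" "j < N" "(i, j) \<in> off_blocks {a, b} \<union> below_diag" for i j
    proof -
      have cases: "j < i \<or> (i < a) \<noteq> (j < a) \<or> (i < b) \<noteq> (j < b)"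
        using ij(3) by (auto simp: off_blocks_def below_diag_def)
      consider "j = a - 1" | "j = b - 1" "j \<noteq> a - 1" | "Suc j = a - 1" "j \<noteq> b - 1" "j \<noteq> a - 1"
        | "j \<noteq> a - 1" "j \<noteq> b - 1" "Suc j \<noteq> a - 1" by blast
      then show ?thesis
      proof cases
        case 1
        then have "a \<le> i" using cases ab by auto
        then show ?thesis using 1 ij vw(1) by (simp add: g_def coord_space_def)
      next
        case 2
        then have "b \<le> i \<or> i < a" using cases ab by auto
        then show ?thesis using 2 ij w'out by (auto simp: g_def)
      next
        case 3
        then have "a - 1 \<le> i" using cases ab by auto
        then have "i = a - 1 \<or> a \<le> i" by auto
        then show ?thesis using 3 ij w'0 by (auto simp: g_def)
      next
        case 4
        then show ?thesis using cases ij by (auto simp: g_def)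
      qed
    qed
    have up: "upper_triangular g"
      using zero gc by (intro upper_triangularI) (auto simp: below_diag_def)
    have diag: "g $$ (i, i) \<noteq> 0" if "i < N" for i
    proof (cases "Suc i = a - 1")
      case True
      then have "i = a - 2" "a \<noteq> 1" by auto
      then show ?thesis using True that w'a aN ab by (simp add: g_def)
    next
      case False
      then show ?thesis using that d1 w'b ab by (auto simp: g_def)
    qed
    have "g \<in> carrier (GL N)"
      using upper_triangular_imp_det_eq_0_iff[OF gc up] gc diag by (auto simp: GL_iff diag_mat_def)
    then have gH: "g \<in> ?H" using zero by (simp add: pattern_def)
    have gv: "g *\<^sub>v v0 = v"
      using c gc aN by (intro eq_vecI) (auto simp: g_def v0_def)
    have "g *\<^sub>v w0 = w'"
    proof (rule eq_vecI)
      fix i assume "i < dim_vec w'"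
      then have i: "i < N" using c' by simp
      have "(g *\<^sub>v w0) $ i = (\<Sum>k<N. g $$ (i, k) * w0 $ k)" by (rule mult_mat_vec_entry[OF gc c0(2) i])
      also have "\<dots> = (\<Sum>k<N. if k = b - 1 \<or> Suc k = a - 1 then g $$ (i, k) else 0)"
        by (intro sum.cong) (auto simp: w0_def)
      also have "\<dots> = (\<Sum>k\<in>{k. k < N \<and> (k = b - 1 \<or> Suc k = a - 1)}. g $$ (i, k))"
        by (simp add: sum.If_cases lessThan_def Collect_conj_eq[symmetric])
      also have "{k. k < N \<and> (k = b - 1 \<or> Suc k = a - 1)} = (if a = 1 then {b - 1} else {b - 1, a - 2})"
        using aN ab by auto
      also have "(\<Sum>k\<in>\<dots>. g $$ (i, k)) = w' $ i"
      proof (cases "a = 1")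
        case True
        then show ?thesis using i aN w'0 by (cases "i = 0") (auto simp: g_def)
      next
        case False
        then have "Suc (a - 2) = a - 1" "b - 1 \<noteq> a - 2" "a - 2 \<noteq> a - 1" using ab by auto
        then show ?thesis using False i aN by (auto simp: g_def)
      qed
      finally show "(g *\<^sub>v w0) $ i = w' $ i" .
    qed (use gc c' in auto)
    then have "act g p = q" unfolding p_def qe act_wedge[OF gc c0] gv ww'[symmetric] by simp
    then show ?thesis using gH unfolding orbit_of_def by blast
  qed
  then show ?thesis using p f pf by blast
qed

theorem corollary4p1p8:
  fixes N l1 l2 :: nat
  assumes "N > 2" and "1 \<le> l1" and "l1 < l2" and "l2 \<le> N"
  shows "spherical_variety N
    (levi_subgroup N (set_stabilizer N (schubert N l1 l2))) (schubert N l1 l2)"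
proof -
  have ab: "0 < l1" "l1 < l2" "l2 \<le> N" using assms by auto
  let ?X = "planes N l1 l2" and ?T = "subtopology (zariski N) (planes N l1 l2)"
  define D where "D = block_steps N (set_stabilizer N ?X)"
  let ?L = "pattern N (off_blocks D)" and ?H = "pattern N (off_blocks D \<union> below_diag)"
  interpret G: group "GL N" by (rule group_GL)
  have X: "schubert N l1 l2 = ?X" using assms by (intro schubert_eq_planes) auto
  have L: "levi_subgroup N (set_stabilizer N ?X) = ?L" by (simp add: levi_subgroup_eq_pattern D_def)
  have top: "topspace ?T = ?X" using planes_subset_proj by auto
  have acts: "act g p \<in> ?X" if "g \<in> ?L" "p \<in> ?X" for g p
    using levi_acts[OF ab] that by (simp add: D_def)
  obtain p f d where p: "p \<in> ?X" "f \<in> hom_poly_fun N d" "p \<in> basic_open N f"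
    and orb: "?X \<inter> basic_open N f \<subseteq> orbit_of (pattern N (off_blocks {l1, l2} \<union> below_diag)) p"
    using open_orbit_point[OF ab] by blast
  let ?O = "orbit_of ?H p" and ?V = "?X \<inter> basic_open N f"
  have HL: "?H \<subseteq> ?L" by (auto simp: pattern_Un)
  have "pattern N (off_blocks {l1, l2} \<union> below_diag) \<subseteq> ?H"
    using block_steps_planes(1)[OF ab] unfolding pattern_def off_blocks_def D_def by blast
  then have VO: "?V \<subseteq> ?O" using orb unfolding orbit_of_def by blast
  have V: "openin ?T ?V" using openin_basic_open[OF p(2)] openin_subtopology_Int2 by blast
  have openO: "openin ?T ?O"
  proof -
    have "\<exists>W. openin ?T W \<and> r \<in> W \<and> W \<subseteq> ?O" if "r \<in> ?O" for r
    proof -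
      obtain g where g: "g \<in> ?H" "r = act g p" using \<open>r \<in> ?O\<close> unfolding orbit_of_def by blast
      have gG: "g \<in> carrier (GL N)" using g by (simp add: pattern_def)
      have "inv\<^bsub>GL N\<^esub> g \<in> ?L" using g HL subgroup.m_inv_closed[OF subgroup_blocks] by blast
      then have "openin ?T (act g ` ?V)"
        using openin_act_image[OF planes_subset_proj gG _ _ V] acts g(1) HL by blast
      moreover have "act g ` ?V \<subseteq> ?O"
      proof
        fix s assume "s \<in> act g ` ?V"
        then obtain h where h: "h \<in> ?H" "s = act g (act h p)" using VO unfolding orbit_of_def by blast
        have "s = act (g * h) p"
          using act_act[of g N h p] GL_carrier[OF gG] h p(1) planes_subset_proj
          by (auto simp: pattern_def GL_iff)
        moreover have "g * h \<in> ?H" using subgroup.m_closed[OF subgroup_upper_blocks g(1) h(1)] by simp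
        ultimately show "s \<in> ?O" unfolding orbit_of_def by blast
      qed
      ultimately show ?thesis using g(2) p by blast
    qed
    then show ?thesis by (subst openin_subopen) blast
  qed
  have "?T closure_of ?O = ?X"
  proof (intro equalityI subsetI)
    fix q assume q: "q \<in> ?X"
    show "q \<in> ?T closure_of ?O" unfolding in_closure_of top
    proof (intro conjI allI impI q)
      fix W assume W: "q \<in> W \<and> openin ?T W"
      have "p \<in> ?O" using VO p by blast
      then have "W \<inter> ?O \<noteq> {}"
        using irreducible_variety_planes[OF ab] W openO
        unfolding irreducible_variety_def irreducible_space_def by blast
      then show "\<exists>y. y \<in> ?O \<and> y \<in> W" by blast
    qed
  qed (use closure_of_subset_topspace[of ?T ?O] top in blast)
  then show ?thesis
    unfolding X L spherical_variety_def
    using connected_reductive_blocks irreducible_variety_planes[OF ab] acts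
      normal_variety_planes[OF ab] borel_subgroup_upper_blocks p(1) openO by blast
qed

end
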